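(* Let $k,r\in\mathbb{N}_0$ with $r>0$. Let $T$ be a simplex of dimension $n$ and let $F\subseteq T$ be a subsimplex of dimension $m$. If $S\in\mathrm{Sym}(T)$, then $$\mathrm{ext}^{k,r}_{F,T}\,S_{|F}^{*}=S^{*}\,\mathrm{ext}^{k,r}_{SF,T}\quad\text{on }\mathring{\mathcal{P}}_r\Lambda^k(SF),\qquad \mathrm{ext}^{k,r,-}_{F,T}\,S_{|F}^{*}=S^{*}\,\mathrm{ext}^{k,r,-}_{SF,T}\quad\text{on }\mathring{\mathcal{P}}^-_r\Lambda^k(SF).$$
   Context: **Simplices.** An $n$-simplex $T$ is the convex hull of affinely independent points $v_0,\dots,v_n$ in a Euclidean space, with this vertex order fixed. A subsimplex $F\subseteq T$ is the convex hull of a nonempty subset of the vertices, ordered compatibly with $T$; if $\dim F=m$, $\imath(F,T):[0:m]\to[0:n]$ (where $[0:n]=\{0,\dots,n\}$) is the strictly increasing map sending vertex indices of $F$ to the corresponding vertex indices of $T$, with range $[\imath(F,T)]$. $\mathrm{Sym}(T)$ is the group of affine automorphisms of $T$. For $S\in\mathrm{Sym}(T)$, $SF=S(F)$ is again a subsimplex of dimension $m$, and $S_{|F}:F\to SF$ is the restriction, an affine diffeomorphism with pullback $S_{|F}^*$ mapping forms on $SF$ to forms on $F$. **Forms and spaces** (coefficients in $\mathbb{F}\in\{\mathbb{R},\mathbb{C}\}$). $\lambda^T_0,\dots,\lambda^T_n$ are the barycentric coordinates of $T$, $d\lambda^T_i$ their exterior derivatives. $A(r,n)$ is the set of $\alpha:[0:n]\to\mathbb{N}_0$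 with $|\alpha|:=\sum_i\alpha(i)=r$; $[\alpha]=\{i:\alpha(i)>0\}$; $\lambda_T^\alpha=\prod_i(\lambda_i^T)^{\alpha(i)}$. $\Sigma(k,n)$ and $\Sigma_0(k,n)$ are the sets of strictly increasing maps $\{1,\dots,k\}\to[0:n]$ and $\{0,\dots,k\}\to[0:n]$ ($\Sigma(0,n)=\{\emptyset\}$); $[\sigma]$ denotes the range. $d\lambda^T_\sigma=d\lambda^T_{\sigma(1)}\wedge\dots\wedge d\lambda^T_{\sigma(k)}$ ($=1$ if $k=0$) and $\phi^T_\rho=\sum_{i=0}^k(-1)^i\lambda^T_{\rho(i)}\,d\lambda^T_{\rho(0)}\wedge\dots\widehat{d\lambda^T_{\rho(i)}}\dots\wedge d\lambda^T_{\rho(k)}$. $\mathcal{P}_r\Lambda^k(T)$ is the span of all $\lambda_T^\alpha d\lambda^T_\sigma$ ($\alpha\in A(r,n)$, $\sigma\in\Sigma(k,n)$) and $\mathcal{P}_r^-\Lambda^k(T)$ the span of all $\lambda_T^\alpha\phi^T_\rho$ ($\alpha\in A(r-1,n)$, $\rho\in\Sigma_0(k,n)$); they are zero for $k\notin[0:n]$. $\mathring{\mathcal{P}}_r\Lambda^k(T)$ and $\mathring{\mathcal{P}}_r^-\Lambda^k(T)$ are the subspaces of forms whose pullback to every proper subsimplex of $T$ vanishes. For $r\ge1$ they are spanned, respectively, by the $\lambda_T^\alpha d\lambda_\sigma^T$ with $\alpha\in A(r,n)$, $[\alpha]\cup[\sigma]=[0:n]$, and by the $\lambda_T^\alpha\phi_\rho^T$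 with $\alpha\in A(r-1,n)$, $[\alpha]\cup[\rho]=[0:n]$. **Extension operators** ($r\ge1$). For a multiindex $\alpha$ on $[0:m]$, $\tilde\alpha$ is the multiindex on $[0:n]$ with $\tilde\alpha\circ\imath(F,T)=\alpha$ and zero outside $[\imath(F,T)]$; $\tilde\sigma=\imath(F,T)\circ\sigma$, $\tilde\rho=\imath(F,T)\circ\rho$. The map $\mathrm{ext}^{k,r,-}_{F,T}:\mathring{\mathcal{P}}_r^-\Lambda^k(F)\to\mathcal{P}_r^-\Lambda^k(T)$ is the well-defined linear map with $\lambda_F^\alpha\phi^F_\rho\mapsto\lambda_T^{\tilde\alpha}\phi^T_{\tilde\rho}$ for all $\alpha\in A(r-1,m)$ and $\rho\in\Sigma_0(k,m)$ with $[\alpha]\cup[\rho]=[0:m]$ (these $\lambda_F^\alpha\phi^F_\rho$ span $\mathring{\mathcal{P}}_r^-\Lambda^k(F)$). The map $\mathrm{ext}^{k,r}_{F,T}:\mathring{\mathcal{P}}_r\Lambda^k(F)\to\mathcal{P}_r\Lambda^k(T)$ is the well-defined linear map with $\lambda_F^\alpha d\lambda^F_\sigma\mapsto\lambda_T^{\tilde\alpha}\,\Psi^{\tilde\alpha,F,T}_{\tilde\sigma(1)}\wedge\dots\wedge\Psi^{\tilde\alpha,F,T}_{\tilde\sigma(k)}$ for all $\alpha\in A(r,m)$ and $\sigma\in\Sigma(k,m)$ with $[\alpha]\cup[\sigma]=[0:m]$ (these $\lambda_F^\alpha d\lambda^F_\sigma$ span $\mathring{\mathcal{P}}_r\Lambda^k(F)$),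 where $\Psi^{\beta,F,T}_i=d\lambda^T_i-\frac{\beta(i)}{|\beta|}\sum_{j\in[\imath(F,T)]}d\lambda_j^T$. *)

theory Defs
  imports
    "HOL-Analysis.Analysis"
    "HOL-Library.Function_Algebras"
    "HOL-Library.FuncSet"
    "HOL-Library.Sublist"
    "HOL-Combinatorics.Permutations"
begin

section \<open>Ordered simplices\<close>

text \<open>
  An ordered simplex is the list of its vertices \<open>v\<^sub>0, \<dots>, v\<^sub>n\<close>; the point set is its body.
  Vertex indices are list positions.
\<close>

definition is_simplex :: "nat \<Rightarrow> 'a::euclidean_space list \<Rightarrow> bool" where
  "is_simplex n T \<longleftrightarrow> length T = Suc n \<and> distinct T \<and> \<not> affine_dependent (set T)"

definition body :: "'a::euclidean_space list \<Rightarrow> 'a set" where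
  "body T = convex hull (set T)"

definition sdim :: "'a list \<Rightarrow> nat" where
  "sdim T = length T - 1"

text \<open>The order of a subsimplex is compatible with that of \<open>T\<close>, hence \<^const>\<open>subseq\<close>.\<close>

definition subsimplex :: "'a list \<Rightarrow> 'a list \<Rightarrow> bool" where
  "subsimplex F T \<longleftrightarrow> F \<noteq> [] \<and> subseq F T"

definition tangent :: "'a::euclidean_space list \<Rightarrow> 'a set" where
  "tangent T = span {v - w | v w. v \<in> set T \<and> w \<in> set T}"

text \<open>The map \<open>\<imath>(F,T)\<close> from vertex indices of \<open>F\<close> to vertex indices of \<open>T\<close>, and its range.\<close>

definition vidx :: "'a list \<Rightarrow> 'a list \<Rightarrow> nat \<Rightarrow> nat" where
  "vidx F T i = (THE j. j < length T \<and> T ! j = F ! i)"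

definition vidx_range :: "'a list \<Rightarrow> 'a list \<Rightarrow> nat set" where
  "vidx_range F T = vidx F T ` {0..sdim F}"

text \<open>
  Maps are only constrained on the body of \<open>T\<close>; preserving convex combinations there is the same
  as being affine there.
\<close>

definition Sym :: "'a::euclidean_space list \<Rightarrow> ('a \<Rightarrow> 'a) set" where
  "Sym T = {S. bij_betw S (body T) (body T) \<and>
     (\<forall>x\<in>body T. \<forall>y\<in>body T. \<forall>t\<in>{0..1}.
        S ((1 - t) *\<^sub>R x + t *\<^sub>R y) = (1 - t) *\<^sub>R S x + t *\<^sub>R S y)}"

text \<open>
  The subsimplex \<open>SF\<close> of \<open>T\<close>: it carries the vertex order of \<open>T\<close>, which in general is not the
  order that \<open>S\<close> transports from \<open>F\<close>.
\<close>

definition image_simplex :: "('a \<Rightarrow> 'a) \<Rightarrow> 'a list \<Rightarrow> 'a list \<Rightarrow> 'a list" where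
  "image_simplex S F T = filter (\<lambda>v. v \<in> S ` set F) T"


section \<open>Differential forms on a simplex\<close>

text \<open>
  A \<open>k\<close>-form takes a point and a list of \<open>k\<close> tangent vectors. Forms on \<open>T\<close> are normalised to be
  \<open>0\<close> off the body of \<open>T\<close>, off its tangent space, and on lists of the wrong length, so that
  equality of forms on \<open>T\<close> is equality of functions. The coefficient type ranges over
  \<open>real_normed_field\<close>, with instances \<open>real\<close> and \<open>complex\<close>.
\<close>

type_synonym ('a, 'f) form = "'a \<Rightarrow> 'a list \<Rightarrow> 'f"

definition form_on ::
  "'a::euclidean_space list \<Rightarrow> nat \<Rightarrow> ('a, 'f::real_normed_field) form \<Rightarrow> ('a, 'f) form" where
  "form_on T k \<omega> = (\<lambda>x vs. if x \<in> body T \<and> length vs = k \<and> set vs \<subseteq> tangent T then \<omega> x vs else 0)"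

definition form_scale :: "'f::real_normed_field \<Rightarrow> ('a, 'f) form \<Rightarrow> ('a, 'f) form" where
  "form_scale c \<omega> = (\<lambda>x vs. c * \<omega> x vs)"

global_interpretation form: vector_space
  "form_scale :: 'f::real_normed_field \<Rightarrow> ('a, 'f) form \<Rightarrow> ('a, 'f) form"
  by unfold_locales (auto simp: form_scale_def fun_eq_iff algebra_simps)

definition fun_mult ::
  "('a \<Rightarrow> real) \<Rightarrow> ('a, 'f::real_normed_field) form \<Rightarrow> ('a, 'f) form" where
  "fun_mult f \<omega> = (\<lambda>x vs. of_real (f x) * \<omega> x vs)"

text \<open>
  Exterior derivative of a function on \<open>T\<close>. The derivative within the body of \<open>T\<close> is unique on
  tangent vectors, and only those are used.
\<close>

definition differential ::
  "'a::euclidean_space list \<Rightarrow> ('a \<Rightarrow> real) \<Rightarrow> ('a, 'f::real_normed_field) form" where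
  "differential T f =
     form_on T 1 (\<lambda>x vs. of_real (frechet_derivative f (at x within body T) (vs ! 0)))"

text \<open>
  Exterior product of a list of 1-forms, in the convention
  \<open>(\<omega>\<^sub>1 \<and> \<dots> \<and> \<omega>\<^sub>k)(v\<^sub>1, \<dots>, v\<^sub>k) = det (\<omega>\<^sub>i(v\<^sub>j))\<close>; the empty product is the constant \<open>1\<close>.
\<close>

definition wedge ::
  "'a::euclidean_space list \<Rightarrow> ('a, 'f::real_normed_field) form list \<Rightarrow> ('a, 'f) form" where
  "wedge T \<omega>s = form_on T (length \<omega>s)
     (\<lambda>x vs. \<Sum>p | p permutes {..<length \<omega>s}.
        of_int (sign p) * (\<Prod>i<length \<omega>s. (\<omega>s ! i) x [vs ! p i]))"

text \<open>Pullback along \<open>f\<close>, defined on \<open>F\<close>, of a \<open>k\<close>-form given on the simplex \<open>f(F)\<close> or a larger one.\<close>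

definition pullback ::
  "'a::euclidean_space list \<Rightarrow> nat \<Rightarrow> ('a \<Rightarrow> 'a) \<Rightarrow> ('a, 'f::real_normed_field) form \<Rightarrow> ('a, 'f) form"
  where
  "pullback F k f \<omega> =
     form_on F k (\<lambda>x vs. \<omega> (f x) (map (frechet_derivative f (at x within body F)) vs))"


section \<open>Barycentric coordinates, multiindices, increasing maps\<close>

definition bary :: "'a::euclidean_space list \<Rightarrow> nat \<Rightarrow> 'a \<Rightarrow> real" where
  "bary T i x = (THE u. (\<forall>j\<ge>length T. u j = 0) \<and> (\<Sum>j<length T. u j) = 1 \<and>
                        (\<Sum>j<length T. u j *\<^sub>R (T ! j)) = x) i"

definition dbary :: "'a::euclidean_space list \<Rightarrow> nat \<Rightarrow> ('a, 'f::real_normed_field) form" where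
  "dbary T i = differential T (bary T i)"

definition multiindices :: "nat \<Rightarrow> nat \<Rightarrow> (nat \<Rightarrow> nat) set" where
  "multiindices r n = {\<alpha>. (\<forall>i>n. \<alpha> i = 0) \<and> (\<Sum>i\<le>n. \<alpha> i) = r}"

definition supp :: "(nat \<Rightarrow> nat) \<Rightarrow> nat set" where
  "supp \<alpha> = {i. \<alpha> i > 0}"

text \<open>
  A strictly increasing map from a \<open>k\<close>-element interval to \<open>[0:n]\<close> is the list of its values, so
  \<open>\<Sigma>(k,n)\<close> is \<open>increasing k n\<close> and \<open>\<Sigma>\<^sub>0(k,n)\<close> is \<open>increasing (k + 1) n\<close>; the range is the list's set.
\<close>

definition increasing :: "nat \<Rightarrow> nat \<Rightarrow> nat list set" where
  "increasing k n = {\<sigma>. length \<sigma> = k \<and> sorted_wrt (<) \<sigma> \<and> set \<sigma> \<subseteq> {0..n}}"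

definition bary_monom :: "'a::euclidean_space list \<Rightarrow> (nat \<Rightarrow> nat) \<Rightarrow> 'a \<Rightarrow> real" where
  "bary_monom T \<alpha> x = (\<Prod>i\<le>sdim T. bary T i x ^ \<alpha> i)"

definition dbary_wedge ::
  "'a::euclidean_space list \<Rightarrow> nat list \<Rightarrow> ('a, 'f::real_normed_field) form" where
  "dbary_wedge T \<sigma> = wedge T (map (dbary T) \<sigma>)"

definition whitney ::
  "'a::euclidean_space list \<Rightarrow> nat list \<Rightarrow> ('a, 'f::real_normed_field) form" where
  "whitney T \<rho> = (\<Sum>i<length \<rho>. form_scale ((-1) ^ i)
     (fun_mult (bary T (\<rho> ! i)) (dbary_wedge T (take i \<rho> @ drop (Suc i) \<rho>))))"


section \<open>Spaces of polynomial forms\<close>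

definition Pfull ::
  "nat \<Rightarrow> nat \<Rightarrow> 'a::euclidean_space list \<Rightarrow> ('a, 'f::real_normed_field) form set" where
  "Pfull r k T = form.span
     {fun_mult (bary_monom T \<alpha>) (dbary_wedge T \<sigma>) | \<alpha> \<sigma>.
        \<alpha> \<in> multiindices r (sdim T) \<and> \<sigma> \<in> increasing k (sdim T)}"

definition Pminus ::
  "nat \<Rightarrow> nat \<Rightarrow> 'a::euclidean_space list \<Rightarrow> ('a, 'f::real_normed_field) form set" where
  "Pminus r k T = form.span
     {fun_mult (bary_monom T \<alpha>) (whitney T \<rho>) | \<alpha> \<rho>.
        r \<ge> 1 \<and> \<alpha> \<in> multiindices (r - 1) (sdim T) \<and> \<rho> \<in> increasing (k + 1) (sdim T)}"

definition vanishing_traces ::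
  "nat \<Rightarrow> 'a::euclidean_space list \<Rightarrow> ('a, 'f::real_normed_field) form set" where
  "vanishing_traces k T = {\<omega>. \<forall>G. subsimplex G T \<and> G \<noteq> T \<longrightarrow> pullback G k (\<lambda>x. x) \<omega> = 0}"

definition Pfull0 ::
  "nat \<Rightarrow> nat \<Rightarrow> 'a::euclidean_space list \<Rightarrow> ('a, 'f::real_normed_field) form set" where
  "Pfull0 r k T = Pfull r k T \<inter> vanishing_traces k T"

definition Pminus0 ::
  "nat \<Rightarrow> nat \<Rightarrow> 'a::euclidean_space list \<Rightarrow> ('a, 'f::real_normed_field) form set" where
  "Pminus0 r k T = Pminus r k T \<inter> vanishing_traces k T"


section \<open>Extension operators\<close>

definition multi_push :: "'a list \<Rightarrow> 'a list \<Rightarrow> (nat \<Rightarrow> nat) \<Rightarrow> nat \<Rightarrow> nat" where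
  "multi_push F T \<alpha> j =
     (if j \<in> vidx_range F T then \<alpha> (the_inv_into {0..sdim F} (vidx F T) j) else 0)"

definition Psi ::
  "(nat \<Rightarrow> nat) \<Rightarrow> 'a::euclidean_space list \<Rightarrow> 'a list \<Rightarrow> nat \<Rightarrow> ('a, 'f::real_normed_field) form" where
  "Psi \<beta> F T i = dbary T i -
     form_scale (of_nat (\<beta> i) / of_nat (\<Sum>j\<le>sdim T. \<beta> j)) (\<Sum>j\<in>vidx_range F T. dbary T j)"

definition form_linear_on ::
  "('a, 'f::real_normed_field) form set \<Rightarrow> (('a, 'f) form \<Rightarrow> ('a, 'f) form) \<Rightarrow> bool" where
  "form_linear_on V E \<longleftrightarrow>
     (\<forall>\<omega>\<in>V. \<forall>\<eta>\<in>V. E (\<omega> + \<eta>) = E \<omega> + E \<eta>) \<and>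
     (\<forall>c. \<forall>\<omega>\<in>V. E (form_scale c \<omega>) = form_scale c (E \<omega>))"

text \<open>
  The extension operators for \<open>r \<ge> 1\<close>: the unique linear maps with the prescribed values on
  spanning sets of the spaces with vanishing traces. The extensional function space makes the map
  itself unique.
\<close>

definition ext_full ::
  "nat \<Rightarrow> nat \<Rightarrow> 'a::euclidean_space list \<Rightarrow> 'a list \<Rightarrow>
     ('a, 'f::real_normed_field) form \<Rightarrow> ('a, 'f) form" where
  "ext_full k r F T = (THE E.
     E \<in> Pfull0 r k F \<rightarrow>\<^sub>E Pfull r k T \<and> form_linear_on (Pfull0 r k F) E \<and>
     (\<forall>\<alpha>\<in>multiindices r (sdim F). \<forall>\<sigma>\<in>increasing k (sdim F).
        supp \<alpha> \<union> set \<sigma> = {0..sdim F} \<longrightarrow>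
        E (fun_mult (bary_monom F \<alpha>) (dbary_wedge F \<sigma>)) =
          fun_mult (bary_monom T (multi_push F T \<alpha>))
            (wedge T (map (Psi (multi_push F T \<alpha>) F T) (map (vidx F T) \<sigma>)))))"

definition ext_minus ::
  "nat \<Rightarrow> nat \<Rightarrow> 'a::euclidean_space list \<Rightarrow> 'a list \<Rightarrow>
     ('a, 'f::real_normed_field) form \<Rightarrow> ('a, 'f) form" where
  "ext_minus k r F T = (THE E.
     E \<in> Pminus0 r k F \<rightarrow>\<^sub>E Pminus r k T \<and> form_linear_on (Pminus0 r k F) E \<and>
     (\<forall>\<alpha>\<in>multiindices (r - 1) (sdim F). \<forall>\<rho>\<in>increasing (k + 1) (sdim F).
        supp \<alpha> \<union> set \<rho> = {0..sdim F} \<longrightarrow>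
        E (fun_mult (bary_monom F \<alpha>) (whitney F \<rho>)) =
          fun_mult (bary_monom T (multi_push F T \<alpha>)) (whitney T (map (vidx F T) \<rho>))))"

end

theory Submission
  imports Defs "Jordan_Normal_Form.Determinant"
begin

text \<open>
  In terms of vertices, both extension operators send a generator on \<open>F\<close> to the expression on \<open>T\<close>
  with the same vertex labels, and \<open>S\<close> acts by permuting labels; so the identities hold on the
  generators. The substance is that the operators exist and are determined by their values there.

  For the spaces \<open>P\<^sup>-\<close>: \<open>\<phi>\<^sub>\<rho>(v\<^sub>1, \<dots>, v\<^sub>k)\<close> at \<open>x\<close> is the determinant of the coordinates \<open>\<rho>\<close> of
  \<open>x, v\<^sub>1, \<dots>, v\<^sub>k\<close>, so the extension is a power of \<open>s = \<Sum>\<^sub>i\<^sub>\<in>\<^sub>F \<lambda>\<^sub>i\<close> times the pullback along the central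
  projection onto \<open>F\<close>, which is linear by inspection. For a facet \<open>G\<close> of \<open>F\<close>, extending the trace on
  \<open>G\<close> back to \<open>F\<close> kills exactly the generators that involve the vertex opposite to \<open>G\<close> and fixes the
  others; so a form with vanishing traces is a combination of generators that involve all vertices.

  For the spaces \<open>P\<close>: the Bernstein monomials of degree \<open>r\<close> are independent, so the coefficient of
  \<open>\<lambda>\<^sup>\<alpha>\<close> is a well-defined alternating form, and the extension acts on it as the pullback along a
  linear map depending on \<open>\<alpha>\<close>, with components \<open>\<Psi>\<^sub>i\<close>. Vanishing traces are read off coefficientwise.
\<close>

section \<open>Determinants of functions of two indices\<close>

text \<open>Both operators are definite descriptions, so each needs a linear map with the prescribed
  values before anything can be computed. The obstacle is that the generators are linearly
  dependent: the \<open>d\<lambda>\<close> sum to zero, and Whitney forms satisfy relations as well.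
  For one family a formula that never mentions generators avoids the question; for the other, every
  relation among generators has to be carried from \<open>F\<close> to \<open>T\<close>.

  A second obstacle is order. The image of \<open>F\<close> inherits its order from
  \<open>T\<close>, so \<open>S\<close> may turn an increasing list into an unsorted one, which
  costs a sign. Generators are therefore indexed by exponents on vertices and by arbitrary lists of
  vertices. Signs and repetitions are settled once, when spans are compared, and \<open>S\<close>
  then acts by plain renaming.

  Positivity of \<open>r\<close> is used repeatedly: the quotient in \<open>Psi\<close> needs a
  nonzero exponent sum, and the choice of a pivot needs a nonempty support.\<close>

definition det_of :: "nat \<Rightarrow> (nat \<Rightarrow> nat \<Rightarrow> real) \<Rightarrow> real" where
  "det_of k f = Determinant.det (mat k k (\<lambda>(i, j). f i j))"

lemma det_of_expand:
  "det_of k f = (\<Sum>p | p permutes {..<k}. of_int (sign p) * (\<Prod>i<k. f i (p i)))"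
proof -
  have "det_of k f = (\<Sum>p | p permutes {0..<k}. of_int (sign p) *
      (\<Prod>i = 0..<k. mat k k (\<lambda>(i, j). f i j) $$ (i, p i)))"
    by (simp add: det_of_def Determinant.det_def)
  also have "\<dots> = (\<Sum>p | p permutes {0..<k}. of_int (sign p) * (\<Prod>i = 0..<k. f i (p i)))"
  proof (intro sum.cong refl arg_cong2[where f = "(*)"] prod.cong)
    fix p i assume "p \<in> {p. p permutes {0..<k}}" "i \<in> {0..<k}"
    then show "mat k k (\<lambda>(i, j). f i j) $$ (i, p i) = f i (p i)"
      using permutes_in_image[of p "{0..<k}" i] by simp
  qed
  finally show ?thesis by (simp only: atLeast0LessThan)
qed

lemma det_of_cong:
  assumes "\<And>i j. i < k \<Longrightarrow> j < k \<Longrightarrow> f i j = g i j"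
  shows "det_of k f = det_of k g"
  unfolding det_of_def by (intro arg_cong[where f = Determinant.det] eq_matI) (auto simp: assms)

lemma det_of_zero_row:
  assumes "i < k" "\<And>j. j < k \<Longrightarrow> f i j = 0"
  shows "det_of k f = 0"
proof -
  have "(\<Prod>l<k. f l (p l)) = 0" if "p permutes {..<k}" for p
    using assms permutes_in_image[OF that, of i] by (intro prod_zero) auto
  then show ?thesis unfolding det_of_expand by (intro sum.neutral) auto
qed

lemma det_of_identical_rows:
  assumes "i < k" "i' < k" "i \<noteq> i'" "\<And>j. j < k \<Longrightarrow> f i j = f i' j"
  shows "det_of k f = 0"
  unfolding det_of_def
  by (rule det_identical_rows[where i = i and j = i' and n = k]) (use assms in \<open>auto intro!: eq_vecI\<close>)

lemma det_of_permute_rows: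
  assumes "p permutes {..<k}"
  shows "det_of k (\<lambda>i. f (p i)) = of_int (sign p) * det_of k f"
proof -
  have "Determinant.det (mat k k (\<lambda>(i, j). mat k k (\<lambda>(i, j). f i j) $$ (p i, j))) =
      of_int (sign p) * det_of k f"
    unfolding det_of_def using assms by (subst det_permute_rows) (auto simp: atLeast0LessThan)
  moreover have "mat k k (\<lambda>(i, j). mat k k (\<lambda>(i, j). f i j) $$ (p i, j)) =
      mat k k (\<lambda>(i, j). f (p i) j)"
    using permutes_in_image[OF assms] by (intro eq_matI) auto
  ultimately show ?thesis by (simp add: det_of_def)
qed

lemma det_of_delta: "det_of k (\<lambda>i j. if i = j then 1 else 0) = 1"
proof -
  have "mat k k (\<lambda>(i, j). if i = j then 1 else 0) = (1\<^sub>m k :: real mat)"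
    by (intro eq_matI) auto
  then show ?thesis by (simp add: det_of_def)
qed

text \<open>No antisymmetry is used: choices \<open>f\<close> that repeat an index have vanishing
  determinants but stay in the sum, so later expansions need neither sorting nor signs.\<close>

lemma det_of_multilinear:
  assumes "finite X"
  shows "det_of k (\<lambda>i j. \<Sum>u\<in>X. C i u * M u j) =
    (\<Sum>f\<in>{..<k} \<rightarrow>\<^sub>E X. (\<Prod>i<k. C i (f i)) * det_of k (\<lambda>i. M (f i)))"
proof -
  have "det_of k (\<lambda>i j. \<Sum>u\<in>X. C i u * M u j) =
      (\<Sum>p | p permutes {..<k}. \<Sum>f\<in>{..<k} \<rightarrow>\<^sub>E X.
        of_int (sign p) * (\<Prod>i<k. C i (f i) * M (f i) (p i)))"
    by (simp add: det_of_expand prod_sum_PiE assms sum_distrib_left)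
  also have "\<dots> = (\<Sum>f\<in>{..<k} \<rightarrow>\<^sub>E X. (\<Prod>i<k. C i (f i)) * det_of k (\<lambda>i. M (f i)))"
    by (subst sum.swap) (simp add: det_of_expand prod.distrib sum_distrib_left mult_ac)
  finally show ?thesis .
qed

text \<open>Column \<open>0\<close> is singled out because in the determinant of a Whitney form it
  holds the coordinates of the point; the expansion then reads as the defining sum of
  \<open>\<phi>\<^sub>\<rho>\<close>.\<close>

lemma det_of_laplace:
  "det_of (Suc k) f = (\<Sum>i<Suc k. (-1) ^ i * f i 0 *
     det_of k (\<lambda>a b. f (if a < i then a else Suc a) (Suc b)))"
proof -
  let ?A = "mat (Suc k) (Suc k) (\<lambda>(i, j). f i j)"
  have "Determinant.det ?A = (\<Sum>i<Suc k. ?A $$ (i, 0) * cofactor ?A i 0)"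
    by (rule laplace_expansion_column) auto
  also have "\<dots> = (\<Sum>i<Suc k. (-1) ^ i * f i 0 *
     det_of k (\<lambda>a b. f (if a < i then a else Suc a) (Suc b)))"
  proof (intro sum.cong refl)
    fix i assume "i \<in> {..<Suc k}"
    moreover have "mat_delete ?A i 0 = mat k k (\<lambda>(a, b). f (if a < i then a else Suc a) (Suc b))"
      by (intro eq_matI) (auto simp: mat_delete_def)
    ultimately show "?A $$ (i, 0) * cofactor ?A i 0 = (-1) ^ i * f i 0 *
     det_of k (\<lambda>a b. f (if a < i then a else Suc a) (Suc b))"
      by (simp add: cofactor_def det_of_def)
  qed
  finally show ?thesis by (simp add: det_of_def)
qed

text \<open>The new matrix is the old one times an upper triangular matrix with diagonal
  \<open>c, 1, \<dots>, 1\<close>. This is how the central projection acts on coordinates: the point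
  is divided by \<open>s\<close>, and each vector loses a multiple of the point.\<close>

lemma det_of_column_operations:
  "det_of (Suc k) (\<lambda>i j. if j = 0 then c * f i 0 else f i j - t j * f i 0) = c * det_of (Suc k) f"
proof -
  let ?n = "Suc k"
  let ?A = "mat ?n ?n (\<lambda>(i, j). f i j)"
  let ?U = "mat ?n ?n (\<lambda>(l, j). if l = 0 then if j = 0 then c else - t j else if l = j then 1 else 0)"
  have "Determinant.det ?U = prod_list (diag_mat ?U)"
    by (rule det_upper_triangular[of _ ?n]) (auto simp: upper_triangular_def)
  also have "diag_mat ?U = c # replicate k 1"
    by (rule nth_equalityI) (auto simp: diag_mat_def nth_Cons' simp del: upt_Suc)
  also have "prod_list \<dots> = c" by simp
  finally have U: "Determinant.det ?U = c" .
  have "?A * ?U = mat ?n ?n (\<lambda>(i, j). if j = 0 then c * f i 0 else f i j - t j * f i 0)"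
  proof (intro eq_matI)
    fix i j assume "i < dim_row (mat ?n ?n (\<lambda>(i, j). if j = 0 then c * f i 0 else f i j - t j * f i 0))"
      "j < dim_col (mat ?n ?n (\<lambda>(i, j). if j = 0 then c * f i 0 else f i j - t j * f i 0))"
    then have ij: "i < ?n" "j < ?n" by auto
    have "(?A * ?U) $$ (i, j) = (\<Sum>l<?n. f i l * (if l = 0 then if j = 0 then c else - t j else if l = j then 1 else 0))"
      using ij by (simp add: scalar_prod_def atLeast0LessThan del: sum.lessThan_Suc)
    \<comment> \<open>A column of \<open>?U\<close> has nonzero entries only in rows
      \<open>0\<close> and \<open>j\<close>. For \<open>j = 0\<close> these coincide, so the second
      summand is then set to \<open>0\<close>.\<close>
    also have "\<dots> = (\<Sum>l<?n. (if l = 0 then f i 0 * (if j = 0 then c else - t j) else 0)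
        + (if l = j then if j = 0 then 0 else f i j else 0))"
      by (intro sum.cong) auto
    also have "\<dots> = (if j = 0 then c * f i 0 else f i j - t j * f i 0)"
      using ij by (simp add: sum.distrib sum.delta del: sum.lessThan_Suc)
    finally show "(?A * ?U) $$ (i, j) = mat ?n ?n (\<lambda>(i, j). if j = 0 then c * f i 0 else f i j - t j * f i 0) $$ (i, j)"
      using ij by simp
  qed auto
  moreover have "Determinant.det (?A * ?U) = Determinant.det ?A * Determinant.det ?U"
    by (rule det_mult[of _ ?n]) auto
  ultimately show ?thesis by (simp add: det_of_def U mult.commute)
qed

section \<open>Homogeneous barycentric coordinates\<close>

text \<open>
  Points \<open>x\<close> and tangent vectors \<open>w\<close> are embedded as \<open>(x, 1)\<close> and \<open>(w, 0)\<close>, so that a single linear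
  functional gives both \<open>\<lambda>\<^sub>v(x)\<close> and \<open>d\<lambda>\<^sub>v(w)\<close>.
\<close>

definition hspan :: "'a::euclidean_space set \<Rightarrow> ('a \<times> real) set" where
  "hspan X = span ((\<lambda>u. (u, 1)) ` X)"

text \<open>The functional is determined only on \<open>hspan X\<close>; elsewhere it depends on the
  choice. Facts about its values are confined to that span, which contains the lifts of points and
  of tangent vectors.\<close>

definition hcoord :: "'a::euclidean_space set \<Rightarrow> 'a \<Rightarrow> 'a \<times> real \<Rightarrow> real" where
  "hcoord X v = (SOME l. linear l \<and> (\<forall>u\<in>X. l (u, 1) = (if u = v then 1 else 0)))"

text \<open>The last component of a linear relation among the \<open>(u, 1)\<close> says that the
  coefficients sum to zero, so such a relation is an affine dependence.\<close>

lemma independent_lift: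
  fixes X :: "'a::euclidean_space set"
  assumes "\<not> affine_dependent X"
  shows "independent ((\<lambda>u. (u, 1::real)) ` X)"
proof
  let ?f = "\<lambda>u::'a. (u, 1::real)"
  have fin: "finite X" using assms by (rule aff_independent_finite)
  have inj: "inj_on ?f X" by (auto simp: inj_on_def)
  assume "dependent (?f ` X)"
  then obtain c where c: "\<exists>v\<in>?f ` X. c v \<noteq> 0" "(\<Sum>v\<in>?f ` X. c v *\<^sub>R v) = 0"
    using fin by (auto simp: dependent_finite)
  have "(\<Sum>u\<in>X. c (u, 1) *\<^sub>R (u, 1::real)) = 0"
    using c(2) by (simp add: sum.reindex[OF inj])
  then have "(\<Sum>u\<in>X. c (u, 1) *\<^sub>R u) = 0" "(\<Sum>u\<in>X. c (u, 1)) = 0"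
    by (simp_all add: prod_eq_iff fst_sum snd_sum)
  with c(1) have "affine_dependent X"
    unfolding affine_dependent_explicit_finite[OF fin] by (intro exI[of _ "\<lambda>u. c (u, 1)"]) auto
  with assms show False by simp
qed

context
  fixes X :: "'a::euclidean_space set"
  assumes X: "\<not> affine_dependent X"
begin

lemma hcoord_works:
  "linear (hcoord X v) \<and> (\<forall>u\<in>X. hcoord X v (u, 1) = (if u = v then 1 else 0))"
proof -
  obtain l where "linear l" "\<forall>z\<in>(\<lambda>u. (u, 1::real)) ` X. l z = (if fst z = v then 1 else (0::real))"
    using linear_independent_extend[OF independent_lift[OF X], of "\<lambda>z. if fst z = v then 1 else (0::real)"]
    by blast
  then have "\<exists>l. linear l \<and> (\<forall>u\<in>X. l (u, 1::real) = (if u = v then 1 else (0::real)))"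
    by (intro exI[of _ l]) auto
  then show ?thesis
    unfolding hcoord_def by (rule someI_ex)
qed

lemma linear_hcoord: "linear (hcoord X v)"
  using hcoord_works by blast

lemma hcoord_vertex: "u \<in> X \<Longrightarrow> hcoord X v (u, 1) = (if u = v then 1 else 0)"
  using hcoord_works by blast

lemma hcoord_expand:
  assumes "z \<in> hspan X"
  shows "z = (\<Sum>u\<in>X. hcoord X u z *\<^sub>R (u, 1))"
proof -
  have fin: "finite X" using X by (rule aff_independent_finite)
  show ?thesis using assms unfolding hspan_def
  proof (induction rule: span_induct_alt)
    case base
    then show ?case by (simp only: linear_0[OF linear_hcoord] scaleR_zero_left sum.neutral_const)
  next
    case (step c b z)
    then obtain w where w: "w \<in> X" "b = (w, 1)" by auto
    have "(\<Sum>u\<in>X. hcoord X u (c *\<^sub>R b + z) *\<^sub>R (u, 1::real)) =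
       (\<Sum>u\<in>X. (if u = w then c *\<^sub>R b else 0) + hcoord X u z *\<^sub>R (u, 1))"
      using w by (intro sum.cong)
        (auto simp: linear_add[OF linear_hcoord] linear_scale[OF linear_hcoord] hcoord_vertex scaleR_left_distrib
          simp del: scaleR_Pair)
    also have "\<dots> = c *\<^sub>R b + z"
      using w fin step.IH by (simp add: sum.distrib)
    finally show ?case by simp
  qed
qed

lemma sum_hcoord: "z \<in> hspan X \<Longrightarrow> (\<Sum>u\<in>X. hcoord X u z) = snd z"
  by (subst (2) hcoord_expand) (simp_all add: snd_sum)

lemma hcoord_combination:
  assumes "v \<in> X"
  shows "hcoord X v (\<Sum>u\<in>X. c u *\<^sub>R (u, 1)) = c v"
proof -
  have fin: "finite X" using X by (rule aff_independent_finite)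
  have "hcoord X v (\<Sum>u\<in>X. c u *\<^sub>R (u, 1)) = (\<Sum>u\<in>X. if u = v then c v else 0)"
    by (auto simp: linear_sum[OF linear_hcoord] linear_scale[OF linear_hcoord] hcoord_vertex simp del: scaleR_Pair intro!: sum.cong)
  then show ?thesis using fin assms by simp
qed

end

text \<open>Expand \<open>z\<close> in the vertices of the face and apply the functional of the
  larger simplex term by term. All computations of traces rest on this.\<close>

lemma hcoord_subset:
  assumes X: "\<not> affine_dependent X" and "Y \<subseteq> X" "z \<in> hspan Y"
  shows "v \<in> Y \<Longrightarrow> hcoord Y v z = hcoord X v z"
    and "v \<in> X \<Longrightarrow> v \<notin> Y \<Longrightarrow> hcoord X v z = 0"
proof -
  have Y: "\<not> affine_dependent Y" using X assms(2) affine_dependent_subset by blast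
  then have fin: "finite Y" by (rule aff_independent_finite)
  have z: "z = (\<Sum>u\<in>Y. hcoord Y u z *\<^sub>R (u, 1))" by (rule hcoord_expand[OF Y assms(3)])
  have "hcoord X v z = (\<Sum>u\<in>Y. if u = v then hcoord Y v z else 0)" if "v \<in> X"
    using assms(2)
    by (subst z) (auto simp: linear_sum[OF linear_hcoord[OF X]] linear_scale[OF linear_hcoord[OF X]]
        hcoord_vertex[OF X] simp del: scaleR_Pair intro!: sum.cong)
  then show "v \<in> Y \<Longrightarrow> hcoord Y v z = hcoord X v z" "v \<in> X \<Longrightarrow> v \<notin> Y \<Longrightarrow> hcoord X v z = 0"
    using fin assms(2) by (auto simp: sum.delta)
qed

lemma hspan_combination: "finite X \<Longrightarrow> (\<Sum>u\<in>X. c u *\<^sub>R (u, 1)) \<in> hspan X"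
  unfolding hspan_def by (intro span_sum span_scale span_base) auto

lemma hspan_mono: "Y \<subseteq> X \<Longrightarrow> hspan Y \<subseteq> hspan X"
  unfolding hspan_def by (intro span_mono) auto

lemma tangent_hspan: "w \<in> tangent T \<longleftrightarrow> (w, 0) \<in> hspan (set T)"
proof
  assume "w \<in> tangent T"
  then show "(w, 0) \<in> hspan (set T)"
    unfolding tangent_def
  proof (induction rule: span_induct_alt)
    case base
    show ?case by (simp add: hspan_def span_0 flip: zero_prod_def)
  next
    case (step c b y)
    then obtain v u where b: "v \<in> set T" "u \<in> set T" "b = v - u" by auto
    have "c *\<^sub>R ((v, 1) - (u, 1)) + (y, 0) \<in> hspan (set T)"
      unfolding hspan_def
      by (intro span_add span_scale span_diff span_base step.IH[unfolded hspan_def] imageI b)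
    then show ?case by (simp add: b)
  qed
next
  assume *: "(w, 0) \<in> hspan (set T)"
  show "w \<in> tangent T"
  proof (cases "T = []")
    case True
    with * show ?thesis by (simp add: hspan_def tangent_def zero_prod_def span_0)
  next
    case False
    then have hd: "hd T \<in> set T" by simp
    \<comment> \<open>Induction over the span needs a claim about all \<open>z\<close>, not only
      those with last component \<open>0\<close>. This linear map sends \<open>(v, 1)\<close> to
      \<open>v - hd T\<close> and \<open>(w, 0)\<close> to \<open>w\<close>.\<close>
    have "fst z - snd z *\<^sub>R hd T \<in> tangent T" if "z \<in> hspan (set T)" for z
      using that unfolding hspan_def
    proof (induction rule: span_induct_alt)
      case base
      show ?case by (simp add: tangent_def span_0)
    next
      case (step c b y)
      then obtain v where v: "v \<in> set T" "b = (v, 1)" by auto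
      have "c *\<^sub>R (v - hd T) + (fst y - snd y *\<^sub>R hd T) \<in> tangent T"
        unfolding tangent_def
        by (intro span_add span_scale span_base step.IH[unfolded tangent_def]) (use v hd in auto)
      then show ?case by (simp add: v algebra_simps)
    qed
    from this[OF *] show ?thesis by simp
  qed
qed

lemma body_hspan: "x \<in> body T \<Longrightarrow> (x, 1) \<in> hspan (set T)"
proof -
  assume "x \<in> body T"
  then obtain c where c: "sum c (set T) = 1" "(\<Sum>v\<in>set T. c v *\<^sub>R v) = x"
    by (auto simp: body_def convex_hull_finite)
  have "(x, 1) = (\<Sum>u\<in>set T. c u *\<^sub>R (u, 1::real))"
    using c by (simp add: prod_eq_iff fst_sum snd_sum)
  then show ?thesis using hspan_combination[of "set T" c] by simp
qed

lemma body_iff_hcoord: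
  assumes "\<not> affine_dependent (set T)"
  shows "x \<in> body T \<longleftrightarrow> (x, 1) \<in> hspan (set T) \<and> (\<forall>v\<in>set T. hcoord (set T) v (x, 1) \<ge> 0)"
proof
  assume x: "x \<in> body T"
  then obtain c where c: "\<forall>v\<in>set T. 0 \<le> c v" "sum c (set T) = 1" "(\<Sum>v\<in>set T. c v *\<^sub>R v) = x"
    by (auto simp: body_def convex_hull_finite)
  have "(x, 1) = (\<Sum>u\<in>set T. c u *\<^sub>R (u, 1::real))"
    using c by (simp add: prod_eq_iff fst_sum snd_sum)
  then show "(x, 1) \<in> hspan (set T) \<and> (\<forall>v\<in>set T. hcoord (set T) v (x, 1) \<ge> 0)"
    using body_hspan[OF x] hcoord_combination[OF assms, of _ c] c(1) by auto
next
  assume *: "(x, 1) \<in> hspan (set T) \<and> (\<forall>v\<in>set T. hcoord (set T) v (x, 1) \<ge> 0)"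
  have "x = (\<Sum>u\<in>set T. hcoord (set T) u (x, 1) *\<^sub>R u)"
    using hcoord_expand[OF assms conjunct1[OF *]] by (simp add: prod_eq_iff fst_sum snd_sum)
  then show "x \<in> body T"
    using * sum_hcoord[OF assms conjunct1[OF *]] unfolding body_def convex_hull_finite[OF finite_set]
    by (auto intro!: exI[of _ "\<lambda>u. hcoord (set T) u (x, 1)"])
qed

lemma body_subset: "set G \<subseteq> set F \<Longrightarrow> body G \<subseteq> body F"
  unfolding body_def by (rule hull_mono)

lemma tangent_subset: "set G \<subseteq> set F \<Longrightarrow> tangent G \<subseteq> tangent F"
  unfolding tangent_def by (intro span_mono) auto

text \<open>\<open>bary\<close> is a definite description over coefficient sequences: the
  functionals provide existence, and affine independence, through \<open>hcoord_combination\<close>,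
  gives uniqueness.\<close>

lemma bary_eq_hcoord:
  assumes T: "\<not> affine_dependent (set T)" "distinct T" and x: "x \<in> body T" and i: "i < length T"
  shows "bary T i x = hcoord (set T) (T ! i) (x, 1)"
proof -
  let ?P = "\<lambda>u. (\<forall>j\<ge>length T. u j = 0) \<and> (\<Sum>j<length T. u j) = 1 \<and>
                        (\<Sum>j<length T. u j *\<^sub>R (T ! j)) = x"
  let ?u = "\<lambda>j. if j < length T then hcoord (set T) (T ! j) (x, 1) else 0"
  have reindex: "(\<Sum>j<length T. f (T ! j)) = (\<Sum>v\<in>set T. f v)" for f :: "'a \<Rightarrow> 'c::comm_monoid_add"
    using T(2) by (intro sum.reindex_bij_betw bij_betw_nth) auto
  note h = body_hspan[OF x]
  have "?P ?u"
    using reindex[of "\<lambda>v. hcoord (set T) v (x, 1)"] reindex[of "\<lambda>v. hcoord (set T) v (x, 1) *\<^sub>R v"]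
      sum_hcoord[OF T(1) h] hcoord_expand[OF T(1) h]
    by (simp add: prod_eq_iff fst_sum)
  moreover have "u = ?u" if u: "?P u" for u
  proof
    fix j
    show "u j = ?u j"
    proof (cases "j < length T")
      case True
      have inj: "inj_on ((!) T) {..<length T}" using T(2) by (simp add: inj_on_nth)
      let ?c = "\<lambda>v. u (the_inv_into {..<length T} ((!) T) v)"
      have c: "?c (T ! l) = u l" if "l < length T" for l
        using inj that by (simp add: the_inv_into_f_f)
      have "(\<Sum>v\<in>set T. ?c v *\<^sub>R (v, 1::real)) = (x, 1)"
        using u c by (simp add: prod_eq_iff fst_sum snd_sum flip: reindex)
      then show ?thesis
        using hcoord_combination[OF T(1), of "T ! j" ?c] True c by simp
    qed (use u in simp)
  qed
  ultimately have "(THE u. ?P u) = ?u" by (rule the_equality)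
  then show ?thesis using i by (simp add: bary_def)
qed

section \<open>Derivatives within the body of a simplex\<close>

lemma has_derivative_within_unique_segment:
  fixes f :: "'a::real_normed_vector \<Rightarrow> 'b::real_normed_vector"
  assumes f: "(f has_derivative D) (at x within S)" "(f has_derivative D') (at x within S)"
    and S: "convex S" "x \<in> S" "y \<in> S"
  shows "D (y - x) = D' (y - x)"
proof -
  \<comment> \<open>Restriction to the segment from \<open>x\<close> to \<open>y\<close> reduces the
    claim to uniqueness of one-sided derivatives on an interval.\<close>
  let ?g = "\<lambda>t::real. x + t *\<^sub>R (y - x)"
  have g: "?g ` {0..1} \<subseteq> S"
  proof -
    have "?g t = (1 - t) *\<^sub>R x + t *\<^sub>R y" for t by (simp add: algebra_simps)
    then show ?thesis using S by (auto simp: convex_alt)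
  qed
  have "(f \<circ> ?g has_vector_derivative E (y - x)) (at 0 within {0..1})"
    if "(f has_derivative E) (at x within S)" for E
  proof -
    have "(?g has_derivative (\<lambda>t. t *\<^sub>R (y - x))) (at 0 within {0..1})"
      by (auto intro!: derivative_eq_intros)
    moreover have "(f has_derivative E) (at (?g 0) within ?g ` {0..1})"
      using has_derivative_subset[OF that g] by simp
    ultimately have "(f \<circ> ?g has_derivative E \<circ> (\<lambda>t. t *\<^sub>R (y - x))) (at 0 within {0..1})"
      by (rule diff_chain_within)
    moreover have "linear E" using that by (rule has_derivative_linear)
    ultimately show ?thesis
      by (simp add: has_vector_derivative_def o_def linear_scale)
  qed
  then show ?thesis
    using f vector_derivative_unique_within_closed_interval[of 0 1 0 "f \<circ> ?g"] by auto
qed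

text \<open>A body of lower dimension has no interior points, so a derivative within it is not
  unique as a linear map. It is unique in the directions towards the vertices, and these span the
  tangent space.\<close>

lemma frechet_derivative_body:
  fixes f :: "'a::euclidean_space \<Rightarrow> 'b::real_normed_vector"
  assumes D: "(f has_derivative D) (at x within body T)" and x: "x \<in> body T" and w: "w \<in> tangent T"
  shows "frechet_derivative f (at x within body T) w = D w"
proof -
  let ?D' = "frechet_derivative f (at x within body T)"
  have D': "(f has_derivative ?D') (at x within body T)"
    using D frechet_derivative_works differentiableI by blast
  have lin: "linear D" "linear ?D'" using D D' by (auto dest: has_derivative_linear)
  have vertex: "?D' (v - x) = D (v - x)" if "v \<in> set T" for v
    using has_derivative_within_unique_segment[OF D' D _ x, of v] that
    by (simp add: body_def hull_inc)
  from w show ?thesis unfolding tangent_def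
  proof (induction rule: span_induct_alt)
    case base
    then show ?case by (simp add: lin linear_0)
  next
    case (step c b y)
    \<comment> \<open>The detour through \<open>x\<close> replaces a difference of vertices by
      directions of segments that start at \<open>x\<close> and stay in the body.\<close>
    then obtain v u where b: "v \<in> set T" "u \<in> set T" "b = (v - x) - (u - x)" by auto
    have "?D' b = D b"
      using vertex[OF b(1)] vertex[OF b(2)]
      unfolding b(3) linear_diff[OF lin(1), of "v - x"] linear_diff[OF lin(2), of "v - x"] by simp
    then show ?case using step.IH by (simp add: lin linear_add linear_scale)
  qed
qed

lemma has_derivative_affine:
  fixes l :: "'a::euclidean_space \<times> real \<Rightarrow> 'b::euclidean_space"
  assumes "linear l"
  shows "((\<lambda>x. l (x, 1)) has_derivative (\<lambda>w. l (w, 0))) (at x within S)"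
proof -
  have bl: "bounded_linear l" using assms by (simp add: linear_conv_bounded_linear)
  have "((\<lambda>x. (x, 1)) has_derivative (\<lambda>w. (w, 0))) (at x within S)"
    by (auto intro!: derivative_eq_intros)
  then show ?thesis by (rule bounded_linear.has_derivative[OF bl])
qed

lemma frechet_derivative_affine:
  fixes l :: "'a::euclidean_space \<times> real \<Rightarrow> 'b::euclidean_space"
  assumes "linear l" "\<And>x. x \<in> body T \<Longrightarrow> f x = l (x, 1)" "x \<in> body T" "w \<in> tangent T"
  shows "frechet_derivative f (at x within body T) w = l (w, 0)"
proof -
  have "(f has_derivative (\<lambda>w. l (w, 0))) (at x within body T)"
    using has_derivative_affine[OF assms(1), of x "body T"]
    by (rule has_derivative_transform_within[where d = 1]) (auto simp: assms)
  then show ?thesis using assms by (intro frechet_derivative_body)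
qed

definition in_dom :: "'a::euclidean_space list \<Rightarrow> nat \<Rightarrow> 'a \<Rightarrow> 'a list \<Rightarrow> bool" where
  "in_dom T k x vs \<longleftrightarrow> x \<in> body T \<and> length vs = k \<and> set vs \<subseteq> tangent T"

lemma dbary_eq_hcoord:
  assumes T: "\<not> affine_dependent (set T)" "distinct T" and i: "i < length T"
  shows "dbary T i x vs = (if in_dom T 1 x vs then of_real (hcoord (set T) (T ! i) (vs ! 0, 0)) else 0)"
proof -
  have "frechet_derivative (bary T i) (at x within body T) (vs ! 0) = hcoord (set T) (T ! i) (vs ! 0, 0)"
    if "in_dom T 1 x vs"
    using that by (intro frechet_derivative_affine linear_hcoord[OF T(1)] bary_eq_hcoord[OF T _ i])
      (auto simp: in_dom_def)
  then show ?thesis by (auto simp: dbary_def differential_def form_on_def in_dom_def)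
qed

section \<open>Generators labelled by vertices\<close>

lemma sum_form_apply: "(\<Sum>i\<in>A. f i) x vs = (\<Sum>i\<in>A. (f i :: ('a, 'f::real_normed_field) form) x vs)"
  by (induction A rule: infinite_finite_induct) auto

definition monom_on :: "'a::euclidean_space list \<Rightarrow> 'a set \<Rightarrow> ('a \<Rightarrow> nat) \<Rightarrow> 'a \<Rightarrow> real" where
  "monom_on T Y a x = (\<Prod>v\<in>Y. hcoord (set T) v (x, 1) ^ a v)"

definition psi :: "'a::euclidean_space list \<Rightarrow> 'a set \<Rightarrow> ('a \<Rightarrow> nat) \<Rightarrow> 'a \<Rightarrow> 'a \<Rightarrow> real" where
  "psi T Y a u w = hcoord (set T) u (w, 0) -
     of_nat (a u) / of_nat (sum a Y) * (\<Sum>y\<in>Y. hcoord (set T) y (w, 0))"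

text \<open>
  With \<open>Y\<close> the vertex set of \<open>F\<close>, \<open>gen_full F Y\<close> and \<open>gen_minus F Y\<close> are the generators on \<open>F\<close> and
  \<open>gen_full T Y\<close> and \<open>gen_minus T Y\<close> their extensions; for the full vertex set the correction term in
  \<open>psi\<close> vanishes.
\<close>

definition gen_full ::
  "'a::euclidean_space list \<Rightarrow> 'a set \<Rightarrow> ('a \<Rightarrow> nat) \<Rightarrow> 'a list \<Rightarrow> ('a, 'f::real_normed_field) form" where
  "gen_full T Y a s = (\<lambda>x vs. if in_dom T (length s) x vs
     then of_real (monom_on T Y a x * det_of (length s) (\<lambda>i j. psi T Y a (s ! i) (vs ! j))) else 0)"

definition gen_minus ::
  "'a::euclidean_space list \<Rightarrow> 'a set \<Rightarrow> ('a \<Rightarrow> nat) \<Rightarrow> 'a list \<Rightarrow> ('a, 'f::real_normed_field) form" where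
  "gen_minus T Y a s = (\<lambda>x vs. if in_dom T (length s - 1) x vs
     then of_real (monom_on T Y a x * det_of (length s)
       (\<lambda>i j. hcoord (set T) (s ! i) (if j = 0 then (x, 1) else (vs ! (j - 1), 0)))) else 0)"

text \<open>A sum over positions in place of an inverse of the indexing: for a distinct list it has
  one term at each vertex, and it is empty, hence \<open>0\<close>, elsewhere.\<close>

definition vlabel :: "'a list \<Rightarrow> (nat \<Rightarrow> nat) \<Rightarrow> 'a \<Rightarrow> nat" where
  "vlabel F \<alpha> v = (\<Sum>i | i < length F \<and> F ! i = v. \<alpha> i)"

lemma vlabel_nth: "distinct F \<Longrightarrow> i < length F \<Longrightarrow> vlabel F \<alpha> (F ! i) = \<alpha> i"
proof -
  assume "distinct F" "i < length F"
  then have "{j. j < length F \<and> F ! j = F ! i} = {i}" by (auto simp: nth_eq_iff_index_eq)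
  then show ?thesis by (simp add: vlabel_def)
qed

lemma vlabel_outside: "v \<notin> set F \<Longrightarrow> vlabel F \<alpha> v = 0"
  by (auto simp: vlabel_def intro!: sum.neutral)

lemma atMost_sdim: "F \<noteq> [] \<Longrightarrow> {..sdim F} = {..<length F}"
  by (cases F) (auto simp: sdim_def)

lemma atLeast0_sdim: "F \<noteq> [] \<Longrightarrow> {0..sdim F} = {..<length F}"
  by (cases F) (auto simp: sdim_def)

lemma nth_reindex:
  assumes "distinct F"
  shows "(\<Sum>j<length F. f (F ! j)) = (\<Sum>v\<in>set F. f v)"
    and "(\<Prod>j<length F. g (F ! j)) = (\<Prod>v\<in>set F. g v)"
  using sum.reindex_bij_betw[OF bij_betw_nth[OF assms refl refl], of f]
    prod.reindex_bij_betw[OF bij_betw_nth[OF assms refl refl], of g] by auto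

lemma sum_vlabel:
  assumes "distinct F" "F \<noteq> []"
  shows "sum (vlabel F \<alpha>) (set F) = (\<Sum>i\<le>sdim F. \<alpha> i)"
  using nth_reindex(1)[OF assms(1), of "vlabel F \<alpha>"] assms by (simp add: atMost_sdim vlabel_nth)

lemma bary_monom_eq:
  assumes T: "\<not> affine_dependent (set T)" "distinct T" "T \<noteq> []" and x: "x \<in> body T"
  shows "bary_monom T \<alpha> x = monom_on T (set T) (vlabel T \<alpha>) x"
proof -
  have "bary_monom T \<alpha> x = (\<Prod>i<length T. hcoord (set T) (T ! i) (x, 1) ^ vlabel T \<alpha> (T ! i))"
    unfolding bary_monom_def atMost_sdim[OF T(3)]
    by (intro prod.cong refl) (simp add: bary_eq_hcoord[OF T(1,2) x] vlabel_nth[OF T(2)])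
  then show ?thesis unfolding monom_on_def
    using nth_reindex(2)[OF T(2), of "\<lambda>v. hcoord (set T) v (x, 1) ^ vlabel T \<alpha> v"] by simp
qed

lemma monom_on_superset:
  assumes "finite Z" "Y \<subseteq> Z" "\<And>v. v \<in> Z \<Longrightarrow> v \<notin> Y \<Longrightarrow> a v = 0"
  shows "monom_on T Z a x = monom_on T Y a x"
  unfolding monom_on_def using assms by (intro prod.mono_neutral_right) auto

lemma wedge_eq_dt:
  assumes "\<And>i x vs. i < length \<omega>s \<Longrightarrow> in_dom T 1 x vs \<Longrightarrow> (\<omega>s ! i) x vs = of_real (l i (vs ! 0))"
  shows "wedge T \<omega>s x vs = (if in_dom T (length \<omega>s) x vs
    then of_real (det_of (length \<omega>s) (\<lambda>i j. l i (vs ! j))) else 0)"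
proof -
  have "(\<Prod>i<length \<omega>s. (\<omega>s ! i) x [vs ! p i]) = of_real (\<Prod>i<length \<omega>s. l i (vs ! p i))"
    if "in_dom T (length \<omega>s) x vs" "p permutes {..<length \<omega>s}" for p
    unfolding of_real_prod
  proof (intro prod.cong refl)
    fix i assume i: "i \<in> {..<length \<omega>s}"
    then have "p i < length \<omega>s" using permutes_in_image[OF that(2), of i] by simp
    then have "in_dom T 1 x [vs ! p i]" using that(1) by (auto simp: in_dom_def)
    then show "(\<omega>s ! i) x [vs ! p i] = of_real (l i (vs ! p i))" using assms i by auto
  qed
  then show ?thesis
    by (auto simp: wedge_def form_on_def in_dom_def det_of_expand of_real_sum intro!: sum.cong)
qed

lemma dbary_wedge_eq:
  assumes T: "\<not> affine_dependent (set T)" "distinct T" and \<sigma>: "\<And>i. i \<in> set \<sigma> \<Longrightarrow> i < length T"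
  shows "dbary_wedge T \<sigma> x vs = (if in_dom T (length \<sigma>) x vs
    then of_real (det_of (length \<sigma>) (\<lambda>i j. hcoord (set T) (T ! (\<sigma> ! i)) (vs ! j, 0))) else 0)"
  unfolding dbary_wedge_def
  by (subst wedge_eq_dt[where l = "\<lambda>i w. hcoord (set T) (T ! (\<sigma> ! i)) (w, 0)"])
    (auto simp: dbary_eq_hcoord[OF T] \<sigma>)

text \<open>The definition of a Whitney form is the expansion of this determinant along its first
  column, which holds the coordinates of \<open>x\<close>. In determinant form the point and the
  vectors can be combined by column operations.\<close>

lemma whitney_eq:
  assumes T: "\<not> affine_dependent (set T)" "distinct T" and \<rho>: "\<And>i. i \<in> set \<rho> \<Longrightarrow> i < length T"
    and "\<rho> \<noteq> []"
  shows "(whitney T \<rho> x vs :: 'f::real_normed_field) = (if in_dom T (length \<rho> - 1) x vs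
    then of_real (det_of (length \<rho>)
      (\<lambda>i j. hcoord (set T) (T ! (\<rho> ! i)) (if j = 0 then (x, 1) else (vs ! (j - 1), 0)))) else 0)"
proof -
  obtain k where k: "length \<rho> = Suc k" using \<open>\<rho> \<noteq> []\<close> by (cases \<rho>) auto
  \<comment> \<open>Deleting entry \<open>i\<close> shifts the later ones by one, just as deleting
    row \<open>i\<close> does in the minor.\<close>
  have nth: "(take i \<rho> @ drop (Suc i) \<rho>) ! a = \<rho> ! (if a < i then a else Suc a)"
    if "i < Suc k" "a < k" for i a
    using that k by (auto simp: nth_append min_def)
  have "dbary_wedge T (take i \<rho> @ drop (Suc i) \<rho>) x vs = (if in_dom T k x vs
      then of_real (det_of k (\<lambda>a b. hcoord (set T) (T ! (\<rho> ! (if a < i then a else Suc a))) (vs ! b, 0))) else 0 :: 'f)"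
    if "i < Suc k" for i
  proof -
    let ?\<rho> = "take i \<rho> @ drop (Suc i) \<rho>"
    have len: "length ?\<rho> = k" using that k by auto
    have "l < length T" if "l \<in> set (take i \<rho> @ drop (Suc i) \<rho>)" for l
      using that \<rho> by (auto dest: in_set_takeD in_set_dropD)
    then have "dbary_wedge T ?\<rho> x vs = (if in_dom T k x vs
        then of_real (det_of k (\<lambda>a b. hcoord (set T) (T ! (?\<rho> ! a)) (vs ! b, 0))) else 0 :: 'f)"
      using dbary_wedge_eq[OF T, of ?\<rho> x vs] unfolding len by blast
    also have "det_of k (\<lambda>a b. hcoord (set T) (T ! (?\<rho> ! a)) (vs ! b, 0)) =
        det_of k (\<lambda>a b. hcoord (set T) (T ! (\<rho> ! (if a < i then a else Suc a))) (vs ! b, 0))"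
      by (rule det_of_cong) (simp only: nth[OF that])
    finally show ?thesis .
  qed
  then have "(whitney T \<rho> x vs :: 'f) = (\<Sum>i<Suc k. (-1) ^ i * (of_real (bary T (\<rho> ! i) x) * (if in_dom T k x vs
      then of_real (det_of k (\<lambda>a b. hcoord (set T) (T ! (\<rho> ! (if a < i then a else Suc a))) (vs ! b, 0))) else 0)))"
    unfolding whitney_def k sum_form_apply form_scale_def fun_mult_def
    by (intro sum.cong refl arg_cong2[where f = "(*)"]) simp
  also have "\<dots> = (if in_dom T k x vs then of_real (\<Sum>i<Suc k. (-1) ^ i * hcoord (set T) (T ! (\<rho> ! i)) (x, 1) *
     det_of k (\<lambda>a b. hcoord (set T) (T ! (\<rho> ! (if a < i then a else Suc a))) (vs ! b, 0))) else 0)"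
  proof (cases "in_dom T k x vs")
    case True
    then have "x \<in> body T" by (simp add: in_dom_def)
    then show ?thesis using True k
      by (auto simp: bary_eq_hcoord[OF T] \<rho> mult.assoc simp del: sum.lessThan_Suc intro!: sum.cong)
  qed simp
  also have "\<dots> = (if in_dom T k x vs then of_real (det_of (Suc k)
      (\<lambda>i j. hcoord (set T) (T ! (\<rho> ! i)) (if j = 0 then (x, 1) else (vs ! (j - 1), 0)))) else 0)"
    by (subst det_of_laplace) simp
  finally show ?thesis by (simp add: k)
qed

lemma sum_hcoord_tangent:
  assumes "\<not> affine_dependent (set T)" "w \<in> tangent T"
  shows "(\<Sum>y\<in>set T. hcoord (set T) y (w, 0)) = 0"
  using sum_hcoord[OF assms(1)] assms(2) by (simp add: tangent_hspan)

lemma psi_self: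
  assumes "\<not> affine_dependent (set T)" "w \<in> tangent T"
  shows "psi T (set T) a u w = hcoord (set T) u (w, 0)"
  by (simp add: psi_def sum_hcoord_tangent[OF assms])

lemma gen_full_self:
  assumes "\<not> affine_dependent (set T)"
  shows "gen_full T (set T) a s x vs = (if in_dom T (length s) x vs
     then of_real (monom_on T (set T) a x * det_of (length s) (\<lambda>i j. hcoord (set T) (s ! i) (vs ! j, 0))) else 0)"
proof -
  have "det_of (length s) (\<lambda>i j. psi T (set T) a (s ! i) (vs ! j)) =
      det_of (length s) (\<lambda>i j. hcoord (set T) (s ! i) (vs ! j, 0))" if "in_dom T (length s) x vs"
    using that by (intro det_of_cong psi_self assms) (auto simp: in_dom_def)
  then show ?thesis by (simp add: gen_full_def)
qed

section \<open>Translation between vertex indices and vertices\<close>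

context
  fixes T F :: "'a::euclidean_space list"
  assumes T: "\<not> affine_dependent (set T)" "distinct T" "T \<noteq> []"
    and F: "set F \<subseteq> set T" "distinct F" "F \<noteq> []"
begin

lemma vidx_works:
  assumes "i < length F"
  shows "vidx F T i < length T" "T ! vidx F T i = F ! i"
proof -
  have "F ! i \<in> set T" using F(1) assms by auto
  then have "\<exists>!j. j < length T \<and> T ! j = F ! i"
    using T(2) by (metis in_set_conv_nth nth_eq_iff_index_eq)
  then have "vidx F T i < length T \<and> T ! vidx F T i = F ! i"
    unfolding vidx_def by (rule theI')
  then show "vidx F T i < length T" "T ! vidx F T i = F ! i" by auto
qed

lemma vidx_range_eq: "vidx_range F T = {j. j < length T \<and> T ! j \<in> set F}"
proof -
  have "j \<in> vidx F T ` {..<length F}" if "j < length T" "T ! j \<in> set F" for j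
  proof -
    obtain i where i: "i < length F" "F ! i = T ! j" using \<open>T ! j \<in> set F\<close> by (auto simp: in_set_conv_nth)
    then have "vidx F T i = j" using vidx_works[OF i(1)] T(2) that(1) by (simp add: nth_eq_iff_index_eq)
    then show ?thesis using i by auto
  qed
  then show ?thesis using vidx_works by (auto simp: vidx_range_def atLeast0_sdim F(3))
qed

lemma inj_on_vidx: "inj_on (vidx F T) {0..sdim F}"
  unfolding atLeast0_sdim[OF F(3)] using vidx_works(2) F(2)
  by (intro inj_onI) (metis lessThan_iff nth_eq_iff_index_eq)

lemma multi_push_eq_vlabel: "j < length T \<Longrightarrow> multi_push F T \<alpha> j = vlabel F \<alpha> (T ! j)"
proof (cases "T ! j \<in> set F")
  case True
  assume j: "j < length T"
  obtain i where i: "i < length F" "F ! i = T ! j" using True by (auto simp: in_set_conv_nth)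
  then have v: "vidx F T i = j" using vidx_works[OF i(1)] T(2) j by (simp add: nth_eq_iff_index_eq)
  have "the_inv_into {0..sdim F} (vidx F T) j = i"
    using the_inv_into_f_f[OF inj_on_vidx, of i] i(1) v by (simp add: atLeast0_sdim[OF F(3)])
  then show ?thesis using True j i vlabel_nth[OF F(2), of i \<alpha>] by (simp add: multi_push_def vidx_range_eq)
next
  case False
  then show ?thesis by (simp add: multi_push_def vidx_range_eq vlabel_outside)
qed

text \<open>Pushing a multiindex to \<open>T\<close> changes positions but not vertices, so a form
  on \<open>F\<close> and its extension carry the same label.\<close>

lemma vlabel_multi_push: "vlabel T (multi_push F T \<alpha>) = vlabel F \<alpha>"
proof
  fix v
  show "vlabel T (multi_push F T \<alpha>) v = vlabel F \<alpha> v"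
  proof (cases "v \<in> set T")
    case True
    then show ?thesis using T(2) by (auto simp: in_set_conv_nth vlabel_nth multi_push_eq_vlabel)
  next
    case False
    then have "v \<notin> set F" using F(1) by auto
    with False show ?thesis by (simp add: vlabel_outside)
  qed
qed

lemma bary_monom_multi_push:
  assumes "x \<in> body T"
  shows "bary_monom T (multi_push F T \<alpha>) x = monom_on T (set F) (vlabel F \<alpha>) x"
  using monom_on_superset[of "set T" "set F" "vlabel F \<alpha>" T x] F(1)
  by (simp add: bary_monom_eq[OF T assms] vlabel_multi_push vlabel_outside)

lemma sum_multi_push: "(\<Sum>j\<le>sdim T. multi_push F T \<alpha> j) = sum (vlabel F \<alpha>) (set F)"
proof -
  have "(\<Sum>j\<le>sdim T. multi_push F T \<alpha> j) = sum (vlabel F \<alpha>) (set T)"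
    using sum_vlabel[OF T(2,3), of "multi_push F T \<alpha>"] by (simp add: vlabel_multi_push)
  also have "\<dots> = sum (vlabel F \<alpha>) (set F)"
    using F(1) by (intro sum.mono_neutral_right) (auto simp: vlabel_outside)
  finally show ?thesis .
qed

lemma bij_betw_vidx_range: "bij_betw ((!) T) (vidx_range F T) (set F)"
  using T(2) F(1) unfolding vidx_range_eq bij_betw_def
  by (auto simp: inj_on_def nth_eq_iff_index_eq in_set_conv_nth image_iff subset_iff) (metis)

lemma Psi_eq_psi:
  assumes "i < length F" "in_dom T 1 x vs"
  shows "(Psi (multi_push F T \<alpha>) F T (vidx F T i) x vs :: 'f::real_normed_field) =
    of_real (psi T (set F) (vlabel F \<alpha>) (F ! i) (vs ! 0))"
proof -
  have "(\<Sum>j\<in>vidx_range F T. dbary T j x vs) =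
      (\<Sum>j\<in>vidx_range F T. of_real (hcoord (set T) (T ! j) (vs ! 0, 0)) :: 'f)"
    using assms(2) by (intro sum.cong refl) (simp add: dbary_eq_hcoord[OF T(1,2)] vidx_range_eq)
  also have "\<dots> = (\<Sum>y\<in>set F. of_real (hcoord (set T) y (vs ! 0, 0)))"
    by (rule sum.reindex_bij_betw[OF bij_betw_vidx_range])
  finally show ?thesis
    using assms vidx_works[OF assms(1)]
    by (simp add: Psi_def form_scale_def sum_form_apply dbary_eq_hcoord[OF T(1,2)] psi_def
        multi_push_eq_vlabel sum_multi_push)
qed

lemma ext_full_generator:
  assumes "\<And>i. i \<in> set \<sigma> \<Longrightarrow> i < length F"
  shows "fun_mult (bary_monom T (multi_push F T \<alpha>))
      (wedge T (map (Psi (multi_push F T \<alpha>) F T) (map (vidx F T) \<sigma>))) =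
    (gen_full T (set F) (vlabel F \<alpha>) (map ((!) F) \<sigma>) :: ('a, 'f::real_normed_field) form)" (is "?l = ?r")
proof (intro ext)
  fix x vs
  have "wedge T (map (Psi (multi_push F T \<alpha>) F T) (map (vidx F T) \<sigma>)) x vs =
    (if in_dom T (length \<sigma>) x vs
     then of_real (det_of (length \<sigma>) (\<lambda>i j. psi T (set F) (vlabel F \<alpha>) (F ! (\<sigma> ! i)) (vs ! j))) else 0 :: 'f)"
    by (subst wedge_eq_dt[where l = "\<lambda>i. psi T (set F) (vlabel F \<alpha>) (F ! (\<sigma> ! i))"])
      (auto simp: Psi_eq_psi assms)
  moreover have "det_of (length \<sigma>) (\<lambda>i j. psi T (set F) (vlabel F \<alpha>) (F ! (\<sigma> ! i)) (vs ! j)) =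
    det_of (length \<sigma>) (\<lambda>i j. psi T (set F) (vlabel F \<alpha>) (map ((!) F) \<sigma> ! i) (vs ! j))"
    by (rule det_of_cong) simp
  ultimately show "?l x vs = ?r x vs"
    by (auto simp: fun_mult_def gen_full_def in_dom_def bary_monom_multi_push)
qed

lemma ext_minus_generator:
  assumes "\<And>i. i \<in> set \<rho> \<Longrightarrow> i < length F" "\<rho> \<noteq> []"
  shows "fun_mult (bary_monom T (multi_push F T \<alpha>)) (whitney T (map (vidx F T) \<rho>)) =
    (gen_minus T (set F) (vlabel F \<alpha>) (map ((!) F) \<rho>) :: ('a, 'f::real_normed_field) form)" (is "?l = ?r")
proof (intro ext)
  fix x vs
  have "det_of (length \<rho>) (\<lambda>i j. hcoord (set T) (T ! (map (vidx F T) \<rho> ! i)) (if j = 0 then (x, 1) else (vs ! (j - 1), 0)))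
    = det_of (length \<rho>) (\<lambda>i j. hcoord (set T) (map ((!) F) \<rho> ! i) (if j = 0 then (x, 1) else (vs ! (j - 1), 0)))"
    by (rule det_of_cong) (simp add: vidx_works assms)
  moreover have "whitney T (map (vidx F T) \<rho>) x vs = (if in_dom T (length \<rho> - 1) x vs
    then of_real (det_of (length \<rho>) (\<lambda>i j. hcoord (set T) (T ! (map (vidx F T) \<rho> ! i))
      (if j = 0 then (x, 1) else (vs ! (j - 1), 0)))) else 0 :: 'f)"
    using assms vidx_works(1) by (subst whitney_eq[OF T(1,2)]) auto
  ultimately show "?l x vs = ?r x vs"
    by (auto simp: fun_mult_def gen_minus_def in_dom_def bary_monom_multi_push)
qed

end

lemma full_generator:
  assumes F: "\<not> affine_dependent (set F)" "distinct F" "F \<noteq> []"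
    and \<sigma>: "\<And>i. i \<in> set \<sigma> \<Longrightarrow> i < length F"
  shows "fun_mult (bary_monom F \<alpha>) (dbary_wedge F \<sigma>) =
    gen_full F (set F) (vlabel F \<alpha>) (map ((!) F) \<sigma>)" (is "?l = ?r")
proof (intro ext)
  fix x vs
  have "det_of (length \<sigma>) (\<lambda>i j. hcoord (set F) (F ! (\<sigma> ! i)) (vs ! j, 0)) =
    det_of (length \<sigma>) (\<lambda>i j. hcoord (set F) (map ((!) F) \<sigma> ! i) (vs ! j, 0))"
    by (rule det_of_cong) simp
  then show "?l x vs = ?r x vs"
    by (auto simp: fun_mult_def gen_full_self[OF F(1)] dbary_wedge_eq[OF F(1,2) \<sigma>] in_dom_def bary_monom_eq[OF F])
qed

lemma minus_generator:
  assumes F: "\<not> affine_dependent (set F)" "distinct F" "F \<noteq> []"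
    and \<rho>: "\<And>i. i \<in> set \<rho> \<Longrightarrow> i < length F" "\<rho> \<noteq> []"
  shows "fun_mult (bary_monom F \<alpha>) (whitney F \<rho>) =
    gen_minus F (set F) (vlabel F \<alpha>) (map ((!) F) \<rho>)" (is "?l = ?r")
proof (intro ext)
  fix x vs
  have "det_of (length \<rho>) (\<lambda>i j. hcoord (set F) (F ! (\<rho> ! i)) (if j = 0 then (x, 1) else (vs ! (j - 1), 0)))
    = det_of (length \<rho>) (\<lambda>i j. hcoord (set F) (map ((!) F) \<rho> ! i) (if j = 0 then (x, 1) else (vs ! (j - 1), 0)))"
    by (rule det_of_cong) simp
  then show "?l x vs = ?r x vs"
    by (auto simp: fun_mult_def gen_minus_def whitney_eq[OF F(1,2) \<rho>] in_dom_def bary_monom_eq[OF F])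
qed

section \<open>Linear maps on forms and pullbacks along simplicial maps\<close>

text \<open>Linearity on all functions of this type, polynomial or not, spares membership side
  conditions when operators are composed. Restriction to a subspace happens only when the definite
  descriptions are evaluated.\<close>

abbreviation form_linear :: "(('a, 'f::real_normed_field) form \<Rightarrow> ('a, 'f) form) \<Rightarrow> bool" where
  "form_linear \<equiv> form_linear_on UNIV"

lemma form_linearI:
  assumes "\<And>\<omega> \<eta>. E (\<omega> + \<eta>) = E \<omega> + E \<eta>" "\<And>c \<omega>. E (form_scale c \<omega>) = form_scale c (E \<omega>)"
  shows "form_linear E"
  using assms by (simp add: form_linear_on_def)

lemma
  assumes "form_linear E"
  shows form_linear_add: "E (\<omega> + \<eta>) = E \<omega> + E \<eta>"
    and form_linear_scale: "E (form_scale c \<omega>) = form_scale c (E \<omega>)"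
  using assms by (auto simp: form_linear_on_def)

lemma form_linear_zero: "form_linear E \<Longrightarrow> E 0 = 0"
  using form_linear_scale[of E 0 0] by simp

lemma form_linear_sum:
  assumes "form_linear E"
  shows "E (\<Sum>i\<in>A. f i) = (\<Sum>i\<in>A. E (f i))"
  by (induction A rule: infinite_finite_induct)
    (simp_all add: form_linear_zero[OF assms] form_linear_add[OF assms] del: zero_fun_apply plus_fun_apply)

lemma form_linear_diff:
  assumes "form_linear E" "form_linear E'"
  shows "form_linear (\<lambda>\<omega>. E \<omega> - E' \<omega>)"
  by (rule form_linearI)
    (simp_all add: form_linear_add[OF assms(1)] form_linear_add[OF assms(2)]
      form_linear_scale[OF assms(1)] form_linear_scale[OF assms(2)] form.scale_right_diff_distrib)

lemma form_linear_compose: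
  assumes "form_linear E" "form_linear E'"
  shows "form_linear (\<lambda>\<omega>. E (E' \<omega>))"
  by (rule form_linearI)
    (simp_all add: form_linear_add[OF assms(1)] form_linear_add[OF assms(2)]
      form_linear_scale[OF assms(1)] form_linear_scale[OF assms(2)]
      del: zero_fun_apply plus_fun_apply)

lemma form_linear_eq_on_span:
  assumes "form_linear E" "form_linear E'" "\<And>\<omega>. \<omega> \<in> B \<Longrightarrow> E \<omega> = E' \<omega>" "\<omega> \<in> form.span B"
  shows "E \<omega> = E' \<omega>"
  using assms(4)
  by (induction rule: form.span_induct_alt)
    (simp_all add: assms(3) form_linear_zero[OF assms(1)] form_linear_zero[OF assms(2)]
      form_linear_add[OF assms(1)] form_linear_add[OF assms(2)]
      form_linear_scale[OF assms(1)] form_linear_scale[OF assms(2)]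
      del: zero_fun_apply plus_fun_apply)

lemma form_linear_image_span:
  assumes "form_linear E" "\<And>\<omega>. \<omega> \<in> B \<Longrightarrow> E \<omega> \<in> form.span C" "\<omega> \<in> form.span B"
  shows "E \<omega> \<in> form.span C"
  using assms(3)
  by (induction rule: form.span_induct_alt)
    (simp_all add: assms(2) form_linear_zero[OF assms(1)] form_linear_add[OF assms(1)]
      form_linear_scale[OF assms(1)] form.span_add form.span_scale form.span_zero del: zero_fun_apply plus_fun_apply)

text \<open>The map is fixed on a basis chosen among the \<open>g i\<close>. For any other index,
  \<open>g i\<close> minus its expansion in the basis is a relation, and \<open>rel\<close> carries
  it over to the \<open>h i\<close>.\<close>

lemma form_linear_from_relations:
  fixes g h :: "'i \<Rightarrow> ('a, 'f::real_normed_field) form"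
  assumes I: "finite I"
    and rel: "\<And>c. (\<Sum>i\<in>I. form_scale (c i) (g i)) = 0 \<Longrightarrow> (\<Sum>i\<in>I. form_scale (c i) (h i)) = 0"
  shows "\<exists>E. form_linear E \<and> (\<forall>i\<in>I. E (g i) = h i)"
proof -
  interpret pair: vector_space_pair "form_scale :: 'f \<Rightarrow> ('a, 'f) form \<Rightarrow> ('a, 'f) form"
    "form_scale :: 'f \<Rightarrow> ('a, 'f) form \<Rightarrow> ('a, 'f) form" ..
  obtain B where B: "B \<subseteq> g ` I" "form.independent B" "g ` I \<subseteq> form.span B"
    by (rule form.maximal_independent_subset)
  have finB: "finite B" using B(1) I by (meson finite_imageI finite_subset)
  define e where "e b = (SOME i. i \<in> I \<and> g i = b)" for b
  have e: "e b \<in> I \<and> g (e b) = b" if "b \<in> B" for b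
    unfolding e_def using that B(1) by (intro someI_ex[of "\<lambda>i. i \<in> I \<and> g i = b"]) auto
  then have inj: "inj_on e B" by (metis inj_onI)
  obtain E where E: "Vector_Spaces.linear form_scale form_scale E" "\<forall>b\<in>B. E b = h (e b)"
    using pair.linear_independent_extend[OF B(2), of "\<lambda>b. h (e b)"] by blast
  have lin: "form_linear E"
    using E(1) by (intro form_linearI) (auto simp: Vector_Spaces.linear_iff)
  have "E (g i) = h i" if "i \<in> I" for i
  proof -
    have "g i \<in> form.span B" using that B(3) by auto
    then obtain d where d: "g i = (\<Sum>b\<in>B. form_scale (d b) b)"
      unfolding form.span_finite[OF finB] by auto
    \<comment> \<open>The relation between \<open>g i\<close> and its expansion, written on indices:
      \<open>1\<close> at \<open>i\<close>, minus \<open>d b\<close> at the chosen index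
      \<open>e b\<close>. Both parts meet if \<open>i\<close> itself was chosen.\<close>
    define c where "c j = (if j = i then 1 else 0) - (\<Sum>b\<in>B. if e b = j then d b else 0)" for j
    have c: "(\<Sum>j\<in>I. form_scale (c j) (f j)) = f i - (\<Sum>b\<in>B. form_scale (d b) (f (e b)))"
      for f :: "'i \<Rightarrow> ('a, 'f) form"
    proof -
      have "(\<Sum>j\<in>I. form_scale (c j) (f j)) = (\<Sum>j\<in>I. if j = i then f j else 0)
          - (\<Sum>j\<in>I. \<Sum>b\<in>B. if j = e b then form_scale (d b) (f j) else 0)"
        unfolding c_def form.scale_left_diff_distrib form.scale_sum_left sum_subtractf
        by (intro arg_cong2[where f = "(-)"] sum.cong) auto
      also have "(\<Sum>j\<in>I. \<Sum>b\<in>B. if j = e b then form_scale (d b) (f j) else 0) =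
          (\<Sum>b\<in>B. form_scale (d b) (f (e b)))"
        using I e by (subst sum.swap) (simp add: sum.delta)
      finally show ?thesis by (simp only: sum.delta[OF I] that if_True)
    qed
    have "(\<Sum>b\<in>B. form_scale (d b) (g (e b))) = g i"
      unfolding d using e by (intro sum.cong) auto
    then have "(\<Sum>j\<in>I. form_scale (c j) (g j)) = 0" by (simp add: c)
    then have "h i = (\<Sum>b\<in>B. form_scale (d b) (h (e b)))"
      using rel[of c] by (simp add: c)
    also have "\<dots> = E (g i)"
      unfolding d using E(2) by (simp add: form_linear_sum[OF lin] form_linear_scale[OF lin])
    finally show ?thesis by simp
  qed
  with lin show ?thesis by blast
qed

lemma form_linear_pullback: "form_linear (pullback T k f)"
  by (rule form_linearI) (auto simp: pullback_def form_on_def form_scale_def fun_eq_iff)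

section \<open>Affine maps that send vertices to vertices\<close>

lemma image_of_hspan:
  fixes A :: "'a::euclidean_space \<times> real \<Rightarrow> 'a \<times> real"
  assumes "linear A" "\<And>v. v \<in> X \<Longrightarrow> A (v, 1) = (\<phi> v, 1)" "z \<in> hspan X"
  shows "A z \<in> hspan (\<phi> ` X)" "snd (A z) = snd z"
proof -
  have "A z \<in> hspan (\<phi> ` X) \<and> snd (A z) = snd z"
    using assms(3) unfolding hspan_def
  proof (induction rule: span_induct_alt)
    case base
    then show ?case by (simp add: linear_0[OF assms(1)] span_zero)
  next
    case (step c b y)
    then obtain v where v: "v \<in> X" "b = (v, 1)" by auto
    have "(\<phi> v, 1) \<in> span ((\<lambda>u. (u, 1)) ` \<phi> ` X)" using v by (intro span_base) auto
    then show ?case using step.IH v assms(2)[OF v(1)]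
      by (auto simp: linear_add[OF assms(1)] linear_scale[OF assms(1)] intro!: span_add span_scale
          simp del: scaleR_Pair)
  qed
  then show "A z \<in> hspan (\<phi> ` X)" "snd (A z) = snd z" by auto
qed

text \<open>\<open>A\<close> lifts \<open>f\<close> to homogeneous coordinates, so it acts on points
  and tangent vectors at once. The image of the vertices need not exhaust \<open>T'\<close>;
  inclusions of faces are covered as well as \<open>S\<close> on \<open>F\<close> and
  \<open>S\<close> on \<open>T\<close>.\<close>

locale simplicial_map =
  fixes T T' :: "'a::euclidean_space list" and A :: "'a \<times> real \<Rightarrow> 'a \<times> real"
    and \<phi> f :: "'a \<Rightarrow> 'a"
  assumes T: "\<not> affine_dependent (set T)" and T': "\<not> affine_dependent (set T')"
    and A: "linear A" "\<And>v. v \<in> set T \<Longrightarrow> A (v, 1) = (\<phi> v, 1)"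
    and inj: "inj_on \<phi> (set T)" and img: "\<phi> ` set T \<subseteq> set T'"
    and f: "\<And>x. x \<in> body T \<Longrightarrow> f x = fst (A (x, 1))"
begin

lemma hcoord_push:
  assumes "z \<in> hspan (set T)" "v \<in> set T"
  shows "hcoord (set T') (\<phi> v) (A z) = hcoord (set T) v z"
  using assms(1) unfolding hspan_def
proof (induction rule: span_induct_alt)
  case base
  then show ?case by (simp add: linear_0[OF A(1)] linear_0[OF linear_hcoord] T T')
next
  case (step c b y)
  then obtain u where u: "u \<in> set T" "b = (u, 1)" by auto
  have "hcoord (set T') (\<phi> v) (\<phi> u, 1) = hcoord (set T) v (u, 1)"
    using u img inj assms(2) by (simp add: hcoord_vertex T T' image_subset_iff inj_on_eq_iff)
  then show ?case using step.IH A(2)[OF u(1)]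
    by (simp add: u linear_add[OF A(1)] linear_scale[OF A(1)] linear_add[OF linear_hcoord]
        linear_scale[OF linear_hcoord] T T' del: scaleR_Pair)
qed

lemma hspan_push: "z \<in> hspan (set T) \<Longrightarrow> A z \<in> hspan (set T')"
  using image_of_hspan(1)[OF A, where X = "set T"] hspan_mono[OF img] by blast

lemma point_push:
  assumes "x \<in> body T"
  shows "A (x, 1) = (f x, 1)" "f x \<in> body T'"
proof -
  note x = body_hspan[OF assms]
  show *: "A (x, 1) = (f x, 1)"
    using image_of_hspan(2)[OF A x] f[OF assms] by (simp add: prod_eq_iff)
  \<comment> \<open>A vertex of \<open>T'\<close> outside the image has coordinate \<open>0\<close>
    at \<open>f x\<close>; any other keeps the coordinate of its preimage.\<close>
  have "hcoord (set T') u (f x, 1) \<ge> 0" if "u \<in> set T'" for u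
  proof (cases "u \<in> \<phi> ` set T")
    case True
    then show ?thesis using hcoord_push[OF x] assms * T by (auto simp: body_iff_hcoord)
  next
    case False
    then show ?thesis
      using hcoord_subset(2)[OF T' img, of "A (x, 1)" u] image_of_hspan(1)[OF A x] that * by simp
  qed
  then show "f x \<in> body T'"
    using hspan_push[OF x] T' * by (simp add: body_iff_hcoord)
qed

lemma vector_push:
  assumes "x \<in> body T" "w \<in> tangent T"
  shows "A (w, 0) = (frechet_derivative f (at x within body T) w, 0)"
    and "frechet_derivative f (at x within body T) w \<in> tangent T'"
proof -
  have w: "(w, 0) \<in> hspan (set T)" using assms(2) by (simp add: tangent_hspan)
  have "frechet_derivative f (at x within body T) w = fst (A (w, 0))"
    using linear_compose[OF A(1) linear_fst] f assms
    by (intro frechet_derivative_affine[where l = "\<lambda>z. fst (A z)"]) (auto simp: o_def)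
  then show *: "A (w, 0) = (frechet_derivative f (at x within body T) w, 0)"
    using image_of_hspan(2)[OF A w] by (simp add: prod_eq_iff)
  then show "frechet_derivative f (at x within body T) w \<in> tangent T'"
    using hspan_push[OF w] by (simp add: tangent_hspan)
qed

lemma in_dom_push:
  assumes "in_dom T k x vs"
  shows "in_dom T' k (f x) (map (frechet_derivative f (at x within body T)) vs)"
  using assms point_push(2) vector_push(2) by (auto simp: in_dom_def)

lemma hcoord_point_push:
  "x \<in> body T \<Longrightarrow> v \<in> set T \<Longrightarrow> hcoord (set T') (\<phi> v) (f x, 1) = hcoord (set T) v (x, 1)"
  using hcoord_push[OF body_hspan] point_push(1) by simp

lemma hcoord_vector_push:
  "x \<in> body T \<Longrightarrow> w \<in> tangent T \<Longrightarrow> v \<in> set T \<Longrightarrow>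
    hcoord (set T') (\<phi> v) (frechet_derivative f (at x within body T) w, 0) = hcoord (set T) v (w, 0)"
  using hcoord_push[of "(w, 0)"] vector_push(1) by (simp add: tangent_hspan)

lemma monom_on_push:
  assumes "Y \<subseteq> set T" "x \<in> body T"
  shows "monom_on T' (\<phi> ` Y) a (f x) = monom_on T Y (a \<circ> \<phi>) x"
proof -
  have "inj_on \<phi> Y" using inj assms(1) by (rule inj_on_subset)
  then show ?thesis
    using assms by (simp add: monom_on_def prod.reindex hcoord_point_push subset_iff)
qed

lemma psi_push:
  assumes "Y \<subseteq> set T" "x \<in> body T" "w \<in> tangent T" "u \<in> set T"
  shows "psi T' (\<phi> ` Y) a (\<phi> u) (frechet_derivative f (at x within body T) w) = psi T Y (a \<circ> \<phi>) u w"
proof -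
  have "inj_on \<phi> Y" using inj assms(1) by (rule inj_on_subset)
  then show ?thesis
    using assms by (simp add: psi_def sum.reindex hcoord_vector_push subset_iff)
qed

lemma pullback_gen_full:
  assumes "Y \<subseteq> set T" "set s \<subseteq> set T"
  shows "pullback T (length s) f (gen_full T' (\<phi> ` Y) a (map \<phi> s)) = gen_full T Y (a \<circ> \<phi>) s"
proof (intro ext)
  fix x vs
  let ?D = "frechet_derivative f (at x within body T)"
  show "pullback T (length s) f (gen_full T' (\<phi> ` Y) a (map \<phi> s)) x vs = gen_full T Y (a \<circ> \<phi>) s x vs"
  proof (cases "in_dom T (length s) x vs")
    case True
    then have "x \<in> body T" by (simp add: in_dom_def)
    have "det_of (length s) (\<lambda>i j. psi T' (\<phi> ` Y) a (map \<phi> s ! i) (map ?D vs ! j)) =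
        det_of (length s) (\<lambda>i j. psi T Y (a \<circ> \<phi>) (s ! i) (vs ! j))"
      using True assms by (intro det_of_cong) (auto simp: in_dom_def psi_push subset_iff)
    with True show ?thesis
      using in_dom_push[OF True] monom_on_push[OF assms(1) \<open>x \<in> body T\<close>]
      by (simp add: pullback_def form_on_def gen_full_def) (simp add: in_dom_def)
  qed (auto simp: pullback_def form_on_def gen_full_def in_dom_def)
qed

lemma pullback_gen_minus:
  assumes "Y \<subseteq> set T" "set s \<subseteq> set T"
  shows "pullback T (length s - 1) f (gen_minus T' (\<phi> ` Y) a (map \<phi> s)) = gen_minus T Y (a \<circ> \<phi>) s"
proof (intro ext)
  fix x vs
  let ?D = "frechet_derivative f (at x within body T)"
  show "pullback T (length s - 1) f (gen_minus T' (\<phi> ` Y) a (map \<phi> s)) x vs = gen_minus T Y (a \<circ> \<phi>) s x vs"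
  proof (cases "in_dom T (length s - 1) x vs")
    case True
    then have "x \<in> body T" by (simp add: in_dom_def)
    have "det_of (length s) (\<lambda>i j. hcoord (set T') (map \<phi> s ! i) (if j = 0 then (f x, 1) else (map ?D vs ! (j - 1), 0))) =
        det_of (length s) (\<lambda>i j. hcoord (set T) (s ! i) (if j = 0 then (x, 1) else (vs ! (j - 1), 0)))"
      using True assms
      by (intro det_of_cong) (auto simp: in_dom_def hcoord_point_push hcoord_vector_push subset_iff)
    with True show ?thesis
      using in_dom_push[OF True] monom_on_push[OF assms(1) \<open>x \<in> body T\<close>]
      by (simp add: pullback_def form_on_def gen_minus_def) (simp add: in_dom_def)
  qed (auto simp: pullback_def form_on_def gen_minus_def in_dom_def)
qed

end

lemma simplicial_map_inclusion:
  assumes "\<not> affine_dependent (set F)" "set G \<subseteq> set F"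
  shows "simplicial_map G F (\<lambda>z. z) (\<lambda>v. v) (\<lambda>x. x)"
  using assms affine_dependent_subset[OF _ assms(2)] by unfold_locales (auto simp: linear_ident)

lemma pullback_face_gen:
  assumes F: "\<not> affine_dependent (set F)" "set G \<subseteq> set F" "Y \<subseteq> set G" "set s \<subseteq> set G"
  shows "pullback G (length s) (\<lambda>x. x) (gen_full F Y a s) = gen_full G Y a s"
    and "pullback G (length s - 1) (\<lambda>x. x) (gen_minus F Y a s) = gen_minus G Y a s"
  using simplicial_map.pullback_gen_full[OF simplicial_map_inclusion[OF F(1,2)] F(3,4), of a]
    simplicial_map.pullback_gen_minus[OF simplicial_map_inclusion[OF F(1,2)] F(3,4), of a]
  by (simp_all add: comp_def)

text \<open>\<open>\<lambda>\<^sub>v\<close> and its differential vanish on a face without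
  \<open>v\<close>: if \<open>a v > 0\<close> the monomial has a zero factor, and if
  \<open>v\<close> occurs in \<open>s\<close> the determinant has a zero row.\<close>

lemma pullback_face_zero:
  assumes F: "\<not> affine_dependent (set F)" "set G \<subseteq> set F"
    and v: "v \<in> set F" "v \<notin> set G" "a v > 0 \<or> v \<in> set s"
  shows "pullback G (length s) (\<lambda>x. x) (gen_full F (set F) a s) = 0"
    and "pullback G (length s - 1) (\<lambda>x. x) (gen_minus F (set F) a s) = 0"
proof -
  interpret simplicial_map G F "\<lambda>z. z" "\<lambda>v. v" "\<lambda>x. x"
    using F by (rule simplicial_map_inclusion)
  have z: "hcoord (set F) v z = 0" if "z \<in> hspan (set G)" for z
    using hcoord_subset(2)[OF F that v(1,2)] .
  have m: "monom_on F (set F) a x = 0" if "x \<in> body G" "a v > 0" for x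
    unfolding monom_on_def using that v(1) z[OF body_hspan[OF that(1)]] by (intro prod_zero) auto
  let ?D = "\<lambda>x. frechet_derivative (\<lambda>x. x) (at x within body G)"
  have D: "hcoord (set F) v (?D x w, 0) = 0" if "x \<in> body G" "w \<in> tangent G" for x w
    using z[of "(w, 0)"] vector_push(1)[OF that] that by (simp add: tangent_hspan)
  have "gen_full F (set F) a s x (map (?D x) vs) = 0" if "in_dom G (length s) x vs" for x vs
  proof (cases "a v > 0")
    case True
    then show ?thesis using m that by (simp add: gen_full_def in_dom_def)
  next
    case False
    then obtain i where i: "i < length s" "s ! i = v" using v(3) by (auto simp: in_set_conv_nth)
    have "det_of (length s) (\<lambda>i j. hcoord (set F) (s ! i) (map (?D x) vs ! j, 0)) = 0"
    proof (rule det_of_zero_row[OF i(1)])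
      fix j assume "j < length s"
      then show "hcoord (set F) (s ! i) (map (?D x) vs ! j, 0) = 0"
        using D[of x "vs ! j"] that i(2) by (auto simp: in_dom_def subset_iff)
    qed
    then show ?thesis by (simp add: gen_full_self F)
  qed
  then show "pullback G (length s) (\<lambda>x. x) (gen_full F (set F) a s) = 0"
    by (auto simp: pullback_def form_on_def in_dom_def fun_eq_iff)
  have "gen_minus F (set F) a s x (map (?D x) vs) = 0" if "in_dom G (length s - 1) x vs" for x vs
  proof (cases "a v > 0")
    case True
    then show ?thesis using m that by (simp add: gen_minus_def in_dom_def)
  next
    case False
    then obtain i where i: "i < length s" "s ! i = v" using v(3) by (auto simp: in_set_conv_nth)
    have "det_of (length s) (\<lambda>i j. hcoord (set F) (s ! i) (if j = 0 then (x, 1) else (map (?D x) vs ! (j - 1), 0))) = 0"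
    proof (rule det_of_zero_row[OF i(1)])
      fix j assume j: "j < length s"
      have x: "x \<in> body G" using that by (simp add: in_dom_def)
      show "hcoord (set F) (s ! i) (if j = 0 then (x, 1) else (map (?D x) vs ! (j - 1), 0)) = 0"
        using D[OF x, of "vs ! (j - 1)"] z[OF body_hspan[OF x]] that i(2) j by (auto simp: in_dom_def subset_iff)
    qed
    then show ?thesis by (simp add: gen_minus_def)
  qed
  then show "pullback G (length s - 1) (\<lambda>x. x) (gen_minus F (set F) a s) = 0"
    by (auto simp: pullback_def form_on_def in_dom_def fun_eq_iff)
qed

section \<open>Polynomial forms as spans of labelled generators\<close>

definition labels :: "'a set \<Rightarrow> nat \<Rightarrow> ('a \<Rightarrow> nat) set" where
  "labels Y r = {a. (\<forall>v. v \<notin> Y \<longrightarrow> a v = 0) \<and> sum a Y = r}"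

text \<open>Lists may be unsorted and may repeat vertices, which makes the family stable under
  \<open>S\<close>. The predicate \<open>Q\<close> on the vertices involved selects all generators
  or those involving every vertex; for \<open>minus_gens\<close>, inclusion of a given set serves as
  a stage between the two.\<close>

definition full_gens ::
  "'a::euclidean_space list \<Rightarrow> nat \<Rightarrow> nat \<Rightarrow> ('a set \<Rightarrow> bool) \<Rightarrow> ('a, 'f::real_normed_field) form set" where
  "full_gens F r k Q = {gen_full F (set F) a s | a s. a \<in> labels (set F) r \<and> length s = k \<and>
     set s \<subseteq> set F \<and> Q ({v. a v > 0} \<union> set s)}"

definition minus_gens ::
  "'a::euclidean_space list \<Rightarrow> nat \<Rightarrow> nat \<Rightarrow> ('a set \<Rightarrow> bool) \<Rightarrow> ('a, 'f::real_normed_field) form set" where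
  "minus_gens F r k Q = {gen_minus F (set F) a s | a s. a \<in> labels (set F) r \<and> length s = k \<and>
     set s \<subseteq> set F \<and> Q ({v. a v > 0} \<union> set s)}"

lemma finite_labels:
  assumes "finite Y"
  shows "finite (labels Y r)"
proof -
  have "a v \<le> r" if "a \<in> labels Y r" "v \<in> Y" for a v
    using that assms member_le_sum[of v Y a] by (auto simp: labels_def)
  then have "labels Y r \<subseteq> {a. \<forall>v. (v \<in> Y \<longrightarrow> a v \<in> {..r}) \<and> (v \<notin> Y \<longrightarrow> a v = 0)}"
    by (auto simp: labels_def)
  then show ?thesis
    using finite_set_of_finite_funs[OF assms, of "{..r}" 0] finite_subset by blast
qed

lemma labels_superset_iff:
  assumes "finite Z" "Y \<subseteq> Z"
  shows "a \<in> labels Y r \<longleftrightarrow> a \<in> labels Z r \<and> (\<forall>v. v \<notin> Y \<longrightarrow> a v = 0)"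
proof -
  have "sum a Z = sum a Y" if "\<forall>v. v \<notin> Y \<longrightarrow> a v = 0"
    using assms that by (intro sum.mono_neutral_right) auto
  then show ?thesis using assms(2) by (auto simp: labels_def)
qed

lemma increasing_bound: "F \<noteq> [] \<Longrightarrow> \<sigma> \<in> increasing k (sdim F) \<Longrightarrow> i \<in> set \<sigma> \<Longrightarrow> i < length F"
  by (cases F) (auto simp: increasing_def sdim_def)

lemma vlabel_in_labels:
  assumes "distinct F" "F \<noteq> []" "\<alpha> \<in> multiindices r (sdim F)"
  shows "vlabel F \<alpha> \<in> labels (set F) r"
  using assms sum_vlabel[OF assms(1,2), of \<alpha>]
  by (auto simp: labels_def multiindices_def vlabel_outside)

lemma vlabel_support:
  assumes "distinct F" "F \<noteq> []" "\<alpha> \<in> multiindices r (sdim F)"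
  shows "{v. vlabel F \<alpha> v > 0} = (!) F ` supp \<alpha>"
proof -
  have "i < length F" if "\<alpha> i > 0" for i
    using that assms(3) by (cases "i \<le> sdim F") (auto simp: multiindices_def sdim_def Suc_le_eq
        intro: le_less_trans[of i "length F - 1"] simp: assms(2) length_greater_0_conv)
  then show ?thesis
    using assms(1) by (auto simp: supp_def vlabel_nth in_set_conv_nth image_iff)
      (metis gr_zeroI in_set_conv_nth less_irrefl vlabel_nth vlabel_outside)
qed

lemma labels_eq_vlabel:
  assumes "distinct F" "F \<noteq> []" "a \<in> labels (set F) r"
  obtains \<alpha> where "\<alpha> \<in> multiindices r (sdim F)" "vlabel F \<alpha> = a"
proof -
  define \<alpha> where "\<alpha> i = (if i < length F then a (F ! i) else 0)" for i
  have *: "vlabel F \<alpha> = a"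
  proof
    fix v
    show "vlabel F \<alpha> v = a v"
      using assms(1,3) vlabel_nth[OF assms(1), of _ \<alpha>]
      by (cases "v \<in> set F") (auto simp: in_set_conv_nth \<alpha>_def vlabel_outside labels_def)
  qed
  have "\<alpha> i = 0" if "i > sdim F" for i
    using that assms(2) by (cases F) (auto simp: \<alpha>_def sdim_def)
  then have "\<alpha> \<in> multiindices r (sdim F)"
    using sum_vlabel[OF assms(1,2), of \<alpha>] assms(3) by (simp add: * multiindices_def labels_def)
  with * show ?thesis using that by blast
qed

section \<open>Sorted and unsorted vertex lists\<close>

lemma sort_to_increasing:
  assumes "distinct F" "F \<noteq> []" "distinct s" "set s \<subseteq> set F"
  obtains \<sigma> p where "\<sigma> \<in> increasing (length s) (sdim F)" "p permutes {..<length s}"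
    "set (map ((!) F) \<sigma>) = set s" "\<And>i. i < length s \<Longrightarrow> s ! i = map ((!) F) \<sigma> ! p i"
proof -
  let ?I = "{i. i < length F \<and> F ! i \<in> set s}"
  define \<sigma> where "\<sigma> = sorted_list_of_set ?I"
  have fin: "finite ?I" by simp
  have img: "(!) F ` ?I = set s" using assms(4) by (auto simp: in_set_conv_nth image_iff) (metis in_mono in_set_conv_nth nth_mem)
  have inj: "inj_on ((!) F) ?I" using assms(1) by (auto simp: inj_on_def nth_eq_iff_index_eq)
  have set\<sigma>: "set \<sigma> = ?I" using fin by (simp add: \<sigma>_def)
  have dist: "distinct (map ((!) F) \<sigma>)" using inj set\<sigma> by (simp add: distinct_map \<sigma>_def)
  have set_eq: "set (map ((!) F) \<sigma>) = set s" using img set\<sigma> by simp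
  then have "mset s = mset (map ((!) F) \<sigma>)"
    using dist assms(3) by (metis set_eq_iff_mset_eq_distinct)
  then obtain p where p: "p permutes {..<length (map ((!) F) \<sigma>)}" "permute_list p (map ((!) F) \<sigma>) = s"
    by (rule mset_eq_permutation)
  have len: "length (map ((!) F) \<sigma>) = length s" using p(2) by (metis length_permute_list)
  have "\<sigma> \<in> increasing (length s) (sdim F)"
    using len set\<sigma> assms(2) by (auto simp: increasing_def \<sigma>_def sdim_def)
  moreover have "s ! i = map ((!) F) \<sigma> ! p i" if "i < length s" for i
    using p that len by (metis permute_list_nth)
  ultimately show ?thesis using that p(1) set_eq unfolding len by blast
qed

lemma det_of_permuted_list:
  assumes "p permutes {..<k}" "\<And>i. i < k \<Longrightarrow> s ! i = s' ! p i"
  shows "det_of k (\<lambda>i. M (s ! i)) = of_int (sign p) * det_of k (\<lambda>i. M (s' ! i))"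
proof -
  have "det_of k (\<lambda>i. M (s ! i)) = det_of k (\<lambda>i. M (s' ! p i))" by (rule det_of_cong) (simp add: assms(2))
  also have "\<dots> = of_int (sign p) * det_of k (\<lambda>i. M (s' ! i))"
    by (rule det_of_permute_rows[OF assms(1)])
  finally show ?thesis .
qed

lemma det_of_repeated_list:
  assumes "length s = k" "\<not> distinct s"
  shows "det_of k (\<lambda>i. M (s ! i)) = 0"
  using assms det_of_identical_rows[of _ k _ "\<lambda>i. M (s ! i)"] by (auto simp: distinct_conv_nth)

lemma gen_full_permuted:
  assumes "p permutes {..<length s}" "\<And>i. i < length s \<Longrightarrow> s ! i = s' ! p i" "length s' = length s"
  shows "gen_full T Y a s = form_scale (of_int (sign p)) (gen_full T Y a s')"
  using det_of_permuted_list[OF assms(1,2), of "\<lambda>u j. psi T Y a u (vs ! j)" for vs] assms(3)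
  by (simp add: gen_full_def form_scale_def fun_eq_iff)

lemma gen_minus_permuted:
  assumes "p permutes {..<length s}" "\<And>i. i < length s \<Longrightarrow> s ! i = s' ! p i" "length s' = length s"
  shows "gen_minus T Y a s = form_scale (of_int (sign p)) (gen_minus T Y a s')"
  using det_of_permuted_list[OF assms(1,2), of "\<lambda>u j. hcoord (set T) u (if j = 0 then (x, 1) else (vs ! (j - 1), 0))" for x vs]
    assms(3)
  by (simp add: gen_minus_def form_scale_def fun_eq_iff)

lemma gen_full_repeated: "\<not> distinct s \<Longrightarrow> gen_full T Y a s = 0"
  using det_of_repeated_list[OF refl, of s "\<lambda>u j. psi T Y a u (vs ! j)" for vs]
  by (simp add: gen_full_def fun_eq_iff)

lemma gen_minus_repeated: "\<not> distinct s \<Longrightarrow> gen_minus T Y a s = 0"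
  using det_of_repeated_list[OF refl, of s "\<lambda>u j. hcoord (set T) u (if j = 0 then (x, 1) else (vs ! (j - 1), 0))" for x vs]
  by (simp add: gen_minus_def fun_eq_iff)

context
  fixes F :: "'a::euclidean_space list"
  assumes F: "\<not> affine_dependent (set F)" "distinct F" "F \<noteq> []"
begin

text \<open>An unsorted list gives a sorted generator up to sign, and a list with a repetition gives
  \<open>0\<close>. Sorting keeps the set of vertices, so the condition \<open>Q\<close>
  survives.\<close>

lemma span_full_gens:
  "form.span {fun_mult (bary_monom F \<alpha>) (dbary_wedge F \<sigma>) | \<alpha> \<sigma>.
      \<alpha> \<in> multiindices r (sdim F) \<and> \<sigma> \<in> increasing k (sdim F) \<and> Q ((!) F ` (supp \<alpha> \<union> set \<sigma>))} =
   form.span (full_gens F r k Q :: ('a, 'f::real_normed_field) form set)"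
  (is "form.span ?P = form.span ?G")
proof (rule antisym)
  have "?P \<subseteq> ?G"
  proof
    fix \<omega> :: "('a, 'f) form" assume "\<omega> \<in> ?P"
    then obtain \<alpha> \<sigma> where *: "\<omega> = fun_mult (bary_monom F \<alpha>) (dbary_wedge F \<sigma>)"
      "\<alpha> \<in> multiindices r (sdim F)" "\<sigma> \<in> increasing k (sdim F)" "Q ((!) F ` (supp \<alpha> \<union> set \<sigma>))" by blast
    note b = increasing_bound[OF F(3) *(3)]
    have "\<omega> = gen_full F (set F) (vlabel F \<alpha>) (map ((!) F) \<sigma>)"
      unfolding *(1) by (rule full_generator[OF F b])
    then show "\<omega> \<in> ?G"
      unfolding full_gens_def using * b vlabel_in_labels[OF F(2,3) *(2)] vlabel_support[OF F(2,3) *(2)]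
      by (auto simp: increasing_def image_Un intro!: exI[of _ "vlabel F \<alpha>"] exI[of _ "map ((!) F) \<sigma>"])
  qed
  then show "form.span ?P \<subseteq> form.span ?G" by (rule form.span_mono)
  have "\<omega> \<in> form.span ?P" if \<omega>: "\<omega> \<in> ?G" for \<omega> :: "('a, 'f) form"
  proof -
    obtain a s where *: "\<omega> = gen_full F (set F) a s" "a \<in> labels (set F) r" "length s = k"
      "set s \<subseteq> set F" "Q ({v. a v > 0} \<union> set s)" using \<omega> unfolding full_gens_def by blast
    show ?thesis
    proof (cases "distinct s")
      case True
      obtain \<sigma> p where \<sigma>: "\<sigma> \<in> increasing (length s) (sdim F)" "p permutes {..<length s}"
        "set (map ((!) F) \<sigma>) = set s" "\<And>i. i < length s \<Longrightarrow> s ! i = map ((!) F) \<sigma> ! p i"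
        using sort_to_increasing[OF F(2,3) True *(4)] by metis
      obtain \<alpha> where \<alpha>: "\<alpha> \<in> multiindices r (sdim F)" "vlabel F \<alpha> = a"
        by (rule labels_eq_vlabel[OF F(2,3) *(2)])
      have len: "length (map ((!) F) \<sigma>) = length s" using \<sigma>(1) by (simp add: increasing_def)
      have \<omega>_eq: "\<omega> = form_scale (of_int (sign p)) (fun_mult (bary_monom F \<alpha>) (dbary_wedge F \<sigma>))"
        using gen_full_permuted[OF \<sigma>(2,4) len, of F "set F" a, where ?'b = 'f]
          full_generator[OF F, of \<sigma> \<alpha>, where ?'b = 'f] increasing_bound[OF F(3) \<sigma>(1)]
        by (simp add: \<alpha>(2) *(1))
      have "Q ((!) F ` (supp \<alpha> \<union> set \<sigma>))"
        using *(5) \<sigma>(3) vlabel_support[OF F(2,3) \<alpha>(1)] by (simp add: \<alpha>(2) image_Un)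
      then have "fun_mult (bary_monom F \<alpha>) (dbary_wedge F \<sigma>) \<in> ?P"
        using \<alpha>(1) \<sigma>(1) unfolding *(3) by blast
      with \<omega>_eq show ?thesis by (simp only: form.span_scale form.span_base)
    next
      case False
      then have "\<omega> = 0" unfolding *(1) by (rule gen_full_repeated)
      then show ?thesis by (simp only: form.span_zero)
    qed
  qed
  then show "form.span ?G \<subseteq> form.span ?P" by (intro form.span_minimal form.subspace_span) blast
qed

text \<open>Here \<open>r\<close> is the degree of the monomials, one less than the degree index of
  the space, and \<open>Suc k\<close> vertices belong to a \<open>k\<close>-form.\<close>

lemma span_minus_gens:
  "form.span {fun_mult (bary_monom F \<alpha>) (whitney F \<rho>) | \<alpha> \<rho>.
      \<alpha> \<in> multiindices r (sdim F) \<and> \<rho> \<in> increasing (Suc k) (sdim F) \<and> Q ((!) F ` (supp \<alpha> \<union> set \<rho>))} =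
   form.span (minus_gens F r (Suc k) Q :: ('a, 'f::real_normed_field) form set)"
  (is "form.span ?P = form.span ?G")
proof (rule antisym)
  have "?P \<subseteq> ?G"
  proof
    fix \<omega> :: "('a, 'f) form" assume "\<omega> \<in> ?P"
    then obtain \<alpha> \<sigma> where *: "\<omega> = fun_mult (bary_monom F \<alpha>) (whitney F \<sigma>)"
      "\<alpha> \<in> multiindices r (sdim F)" "\<sigma> \<in> increasing (Suc k) (sdim F)" "Q ((!) F ` (supp \<alpha> \<union> set \<sigma>))" by blast
    note b = increasing_bound[OF F(3) *(3)]
    have "\<sigma> \<noteq> []" using *(3) by (auto simp: increasing_def)
    then have "\<omega> = gen_minus F (set F) (vlabel F \<alpha>) (map ((!) F) \<sigma>)"
      unfolding *(1) by (intro minus_generator[OF F b])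
    then show "\<omega> \<in> ?G"
      unfolding minus_gens_def using * b vlabel_in_labels[OF F(2,3) *(2)] vlabel_support[OF F(2,3) *(2)]
      by (auto simp: increasing_def image_Un intro!: exI[of _ "vlabel F \<alpha>"] exI[of _ "map ((!) F) \<sigma>"])
  qed
  then show "form.span ?P \<subseteq> form.span ?G" by (rule form.span_mono)
  have "\<omega> \<in> form.span ?P" if \<omega>: "\<omega> \<in> ?G" for \<omega> :: "('a, 'f) form"
  proof -
    obtain a s where *: "\<omega> = gen_minus F (set F) a s" "a \<in> labels (set F) r" "length s = Suc k"
      "set s \<subseteq> set F" "Q ({v. a v > 0} \<union> set s)" using \<omega> unfolding minus_gens_def by blast
    show ?thesis
    proof (cases "distinct s")
      case True
      obtain \<sigma> p where \<sigma>: "\<sigma> \<in> increasing (length s) (sdim F)" "p permutes {..<length s}"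
        "set (map ((!) F) \<sigma>) = set s" "\<And>i. i < length s \<Longrightarrow> s ! i = map ((!) F) \<sigma> ! p i"
        using sort_to_increasing[OF F(2,3) True *(4)] by metis
      obtain \<alpha> where \<alpha>: "\<alpha> \<in> multiindices r (sdim F)" "vlabel F \<alpha> = a"
        by (rule labels_eq_vlabel[OF F(2,3) *(2)])
      have len: "length (map ((!) F) \<sigma>) = length s" using \<sigma>(1) by (simp add: increasing_def)
      then have "\<sigma> \<noteq> []" using *(3) by auto
      then have \<omega>_eq: "\<omega> = form_scale (of_int (sign p)) (fun_mult (bary_monom F \<alpha>) (whitney F \<sigma>))"
        using gen_minus_permuted[OF \<sigma>(2,4) len, of F "set F" a, where ?'b = 'f]
          minus_generator[OF F, of \<sigma> \<alpha>, where ?'b = 'f] increasing_bound[OF F(3) \<sigma>(1)]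
        by (simp add: \<alpha>(2) *(1))
      have "Q ((!) F ` (supp \<alpha> \<union> set \<sigma>))"
        using *(5) \<sigma>(3) vlabel_support[OF F(2,3) \<alpha>(1)] by (simp add: \<alpha>(2) image_Un)
      then have "fun_mult (bary_monom F \<alpha>) (whitney F \<sigma>) \<in> ?P"
        using \<alpha>(1) \<sigma>(1) unfolding *(3) by blast
      with \<omega>_eq show ?thesis by (simp only: form.span_scale form.span_base)
    next
      case False
      then have "\<omega> = 0" unfolding *(1) by (rule gen_minus_repeated)
      then show ?thesis by (simp only: form.span_zero)
    qed
  qed
  then show "form.span ?G \<subseteq> form.span ?P" by (intro form.span_minimal form.subspace_span) blast
qed

lemma Pfull_eq_span: "Pfull r k F = form.span (full_gens F r k (\<lambda>_. True))"
  using span_full_gens[of r k "\<lambda>_. True"] by (simp add: Pfull_def)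

lemma Pminus_eq_span: "r > 0 \<Longrightarrow> Pminus r k F = form.span (minus_gens F (r - 1) (Suc k) (\<lambda>_. True))"
  using span_minus_gens[of "r - 1" k "\<lambda>_. True"] by (simp add: Pminus_def Suc_le_eq)

lemma nth_image_full_iff:
  assumes "\<alpha> \<in> multiindices r (sdim F)" "\<sigma> \<in> increasing k (sdim F)"
  shows "(!) F ` (supp \<alpha> \<union> set \<sigma>) = set F \<longleftrightarrow> supp \<alpha> \<union> set \<sigma> = {0..sdim F}"
proof -
  have U: "supp \<alpha> \<union> set \<sigma> \<subseteq> {..<length F}"
  proof -
    have "i \<le> sdim F" if "\<alpha> i > 0" for i
      using that assms(1) by (metis (mono_tags, lifting) less_irrefl mem_Collect_eq multiindices_def not_le_imp_less)
    then show ?thesis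
      using increasing_bound[OF F(3) assms(2)] F(3) atMost_sdim[OF F(3)] by (auto simp: supp_def)
  qed
  have inj: "inj_on ((!) F) {..<length F}" using F(2) by (simp add: inj_on_nth)
  have "set F = (!) F ` {..<length F}" by (auto simp: in_set_conv_nth image_iff)
  then have "(!) F ` (supp \<alpha> \<union> set \<sigma>) = set F \<longleftrightarrow> supp \<alpha> \<union> set \<sigma> = {..<length F}"
    using inj_on_image_eq_iff[OF inj U] by auto
  then show ?thesis by (simp only: atLeast0_sdim[OF F(3)])
qed

end

section \<open>Faces and vanishing traces\<close>

lemma subsimplex_set: "subsimplex G F \<Longrightarrow> set G \<subseteq> set F"
  by (auto simp: subsimplex_def subseq_conv_nths dest: in_set_nthsD)

text \<open>A distinct sublist with the same elements has the same length, and a sublist of full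
  length is the whole list.\<close>

lemma proper_subsimplex_vertex:
  assumes "subsimplex G F" "G \<noteq> F" "distinct F"
  obtains v where "v \<in> set F" "v \<notin> set G"
proof -
  have sub: "subseq G F" "set G \<subseteq> set F" using assms(1) subsimplex_set by (auto simp: subsimplex_def)
  have "distinct G" using sub(1) assms(3) by (auto simp: subseq_conv_nths)
  moreover have "length G \<noteq> length F" using sub(1) assms(2) subseq_same_length by blast
  ultimately have "set G \<noteq> set F" using assms(3) by (metis distinct_card)
  with sub(2) show ?thesis using that by blast
qed

lemma subsimplex_filter: "Y \<inter> set F \<noteq> {} \<Longrightarrow> subsimplex (filter (\<lambda>v. v \<in> Y) F) F"
  by (auto simp: subsimplex_def filter_empty_conv)

lemma subspace_vanishing_traces: "form.subspace (vanishing_traces k F)"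
  unfolding form.subspace_def vanishing_traces_def
  by (simp add: form_linear_zero[OF form_linear_pullback] form_linear_add[OF form_linear_pullback]
      form_linear_scale[OF form_linear_pullback] del: zero_fun_apply plus_fun_apply)

text \<open>A proper face misses some vertex, and a generator that involves all vertices involves
  that one.\<close>

lemma gens_vanishing:
  assumes F: "\<not> affine_dependent (set F)" "distinct F"
  shows "full_gens F r k (\<lambda>U. U = set F) \<subseteq>
      (vanishing_traces k F :: ('a::euclidean_space, 'f::real_normed_field) form set)"
    and "minus_gens F r (Suc k) (\<lambda>U. U = set F) \<subseteq>
      (vanishing_traces k F :: ('a, 'f) form set)"
proof -
  have *: "\<exists>v. v \<in> set F \<and> v \<notin> set G \<and> (a v > 0 \<or> v \<in> set s)"
    if G: "subsimplex G F \<and> G \<noteq> F" and "{v. a v > 0} \<union> set s = set F" for G a s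
  proof -
    obtain v where "v \<in> set F" "v \<notin> set G"
      using proper_subsimplex_vertex F(2) G by metis
    then show ?thesis using that(2) by blast
  qed
  show "full_gens F r k (\<lambda>U. U = set F) \<subseteq> (vanishing_traces k F :: ('a, 'f) form set)"
  proof
    fix \<omega> :: "('a, 'f) form" assume "\<omega> \<in> full_gens F r k (\<lambda>U. U = set F)"
    then obtain a s where \<omega>: "\<omega> = gen_full F (set F) a s" "length s = k" "{v. a v > 0} \<union> set s = set F"
      by (auto simp: full_gens_def)
    show "\<omega> \<in> vanishing_traces k F"
      unfolding vanishing_traces_def
    proof (intro CollectI allI impI)
      fix G assume G: "subsimplex G F \<and> G \<noteq> F"
      then show "pullback G k (\<lambda>x. x) \<omega> = 0"
        using *[OF G \<omega>(3)] pullback_face_zero(1)[OF F(1) subsimplex_set, of G _ a s] \<omega>(1,2) by blast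
    qed
  qed
  show "minus_gens F r (Suc k) (\<lambda>U. U = set F) \<subseteq> (vanishing_traces k F :: ('a, 'f) form set)"
  proof
    fix \<omega> :: "('a, 'f) form" assume "\<omega> \<in> minus_gens F r (Suc k) (\<lambda>U. U = set F)"
    then obtain a s where \<omega>: "\<omega> = gen_minus F (set F) a s" "length s = Suc k" "{v. a v > 0} \<union> set s = set F"
      by (auto simp: minus_gens_def)
    then have "length s - 1 = k" by simp
    show "\<omega> \<in> vanishing_traces k F"
      unfolding vanishing_traces_def
    proof (intro CollectI allI impI)
      fix G assume G: "subsimplex G F \<and> G \<noteq> F"
      then show "pullback G k (\<lambda>x. x) \<omega> = 0"
        using *[OF G \<omega>(3)] pullback_face_zero(2)[OF F(1) subsimplex_set, of G _ a s] \<omega>(1) \<open>length s - 1 = k\<close>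
        by blast
    qed
  qed
qed

section \<open>The extension operators for \<open>P\<^sup>-\<close>\<close>

text \<open>Shared by both operators: \<open>E0\<close> is any globally linear map with the
  prescribed values. These values determine a linear map on the span, and
  \<open>\<rightarrow>\<^sub>E\<close> fixes it off the span.\<close>

lemma extension_operator_unique:
  fixes E0 :: "('a, 'f::real_normed_field) form \<Rightarrow> ('a, 'f) form"
  assumes V: "V = form.span {g \<alpha> \<sigma> | \<alpha> \<sigma>. \<alpha> \<in> A \<and> \<sigma> \<in> B \<and> C \<alpha> \<sigma>}"
    and E0: "form_linear E0" "\<And>\<omega>. \<omega> \<in> V \<Longrightarrow> E0 \<omega> \<in> W"
    "\<And>\<alpha> \<sigma>. \<alpha> \<in> A \<Longrightarrow> \<sigma> \<in> B \<Longrightarrow> C \<alpha> \<sigma> \<Longrightarrow> E0 (g \<alpha> \<sigma>) = h \<alpha> \<sigma>"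
  shows "(THE E. E \<in> V \<rightarrow>\<^sub>E W \<and> form_linear_on V E \<and>
      (\<forall>\<alpha>\<in>A. \<forall>\<sigma>\<in>B. C \<alpha> \<sigma> \<longrightarrow> E (g \<alpha> \<sigma>) = h \<alpha> \<sigma>)) = restrict E0 V"
proof (rule the_equality)
  have sub: "form.subspace V" unfolding V by (rule form.subspace_span)
  have g: "g \<alpha> \<sigma> \<in> V" if "\<alpha> \<in> A" "\<sigma> \<in> B" "C \<alpha> \<sigma>" for \<alpha> \<sigma>
    unfolding V using that by (intro form.span_base) blast
  have "form_linear_on V (restrict E0 V)"
    unfolding form_linear_on_def
    using form.subspace_add[OF sub] form.subspace_scale[OF sub]
    by (simp add: form_linear_add[OF E0(1)] form_linear_scale[OF E0(1)] del: plus_fun_apply)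
  then show "restrict E0 V \<in> V \<rightarrow>\<^sub>E W \<and> form_linear_on V (restrict E0 V) \<and>
      (\<forall>\<alpha>\<in>A. \<forall>\<sigma>\<in>B. C \<alpha> \<sigma> \<longrightarrow> restrict E0 V (g \<alpha> \<sigma>) = h \<alpha> \<sigma>)"
    using E0 g by auto
  fix E assume E: "E \<in> V \<rightarrow>\<^sub>E W \<and> form_linear_on V E \<and>
      (\<forall>\<alpha>\<in>A. \<forall>\<sigma>\<in>B. C \<alpha> \<sigma> \<longrightarrow> E (g \<alpha> \<sigma>) = h \<alpha> \<sigma>)"
  then have add: "\<And>\<omega> \<eta>. \<omega> \<in> V \<Longrightarrow> \<eta> \<in> V \<Longrightarrow> E (\<omega> + \<eta>) = E \<omega> + E \<eta>"
    and scale: "\<And>c \<omega>. \<omega> \<in> V \<Longrightarrow> E (form_scale c \<omega>) = form_scale c (E \<omega>)"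
    by (auto simp: form_linear_on_def)
  \<comment> \<open>Membership belongs to the induction claim: \<open>E\<close> is additive on
    \<open>V\<close> only, so the rest of a linear combination must be known to lie there.\<close>
  have "\<omega> \<in> V \<and> E \<omega> = E0 \<omega>" if "\<omega> \<in> V" for \<omega>
    using that unfolding V
  proof (induction rule: form.span_induct_alt)
    case base
    \<comment> \<open>Linearity on a subspace is stated without \<open>E 0 = 0\<close>; scaling the
      zero form by \<open>0\<close> supplies it.\<close>
    have "E (form_scale 0 0) = form_scale 0 (E 0)" using form.subspace_0[OF sub] by (rule scale)
    then show ?case unfolding V[symmetric] form_linear_zero[OF E0(1)] form.scale_zero_left
      using form.subspace_0[OF sub] by blast
  next
    case (step c x y)
    then obtain \<alpha> \<sigma> where x: "x = g \<alpha> \<sigma>" "\<alpha> \<in> A" "\<sigma> \<in> B" "C \<alpha> \<sigma>" by blast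
    have xV: "x \<in> V" and yV: "y \<in> V" using g x step.IH V by auto
    have "E (g \<alpha> \<sigma>) = h \<alpha> \<sigma>" using E x(2-4) by simp
    then have "E x = E0 x" unfolding x(1) E0(3)[OF x(2-4)] .
    then have "E (form_scale c x + y) = E0 (form_scale c x + y)"
      using step.IH
      unfolding add[OF form.subspace_scale[OF sub xV] yV] scale[OF xV]
        form_linear_add[OF E0(1)] form_linear_scale[OF E0(1)] by (simp only:)
    then show ?case
      unfolding V[symmetric] using form.subspace_add[OF sub form.subspace_scale[OF sub xV] yV] by blast
  qed
  then show "E = restrict E0 V"
    using E by (intro extensionalityI[of E V]) (auto simp: PiE_def)
qed

text \<open>
  The factor \<open>s ^ r\<close> compensates the degree in \<open>x\<close>; the vectors are not divided by \<open>s\<close> since the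
  generators are already homogeneous of degree \<open>1\<close> in each of them.
\<close>

definition minus_ext ::
  "'a::euclidean_space list \<Rightarrow> 'a set \<Rightarrow> nat \<Rightarrow> nat \<Rightarrow> ('a, 'f::real_normed_field) form \<Rightarrow> ('a, 'f) form" where
  "minus_ext T Y k r \<omega> = (\<lambda>x vs. let S = (\<lambda>z. \<Sum>y\<in>Y. hcoord (set T) y z); s = S (x, 1) in
     if in_dom T k x vs \<and> s \<noteq> 0
     then of_real (s ^ r) * \<omega> (\<Sum>y\<in>Y. (hcoord (set T) y (x, 1) / s) *\<^sub>R y)
       (map (\<lambda>w. \<Sum>y\<in>Y. (hcoord (set T) y (w, 0) - S (w, 0) / s * hcoord (set T) y (x, 1)) *\<^sub>R y) vs)
     else 0)"

lemma form_linear_minus_ext: "form_linear (minus_ext T Y k r)"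
  by (rule form_linearI) (auto simp: minus_ext_def Let_def form_scale_def fun_eq_iff distrib_left)

lemma det_of_zero_first_column:
  assumes "\<And>i. i \<le> k \<Longrightarrow> f i 0 = 0"
  shows "det_of (Suc k) f = 0"
  unfolding det_of_laplace using assms by (intro sum.neutral) auto

text \<open>At the projected point the first column is divided by \<open>s\<close> and the others
  lose multiples of it, so the determinant changes by \<open>1 / s\<close>; the monomial is divided
  by \<open>s ^ (r - 1)\<close>. For \<open>r > 0\<close> the factor \<open>s ^ r\<close> cancels
  both.\<close>

lemma minus_ext_generator:
  fixes T F :: "'a::euclidean_space list"
  assumes T: "\<not> affine_dependent (set T)" and F: "set F \<subseteq> set T" and r: "r > 0"
    and a: "a \<in> labels (set F) (r - 1)" and s: "length s = Suc k" "set s \<subseteq> set F"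
  shows "minus_ext T (set F) k r (gen_minus F (set F) a s) =
    (gen_minus T (set F) a s :: ('a, 'f::real_normed_field) form)"
proof (intro ext)
  fix x vs
  show "minus_ext T (set F) k r (gen_minus F (set F) a s) x vs = (gen_minus T (set F) a s x vs :: 'f)"
  proof (cases "in_dom T k x vs")
    case False
    then show ?thesis by (simp add: minus_ext_def gen_minus_def s)
  next
    case True
    define c where "c y = hcoord (set T) y (x, 1)" for y
    define d where "d w y = hcoord (set T) y (w, 0)" for w y
    define S where "S = sum c (set F)"
    define D where "D w = sum (d w) (set F)" for w
    let ?f = "\<lambda>i j. hcoord (set T) (s ! i) (if j = 0 then (x, 1) else (vs ! (j - 1), 0))"
    have x: "x \<in> body T" using True by (simp add: in_dom_def)
    have c_pos: "c y \<ge> 0" if "y \<in> set F" for y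
      using x F that T by (auto simp: c_def body_iff_hcoord)
    have s_in: "s ! i \<in> set F" if "i < Suc k" for i using s that by (metis nth_mem subsetD)
    show ?thesis
    proof (cases "S = 0")
      \<comment> \<open>On the face opposite to \<open>F\<close> there is no projection, and
        \<open>minus_ext\<close> is \<open>0\<close> by definition. The generator on
        \<open>T\<close> vanishes there even if its monomial is constant: the nonnegative
        \<open>c y\<close> sum to zero, so the column of the point is zero.\<close>
      case zero: True
      then have "c y = 0" if "y \<in> set F" for y
        using that c_pos sum_nonneg_eq_0_iff[of "set F" c] by (simp add: S_def)
      then have "det_of (Suc k) ?f = 0"
        using s_in by (intro det_of_zero_first_column) (simp add: c_def)
      then show ?thesis using True zero by (simp add: minus_ext_def gen_minus_def s S_def c_def Let_def)
    next
      case False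
      then have S: "S > 0" using sum_nonneg[of "set F" c] c_pos by (simp add: S_def less_eq_real_def)
      have F': "\<not> affine_dependent (set F)" using T F affine_dependent_subset by blast
      define q where "q = (\<Sum>y\<in>set F. (c y / S) *\<^sub>R y)"
      \<comment> \<open>This is \<open>S\<close> times the derivative of the projection:
        \<open>c y / S\<close> has derivative \<open>(d w y - D w / S * c y) / S\<close> in
        direction \<open>w\<close>. The coordinates sum to zero, hence \<open>P w\<close> is tangent
        to \<open>F\<close>.\<close>
      define P where "P w = (\<Sum>y\<in>set F. (d w y - D w / S * c y) *\<^sub>R y)" for w
      have sum_c: "(\<Sum>y\<in>set F. c y / S) = 1"
        using S unfolding sum_divide_distrib[symmetric] S_def[symmetric] by simp
      have q: "(q, 1) = (\<Sum>y\<in>set F. (c y / S) *\<^sub>R (y, 1::real))"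
        using sum_c by (simp add: q_def prod_eq_iff fst_sum snd_sum)
      have "(\<Sum>y\<in>set F. d w y - D w / S * c y) = 0" for w
        using S unfolding sum_subtractf sum_distrib_left[symmetric] D_def[symmetric] S_def[symmetric] by simp
      then have P: "(P w, 0) = (\<Sum>y\<in>set F. (d w y - D w / S * c y) *\<^sub>R (y, 1::real))" for w
        by (simp add: P_def prod_eq_iff fst_sum snd_sum)
      have hq: "hcoord (set F) u (q, 1) = c u / S" if "u \<in> set F" for u
        unfolding q using hcoord_combination[OF F' that] .
      have hP: "hcoord (set F) u (P w, 0) = d w u - D w / S * c u" if "u \<in> set F" for u w
        unfolding P using hcoord_combination[OF F' that] .
      have "q \<in> body F"
        using hspan_combination[of "set F" "\<lambda>y. c y / S"] c_pos S hq F' unfolding q[symmetric]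
        by (simp add: body_iff_hcoord)
      moreover have "P w \<in> tangent F" for w
        using hspan_combination[of "set F" "\<lambda>y. d w y - D w / S * c y"] unfolding P[symmetric]
        by (simp add: tangent_hspan)
      ultimately have dom: "in_dom F k q (map P vs)" using True by (auto simp: in_dom_def)
      have mono: "monom_on F (set F) a q = monom_on T (set F) a x / S ^ (r - 1)"
      proof -
        have "monom_on F (set F) a q = (\<Prod>v\<in>set F. c v ^ a v / S ^ a v)"
          unfolding monom_on_def by (intro prod.cong refl) (simp add: hq power_divide)
        also have "\<dots> = monom_on T (set F) a x / S ^ sum a (set F)"
          by (simp add: prod_dividef monom_on_def c_def power_sum)
        finally show ?thesis using a by (simp add: labels_def)
      qed
      have "det_of (Suc k) (\<lambda>i j. hcoord (set F) (s ! i) (if j = 0 then (q, 1) else (map P vs ! (j - 1), 0))) =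
        det_of (Suc k) (\<lambda>i j. if j = 0 then 1 / S * ?f i 0 else ?f i j - D (vs ! (j - 1)) / S * ?f i 0)"
        using True by (intro det_of_cong) (auto simp: hq hP s_in in_dom_def c_def d_def)
      also have "\<dots> = 1 / S * det_of (Suc k) ?f" by (rule det_of_column_operations)
      finally have det: "det_of (Suc k) (\<lambda>i j. hcoord (set F) (s ! i) (if j = 0 then (q, 1) else (map P vs ! (j - 1), 0))) =
        1 / S * det_of (Suc k) ?f" .
      have "minus_ext T (set F) k r (gen_minus F (set F) a s) x vs =
          of_real (S ^ r) * (gen_minus F (set F) a s q (map P vs) :: 'f)"
        using True S by (simp add: minus_ext_def Let_def S_def D_def c_def d_def q_def P_def[abs_def])
      also have "\<dots> = of_real (S ^ r * (monom_on T (set F) a x / S ^ (r - 1) * (1 / S * det_of (Suc k) ?f)))"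
        using dom by (simp add: gen_minus_def s mono det)
      also have "S ^ r * (monom_on T (set F) a x / S ^ (r - 1) * (1 / S * det_of (Suc k) ?f)) =
          monom_on T (set F) a x * det_of (Suc k) ?f"
        using S r by (cases r) (simp_all add: field_simps)
      finally show ?thesis using True by (simp add: gen_minus_def s)
    qed
  qed
qed

text \<open>Vertices are forced into the generators one at a time: the induction is on the set
  \<open>I\<close> of those already forced, and each step uses the trace on a single facet.\<close>

lemma Pminus0_eq_span:
  fixes F :: "'a::euclidean_space list"
  assumes F: "\<not> affine_dependent (set F)" "distinct F" "F \<noteq> []" and r: "r > 0"
  shows "Pminus0 r k F =
    form.span (minus_gens F (r - 1) (Suc k) (\<lambda>U. U = set F) :: ('a, 'f::real_normed_field) form set)"
proof (rule antisym)
  have "minus_gens F (r - 1) (Suc k) (\<lambda>U. U = set F) \<subseteq> (minus_gens F (r - 1) (Suc k) (\<lambda>_. True) :: ('a, 'f) form set)"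
    by (auto simp: minus_gens_def)
  then show "form.span (minus_gens F (r - 1) (Suc k) (\<lambda>U. U = set F) :: ('a, 'f) form set) \<subseteq> Pminus0 r k F"
    unfolding Pminus0_def Pminus_eq_span[OF F r]
    by (intro Int_greatest form.span_mono form.span_minimal gens_vanishing(2) F
        subspace_vanishing_traces)
  show "Pminus0 r k F \<subseteq> form.span (minus_gens F (r - 1) (Suc k) (\<lambda>U. U = set F) :: ('a, 'f) form set)"
  proof
    fix \<omega> :: "('a, 'f) form" assume "\<omega> \<in> Pminus0 r k F"
    then have \<omega>: "\<omega> \<in> form.span (minus_gens F (r - 1) (Suc k) (\<lambda>_. True))" "\<omega> \<in> vanishing_traces k F"
      by (auto simp: Pminus0_def Pminus_eq_span[OF F r])
    have "\<omega> \<in> form.span (minus_gens F (r - 1) (Suc k) (\<lambda>U. I \<subseteq> U))" if "finite I" "I \<subseteq> set F" for I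
      using that
    proof (induction I rule: finite_induct)
      case empty
      then show ?case using \<omega>(1) by simp
    next
      case (insert v I)
      let ?A = "minus_gens F (r - 1) (Suc k) (\<lambda>U. I \<subseteq> U) :: ('a, 'f) form set"
      let ?B = "minus_gens F (r - 1) (Suc k) (\<lambda>U. insert v I \<subseteq> U) :: ('a, 'f) form set"
      define G where "G = filter (\<lambda>u. u \<noteq> v) F"
      have setG: "set G = set F - {v}" by (auto simp: G_def)
      have v: "v \<in> set F" using insert.prems by simp
      show ?case
      proof (cases "G = []")
        case True
        then have "set F = {v}" using setG v by auto
        \<comment> \<open>There is no facet to take a trace on, but \<open>s\<close> has
          \<open>k + 1\<close> entries, so at least one, and all of them equal
          \<open>v\<close>.\<close>
        then have "v \<in> set s" if "length s = Suc k" "set s \<subseteq> set F" for s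
          using that by (cases s) auto
        then have "?A \<subseteq> ?B" by (fastforce simp: minus_gens_def)
        then show ?thesis using insert form.span_mono by blast
      next
        case False
        have sub: "subsimplex G F"
          using subsimplex_filter[of "- {v}" F] False by (auto simp: G_def filter_empty_conv)
        have "G \<noteq> F" using setG v by auto
        define E where "E \<eta> = minus_ext F (set G) k r (pullback G k (\<lambda>x. x) \<eta>)" for \<eta> :: "('a, 'f) form"
        have lin: "form_linear E"
          unfolding E_def by (rule form_linear_compose[OF form_linear_minus_ext form_linear_pullback])
        have "E \<omega> = 0"
          using \<omega>(2) sub \<open>G \<noteq> F\<close> form_linear_zero[OF form_linear_minus_ext]
          unfolding E_def vanishing_traces_def by auto
        \<comment> \<open>Nothing changes for \<open>\<omega>\<close> itself, but the map from
          \<open>\<eta>\<close> to \<open>\<eta> - E \<eta>\<close> sends each generator to itself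
          or to \<open>0\<close>, and only those that involve \<open>v\<close> remain.\<close>
        then have "\<omega> = \<omega> - E \<omega>" by simp
        also have "\<dots> \<in> form.span ?B"
        proof (rule form_linear_image_span[where B = ?A and E = "\<lambda>\<eta>. \<eta> - E \<eta>"])
          show "form_linear (\<lambda>\<eta>. \<eta> - E \<eta>)"
            by (rule form_linear_diff[OF _ lin]) (simp add: form_linear_on_def)
          show "\<omega> \<in> form.span ?A" using insert by blast
          fix \<eta> assume "\<eta> \<in> ?A"
          then obtain a s where \<eta>: "\<eta> = gen_minus F (set F) a s" "a \<in> labels (set F) (r - 1)"
            "length s = Suc k" "set s \<subseteq> set F" "I \<subseteq> {v. a v > 0} \<union> set s"
            by (auto simp: minus_gens_def)
          show "\<eta> - E \<eta> \<in> form.span ?B"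
          proof (cases "a v > 0 \<or> v \<in> set s")
            case True
            then have "pullback G k (\<lambda>x. x) \<eta> = 0"
              using pullback_face_zero(2)[of F G v a s] F(1) v True setG \<eta>(1,3) by auto
            then have "E \<eta> = 0" unfolding E_def by (simp only: form_linear_zero[OF form_linear_minus_ext])
            moreover have "\<eta> \<in> ?B" using \<eta> True by (auto simp: minus_gens_def)
            ultimately show ?thesis by (simp add: form.span_base)
          next
            case False
            have sG: "set s \<subseteq> set G" using False \<eta>(4) setG by auto
            have "monom_on F (set F) a = monom_on F (set G) a"
              using False setG by (intro ext monom_on_superset) auto
            then have \<eta>': "\<eta> = gen_minus F (set G) a s" by (simp only: \<eta>(1) gen_minus_def)
            have "pullback G k (\<lambda>x. x) \<eta> = gen_minus G (set G) a s"
              using pullback_face_gen(2)[OF F(1) _ order_refl sG, of a] setG \<eta>(3) by (simp add: \<eta>')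
            moreover have "a \<in> labels (set G) (r - 1)"
              using \<eta>(2) False setG labels_superset_iff[of "set F" "set G"] by (auto simp: labels_def)
            ultimately have "E \<eta> = \<eta>"
              unfolding E_def \<eta>' using minus_ext_generator[OF F(1) _ r _ \<eta>(3) sG] setG by auto
            then show ?thesis by (simp add: form.span_zero)
          qed
        qed
        finally show ?thesis .
      qed
    qed
    from this[of "set F"] have "\<omega> \<in> form.span (minus_gens F (r - 1) (Suc k) (\<lambda>U. set F \<subseteq> U))" by simp
    \<comment> \<open>Inclusion becomes equality because labels vanish off
      \<open>set F\<close>.\<close>
    moreover have "minus_gens F (r - 1) (Suc k) (\<lambda>U. set F \<subseteq> U) \<subseteq>
        (minus_gens F (r - 1) (Suc k) (\<lambda>U. U = set F) :: ('a, 'f) form set)"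
      by (force simp: minus_gens_def labels_def)
    ultimately show "\<omega> \<in> form.span (minus_gens F (r - 1) (Suc k) (\<lambda>U. U = set F))"
      using form.span_mono by blast
  qed
qed

lemma ext_minus_eq:
  fixes T F :: "'a::euclidean_space list"
  assumes T: "\<not> affine_dependent (set T)" "distinct T" "T \<noteq> []"
    and F: "set F \<subseteq> set T" "distinct F" "F \<noteq> []" and r: "r > 0"
  shows "ext_minus k r F T = (restrict (minus_ext T (set F) k r) (Pminus0 r k F) ::
    ('a, 'f::real_normed_field) form \<Rightarrow> ('a, 'f) form)"
  unfolding ext_minus_def
proof (rule extension_operator_unique)
  have F': "\<not> affine_dependent (set F)" using T(1) F(1) affine_dependent_subset by blast
  show "Pminus0 r k F = form.span {fun_mult (bary_monom F \<alpha>) (whitney F \<rho>) :: ('a, 'f) form | \<alpha> \<rho>.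
      \<alpha> \<in> multiindices (r - 1) (sdim F) \<and> \<rho> \<in> increasing (k + 1) (sdim F) \<and> supp \<alpha> \<union> set \<rho> = {0..sdim F}}"
    unfolding Pminus0_eq_span[OF F' F(2,3) r] span_minus_gens[OF F' F(2,3), symmetric]
    by (intro arg_cong[where f = form.span] Collect_cong ex_cong1)
      (simp add: nth_image_full_iff[OF F' F(2,3)] cong: conj_cong)
  show "form_linear (minus_ext T (set F) k r)" by (rule form_linear_minus_ext)
  show "minus_ext T (set F) k r \<omega> \<in> Pminus r k T" if "\<omega> \<in> Pminus0 r k F" for \<omega> :: "('a, 'f) form"
    using that unfolding Pminus0_eq_span[OF F' F(2,3) r] Pminus_eq_span[OF T r]
  proof (rule form_linear_image_span[OF form_linear_minus_ext, rotated])
    fix \<omega> :: "('a, 'f) form" assume "\<omega> \<in> minus_gens F (r - 1) (Suc k) (\<lambda>U. U = set F)"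
    then obtain a s where \<omega>: "\<omega> = gen_minus F (set F) a s" "a \<in> labels (set F) (r - 1)"
      "length s = Suc k" "set s \<subseteq> set F" by (auto simp: minus_gens_def)
    have "monom_on T (set F) a = monom_on T (set T) a"
      using F(1) \<omega>(2) by (intro ext monom_on_superset[symmetric]) (auto simp: labels_def)
    then have "gen_minus T (set F) a s = (gen_minus T (set T) a s :: ('a, 'f) form)"
      by (simp only: gen_minus_def)
    then have "minus_ext T (set F) k r \<omega> = gen_minus T (set T) a s"
      unfolding \<omega>(1) minus_ext_generator[OF T(1) F(1) r \<omega>(2-4)] .
    moreover have "a \<in> labels (set T) (r - 1)"
      using \<omega>(2) labels_superset_iff[OF finite_set F(1)] by blast
    ultimately show "minus_ext T (set F) k r \<omega> \<in> form.span (minus_gens T (r - 1) (Suc k) (\<lambda>_. True))"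
      using \<omega>(3,4) F(1) by (intro form.span_base) (auto simp: minus_gens_def)
  qed
  fix \<alpha> \<rho> assume *: "\<alpha> \<in> multiindices (r - 1) (sdim F)" "\<rho> \<in> increasing (k + 1) (sdim F)"
  note b = increasing_bound[OF F(3) *(2)]
  have \<rho>: "length \<rho> = Suc k" "\<rho> \<noteq> []" using *(2) by (auto simp: increasing_def)
  show "minus_ext T (set F) k r (fun_mult (bary_monom F \<alpha>) (whitney F \<rho>)) =
      (fun_mult (bary_monom T (multi_push F T \<alpha>)) (whitney T (map (vidx F T) \<rho>)) :: ('a, 'f) form)"
  proof -
    let ?a = "vlabel F \<alpha>" and ?s = "map ((!) F) \<rho>"
    have "fun_mult (bary_monom F \<alpha>) (whitney F \<rho>) = (gen_minus F (set F) ?a ?s :: ('a, 'f) form)"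
      using b \<rho>(2) by (intro minus_generator F' F)
    moreover have "fun_mult (bary_monom T (multi_push F T \<alpha>)) (whitney T (map (vidx F T) \<rho>)) =
        (gen_minus T (set F) ?a ?s :: ('a, 'f) form)"
      using b \<rho>(2) by (intro ext_minus_generator T F)
    moreover have "minus_ext T (set F) k r (gen_minus F (set F) ?a ?s) =
        (gen_minus T (set F) ?a ?s :: ('a, 'f) form)"
      using b \<rho>(1) by (intro minus_ext_generator T F r vlabel_in_labels *) auto
    ultimately show ?thesis by (simp only:)
  qed
qed

section \<open>The extension operators for \<open>P\<close>\<close>

text \<open>A polynomial with infinitely many roots is zero. Exponents \<open>e a\<close> may
  coincide, so only sums of coefficients over a common exponent are known to vanish.\<close>

lemma polynomial_zero_on_positives:
  fixes c :: "'i \<Rightarrow> 'f::real_normed_field"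
  assumes A: "finite A" and zero: "\<And>t::real. t > 0 \<Longrightarrow> (\<Sum>a\<in>A. c a * of_real t ^ e a) = 0"
  shows "(\<Sum>a | a \<in> A \<and> e a = d. c a) = 0"
proof -
  define p where "p = (\<Sum>a\<in>A. Polynomial.monom (c a) (e a))"
  have "poly p (of_real t) = 0" if "t > 0" for t
    using zero[OF that] by (simp add: p_def poly_sum poly_monom)
  then have "of_real ` {0<..} \<subseteq> {x. poly p x = 0}" by auto
  moreover have "infinite (of_real ` {0::real<..} :: 'f set)"
    by (subst finite_image_iff) (auto simp: inj_on_def infinite_Ioi)
  ultimately have "p = 0" using poly_roots_finite finite_subset by blast
  then have "0 = coeff p d" by simp
  also have "\<dots> = (\<Sum>a\<in>A. if e a = d then c a else 0)" by (simp add: p_def coeff_sum)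
  also have "\<dots> = (\<Sum>a | a \<in> A \<and> e a = d. c a)"
    using A by (simp add: sum.If_cases Int_def)
  finally show ?thesis by simp
qed

text \<open>Induction on the variables: with the others fixed, the sum is a polynomial in the
  variable \<open>h\<close>, and the terms whose exponent at \<open>h\<close> is that of
  \<open>a\<close> form a relation in fewer variables.\<close>

lemma monomials_independent:
  fixes C :: "('v \<Rightarrow> nat) \<Rightarrow> 'f::real_normed_field"
  assumes "finite H" "finite A" "inj_on (\<lambda>a. restrict a H) A"
    and "\<And>p::'v \<Rightarrow> real. (\<And>v. v \<in> H \<Longrightarrow> p v > 0) \<Longrightarrow> (\<Sum>a\<in>A. C a * of_real (\<Prod>v\<in>H. p v ^ a v)) = 0"
    and "a \<in> A"
  shows "C a = 0"
  using assms
proof (induction H arbitrary: A rule: finite_induct)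
  case empty
  then have "b = a" if "b \<in> A" for b using that by (auto simp: inj_on_def restrict_def)
  then have "A = {a}" using empty by blast
  then show ?case using empty.prems(3)[of undefined] by simp
next
  case (insert h H)
  \<comment> \<open>All members agree at \<open>h\<close>, so distinct exponents stay distinct after
    \<open>h\<close> is dropped.\<close>
  let ?A = "{b. b \<in> A \<and> b h = a h}"
  show ?case
  proof (rule insert.IH[of ?A])
    show "finite ?A" "a \<in> ?A" using insert.prems by auto
    show "inj_on (\<lambda>a. restrict a H) ?A"
    proof (rule inj_onI)
      fix b b' assume b: "b \<in> ?A" "b' \<in> ?A" "restrict b H = restrict b' H"
      then have "restrict b (insert h H) = restrict b' (insert h H)"
      proof -
        have "b v = b' v" if "v \<in> H" for v using fun_cong[OF b(3), of v] that by simp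
        then show ?thesis using b by (auto simp: restrict_def)
      qed
      then show "b = b'" by (rule inj_onD[OF insert.prems(2)]) (use b in auto)
    qed
    fix p :: "'v \<Rightarrow> real" assume p: "\<And>v. v \<in> H \<Longrightarrow> p v > 0"
    have "(\<Sum>b\<in>A. C b * of_real (\<Prod>v\<in>H. p v ^ b v) * of_real t ^ b h) = 0" if "t > 0" for t
    proof -
      have "(\<Prod>v\<in>H. (p(h := t)) v ^ b v) = (\<Prod>v\<in>H. p v ^ b v)" for b
        using insert.hyps(2) by (intro prod.cong) auto
      moreover have "(p(h := t)) v > 0" if "v \<in> insert h H" for v
        using p \<open>t > 0\<close> that by (cases "v = h") auto
      then have "(\<Sum>b\<in>A. C b * of_real (\<Prod>v\<in>insert h H. (p(h := t)) v ^ b v)) = 0"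
        by (rule insert.prems(3))
      ultimately show ?thesis
        using insert.hyps by (simp add: mult_ac del: of_real_prod)
    qed
    then show "(\<Sum>b\<in>?A. C b * of_real (\<Prod>v\<in>H. p v ^ b v)) = 0"
      by (rule polynomial_zero_on_positives[OF insert.prems(1)])
  qed
qed

text \<open>Barycentric coordinates are not free variables, since they sum to \<open>1\<close>.
  Homogeneity repairs this: arbitrary positive values are divided by their sum \<open>s\<close>,
  which changes every monomial by the same factor \<open>s ^ r\<close>.\<close>

lemma bernstein_independent:
  fixes C :: "('a::euclidean_space \<Rightarrow> nat) \<Rightarrow> 'f::real_normed_field"
  assumes G: "\<not> affine_dependent (set G)" "G \<noteq> []"
    and zero: "\<And>x. x \<in> body G \<Longrightarrow> (\<Sum>a\<in>labels (set G) r. C a * of_real (monom_on G (set G) a x)) = 0"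
    and a: "a \<in> labels (set G) r"
  shows "C a = 0"
proof (rule monomials_independent[OF finite_set[of G] finite_labels[OF finite_set[of G], of r] _ _ a])
  show "inj_on (\<lambda>a. restrict a (set G)) (labels (set G) r)"
  proof (rule inj_onI, rule ext)
    fix b b' v assume b: "b \<in> labels (set G) r" "b' \<in> labels (set G) r"
      "restrict b (set G) = restrict b' (set G)"
    then show "b v = b' v"
      by (cases "v \<in> set G") (auto simp: labels_def restrict_def fun_eq_iff split: if_splits)
  qed
  fix p :: "'a \<Rightarrow> real" assume p: "\<And>v. v \<in> set G \<Longrightarrow> p v > 0"
  define s where "s = sum p (set G)"
  have s: "s > 0" unfolding s_def using G(2) p by (intro sum_pos) auto
  define x where "x = (\<Sum>v\<in>set G. (p v / s) *\<^sub>R v)"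
  have "(\<Sum>v\<in>set G. p v / s) = 1" using s by (simp add: s_def flip: sum_divide_distrib)
  then have x: "(x, 1) = (\<Sum>v\<in>set G. (p v / s) *\<^sub>R (v, 1::real))"
    by (simp add: x_def prod_eq_iff fst_sum snd_sum)
  have hx: "hcoord (set G) v (x, 1) = p v / s" if "v \<in> set G" for v
    unfolding x by (rule hcoord_combination[OF G(1) that])
  have "x \<in> body G"
    using hspan_combination[of "set G" "\<lambda>v. p v / s"] p s unfolding x[symmetric]
    by (simp add: body_iff_hcoord[OF G(1)] hx less_imp_le)
  have mono: "(\<Prod>v\<in>set G. p v ^ b v) = s ^ r * monom_on G (set G) b x" if "b \<in> labels (set G) r" for b
  proof -
    have "monom_on G (set G) b x = (\<Prod>v\<in>set G. p v ^ b v / s ^ b v)"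
      unfolding monom_on_def by (intro prod.cong refl) (simp add: hx power_divide)
    also have "\<dots> = (\<Prod>v\<in>set G. p v ^ b v) / s ^ r"
      using that by (simp add: prod_dividef labels_def flip: power_sum)
    finally show ?thesis using s by simp
  qed
  have "(\<Sum>b\<in>labels (set G) r. C b * of_real (\<Prod>v\<in>set G. p v ^ b v)) =
      (\<Sum>b\<in>labels (set G) r. of_real (s ^ r) * (C b * of_real (monom_on G (set G) b x)))"
    by (intro sum.cong refl) (simp add: mono mult_ac)
  also have "\<dots> = 0"
    using zero[OF \<open>x \<in> body G\<close>] by (simp flip: sum_distrib_left)
  finally show "(\<Sum>b\<in>labels (set G) r. C b * of_real (\<Prod>v\<in>set G. p v ^ b v)) = 0" .
qed

text \<open>The substitution of vectors depends on the exponent \<open>a\<close>, so a relation on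
  \<open>F\<close> cannot be pulled back as a whole. It is split into one relation for each
  \<open>a\<close>, valid for all tangent vectors, and each is evaluated at its own vectors.\<close>

lemma full_ext_exists:
  fixes T F :: "'a::euclidean_space list"
  assumes T: "\<not> affine_dependent (set T)" and F: "set F \<subseteq> set T" "F \<noteq> []" and r: "r > 0"
  shows "\<exists>E :: ('a, 'f::real_normed_field) form \<Rightarrow> ('a, 'f) form. form_linear E \<and>
    (\<forall>a s. a \<in> labels (set F) r \<longrightarrow> length s = k \<longrightarrow> set s \<subseteq> set F \<longrightarrow>
      E (gen_full F (set F) a s) = gen_full T (set F) a s)"
proof -
  let ?L = "{s. set s \<subseteq> set F \<and> length s = k}"
  let ?I = "labels (set F) r \<times> ?L"
  have F': "\<not> affine_dependent (set F)" using T F(1) affine_dependent_subset by blast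
  have finL: "finite ?L" by (simp add: finite_lists_length_eq)
  have finI: "finite ?I" using finL finite_labels[OF finite_set] by blast
  have "\<exists>E :: ('a, 'f) form \<Rightarrow> ('a, 'f) form. form_linear E \<and>
      (\<forall>i\<in>?I. E (gen_full F (set F) (fst i) (snd i)) = gen_full T (set F) (fst i) (snd i))"
  proof (rule form_linear_from_relations[OF finI])
    fix c :: "('a \<Rightarrow> nat) \<times> 'a list \<Rightarrow> 'f"
    assume rel: "(\<Sum>i\<in>?I. form_scale (c i) (gen_full F (set F) (fst i) (snd i))) = 0"
    \<comment> \<open>The vectors are held fixed while the point varies, so the coefficients of the
      monomials are scalars.\<close>
    have B0: "(\<Sum>s\<in>?L. c (a, s) * of_real (det_of k (\<lambda>i j. hcoord (set F) (s ! i) (ws ! j, 0)))) = 0"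
      if ws: "length ws = k" "set ws \<subseteq> tangent F" and a: "a \<in> labels (set F) r" for a ws
    proof (rule bernstein_independent[OF F' F(2) _ a])
      fix x assume "x \<in> body F"
      then have dom: "in_dom F k x ws" using ws by (simp add: in_dom_def)
      have "0 = (\<Sum>i\<in>?I. form_scale (c i) (gen_full F (set F) (fst i) (snd i)) x ws)"
        using arg_cong[OF rel, of "\<lambda>\<omega>. \<omega> x ws"] by (simp add: sum_form_apply)
      also have "\<dots> = (\<Sum>(a, s)\<in>?I. (c (a, s) * of_real (det_of k (\<lambda>i j. hcoord (set F) (s ! i) (ws ! j, 0)))) *
          of_real (monom_on F (set F) a x))"
        using dom by (intro sum.cong refl) (auto simp: form_scale_def gen_full_self[OF F'] mult_ac)
      finally show "(\<Sum>a\<in>labels (set F) r. (\<Sum>s\<in>?L. c (a, s) * of_real (det_of k (\<lambda>i j. hcoord (set F) (s ! i) (ws ! j, 0)))) *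
          of_real (monom_on F (set F) a x)) = 0"
        by (simp add: sum.cartesian_product sum_distrib_right)
    qed
    show "(\<Sum>i\<in>?I. form_scale (c i) (gen_full T (set F) (fst i) (snd i))) = 0"
    proof (intro ext)
      fix x vs
      have "(\<Sum>(a, s)\<in>?I. c (a, s) * gen_full T (set F) a s x vs) = 0"
      proof (cases "in_dom T k x vs")
        case False
        then show ?thesis by (intro sum.neutral) (auto simp: gen_full_def)
      next
        case True
        \<comment> \<open>The vector whose coordinates in \<open>F\<close> are the
          \<open>\<Psi>\<close>. The quotients \<open>a y / r\<close> sum to \<open>1\<close> over
          \<open>F\<close>, so the correction term makes the coordinates sum to zero and the vector
          tangent to \<open>F\<close>.\<close>
        define P where "P a w = (\<Sum>y\<in>set F. psi T (set F) a y w *\<^sub>R y)" for a w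
        have P: "(P a w, 0) = (\<Sum>y\<in>set F. psi T (set F) a y w *\<^sub>R (y, 1::real))"
          if "a \<in> labels (set F) r" for a w
        proof -
          have "real (sum a (set F)) \<noteq> 0" using that r by (simp add: labels_def)
          then have "(\<Sum>y\<in>set F. psi T (set F) a y w) = 0"
            by (simp add: psi_def sum_subtractf flip: sum_distrib_right sum_divide_distrib of_nat_sum)
          then show ?thesis by (simp add: P_def prod_eq_iff fst_sum snd_sum)
        qed
        have hP: "hcoord (set F) u (P a w, 0) = psi T (set F) a u w"
          if "a \<in> labels (set F) r" "u \<in> set F" for a u w
          unfolding P[OF that(1)] by (rule hcoord_combination[OF F' that(2)])
        have tP: "P a w \<in> tangent F" if "a \<in> labels (set F) r" for a w
          using hspan_combination[of "set F" "\<lambda>y. psi T (set F) a y w"]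
          unfolding P[OF that, symmetric] by (simp add: tangent_hspan)
        have "(\<Sum>(a, s)\<in>?I. c (a, s) * gen_full T (set F) a s x vs) =
          (\<Sum>(a, s)\<in>?I. of_real (monom_on T (set F) a x) *
            (c (a, s) * of_real (det_of k (\<lambda>i j. hcoord (set F) (s ! i) (map (P a) vs ! j, 0)))))"
        proof (intro sum.cong refl)
          fix i assume i: "i \<in> ?I"
          obtain a s where as: "i = (a, s)" by (cases i)
          have "det_of k (\<lambda>i j. hcoord (set F) (s ! i) (map (P a) vs ! j, 0)) =
              det_of k (\<lambda>i j. psi T (set F) a (s ! i) (vs ! j))"
            using i True as by (intro det_of_cong) (auto simp: hP in_dom_def subset_iff)
          then show "(case i of (a, s) \<Rightarrow> c (a, s) * gen_full T (set F) a s x vs) =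
              (case i of (a, s) \<Rightarrow> of_real (monom_on T (set F) a x) *
            (c (a, s) * of_real (det_of k (\<lambda>i j. hcoord (set F) (s ! i) (map (P a) vs ! j, 0)))))"
            using i True as by (auto simp: gen_full_def)
        qed
        also have "\<dots> = (\<Sum>a\<in>labels (set F) r. of_real (monom_on T (set F) a x) *
            (\<Sum>s\<in>?L. c (a, s) * of_real (det_of k (\<lambda>i j. hcoord (set F) (s ! i) (map (P a) vs ! j, 0)))))"
          by (simp add: sum.cartesian_product sum_distrib_left)
        also have "\<dots> = 0"
        proof (intro sum.neutral ballI)
          fix a assume a: "a \<in> labels (set F) r"
          have "length (map (P a) vs) = k" "set (map (P a) vs) \<subseteq> tangent F"
            using True tP[OF a] by (auto simp: in_dom_def)
          from B0[OF this a] show "of_real (monom_on T (set F) a x) *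
            (\<Sum>s\<in>?L. c (a, s) * of_real (det_of k (\<lambda>i j. hcoord (set F) (s ! i) (map (P a) vs ! j, 0)))) = 0"
            by simp
        qed
        finally show ?thesis .
      qed
      then show "(\<Sum>i\<in>?I. form_scale (c i) (gen_full T (set F) (fst i) (snd i))) x vs = 0 x vs"
        by (simp add: sum_form_apply form_scale_def case_prod_beta)
    qed
  qed
  then show ?thesis by (auto simp: Ball_def)
qed

text \<open>Used twice: with all vertices of \<open>T\<close> as \<open>X\<close>, to place an
  extended generator in the polynomial space, and with one vertex left out, to eliminate its
  differential.\<close>

lemma gen_full_expand:
  fixes T :: "'a::euclidean_space list"
  assumes T: "\<not> affine_dependent (set T)" and X: "finite X" and s: "length s = k"
    and mono: "\<And>x. monom_on T Y a x = monom_on T (set T) a x"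
    and C: "\<And>i w. i < k \<Longrightarrow> w \<in> tangent T \<Longrightarrow> psi T Y a (s ! i) w = (\<Sum>u\<in>X. C i u * hcoord (set T) u (w, 0))"
  shows "(gen_full T Y a s :: ('a, 'f::real_normed_field) form) \<in>
    form.span {gen_full T (set T) a s' | s'. length s' = k \<and> set s' \<subseteq> X}"
proof -
  let ?PiE = "{..<k} \<rightarrow>\<^sub>E X"
  have "gen_full T Y a s =
    (\<Sum>f\<in>?PiE. form_scale (of_real (\<Prod>i<k. C i (f i))) (gen_full T (set T) a (map f [0..<k]) :: ('a, 'f) form))"
  proof (intro ext)
    fix x vs
    have f: "det_of k (\<lambda>i j. hcoord (set T) (map f [0..<k] ! i) (vs ! j, 0)) = det_of k (\<lambda>i j. hcoord (set T) (f i) (vs ! j, 0))" for f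
      by (rule det_of_cong) simp
    show "gen_full T Y a s x vs =
      (\<Sum>f\<in>?PiE. form_scale (of_real (\<Prod>i<k. C i (f i))) (gen_full T (set T) a (map f [0..<k]) :: ('a, 'f) form)) x vs"
    proof (cases "in_dom T k x vs")
      case True
      have "det_of k (\<lambda>i j. psi T Y a (s ! i) (vs ! j)) = det_of k (\<lambda>i j. \<Sum>u\<in>X. C i u * hcoord (set T) u (vs ! j, 0))"
        using True by (intro det_of_cong C) (auto simp: in_dom_def subset_iff)
      also have "\<dots> = (\<Sum>f\<in>?PiE. (\<Prod>i<k. C i (f i)) * det_of k (\<lambda>i j. hcoord (set T) (f i) (vs ! j, 0)))"
        by (rule det_of_multilinear[OF X])
      finally show ?thesis
        using True unfolding sum_form_apply form_scale_def gen_full_self[OF T]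
        by (simp add: gen_full_def s mono f sum_distrib_left mult_ac del: of_real_prod)
    next
      case False
      then show ?thesis
        unfolding sum_form_apply form_scale_def gen_full_self[OF T] by (simp add: gen_full_def s)
    qed
  qed
  also have "\<dots> \<in> form.span {gen_full T (set T) a s' | s'. length s' = k \<and> set s' \<subseteq> X}"
  proof (rule form.span_sum, rule form.span_scale, rule form.span_base)
    fix f assume f: "f \<in> ?PiE"
    have "length (map f [0..<k]) = k" "set (map f [0..<k]) \<subseteq> X"
      using PiE_mem[OF f] by (simp_all add: image_subset_iff)
    then show "gen_full T (set T) a (map f [0..<k]) \<in> {gen_full T (set T) a s' | s'. length s' = k \<and> set s' \<subseteq> X}"
      by blast
  qed
  finally show ?thesis .
qed

text \<open>Coefficients are indexed by all of \<open>I\<close>, with zeros off \<open>J\<close>, so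
  that they can be summed over a full product of exponents and lists.\<close>

lemma sum_over_image_in_span:
  fixes g :: "'i \<Rightarrow> ('a, 'f::real_normed_field) form"
  assumes "finite I" "J \<subseteq> I" "\<omega> \<in> form.span (g ` J)"
  obtains c where "\<omega> = (\<Sum>i\<in>I. form_scale (c i) (g i))" "\<And>i. i \<notin> J \<Longrightarrow> c i = 0"
proof -
  have "\<exists>c. \<omega> = (\<Sum>i\<in>I. form_scale (c i) (g i)) \<and> (\<forall>i. i \<notin> J \<longrightarrow> c i = 0)"
    using assms(3)
  proof (induction rule: form.span_induct_alt)
    case base
    show ?case by (rule exI[of _ "\<lambda>_. 0"]) (simp del: zero_fun_apply)
  next
    case (step d x y)
    then obtain c j where c: "y = (\<Sum>i\<in>I. form_scale (c i) (g i))" "\<forall>i. i \<notin> J \<longrightarrow> c i = 0"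
      and j: "j \<in> J" "x = g j" by blast
    let ?c = "\<lambda>i. (if i = j then d else 0) + c i"
    have "(\<Sum>i\<in>I. form_scale (?c i) (g i)) = (\<Sum>i\<in>I. if i = j then form_scale d (g i) else 0) + y"
      unfolding c(1) form.scale_left_distrib sum.distrib
      by (intro arg_cong2[where f = "(+)"] sum.cong) auto
    also have "\<dots> = form_scale d x + y"
      using j assms(2) by (simp only: sum.delta[OF assms(1)] subsetD if_True)
    finally have "form_scale d x + y = (\<Sum>i\<in>I. form_scale (?c i) (g i))" by (rule sym)
    moreover have "\<forall>i. i \<notin> J \<longrightarrow> ?c i = 0" using c(2) j by auto
    ultimately show ?case by (intro exI[of _ ?c] conjI)
  qed
  then show ?thesis using that by blast
qed

section \<open>Forms in P with vanishing traces\<close>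

lemma finite_increasing: "finite (increasing k n)"
proof (rule finite_subset)
  show "increasing k n \<subseteq> {s. set s \<subseteq> {0..n} \<and> length s = k}" by (auto simp: increasing_def)
qed (simp add: finite_lists_length_eq)

text \<open>Distinct increasing lists of equal length have different ranges, so some entry of
  \<open>\<sigma>\<close> is missing from \<open>\<sigma>'\<close> and its row is zero. This duality
  isolates a single coefficient.\<close>

lemma det_of_increasing:
  assumes "\<sigma> \<in> increasing k n" "\<sigma>' \<in> increasing k n"
  shows "det_of k (\<lambda>i j. if \<sigma> ! i = \<sigma>' ! j then 1 else 0) = (if \<sigma> = \<sigma>' then 1 else 0)"
proof (cases "\<sigma> = \<sigma>'")
  case True
  have "distinct \<sigma>" "length \<sigma> = k" using assms(1) by (auto simp: increasing_def strict_sorted_iff)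
  then have "det_of k (\<lambda>i j. if \<sigma> ! i = \<sigma>' ! j then 1 else 0) = det_of k (\<lambda>i j. if i = j then 1 else 0)"
    using True by (intro det_of_cong) (auto simp: nth_eq_iff_index_eq)
  with True show ?thesis by (simp add: det_of_delta)
next
  case False
  have \<sigma>: "length \<sigma> = k" "sorted \<sigma>" "distinct \<sigma>" "length \<sigma>' = k" "sorted \<sigma>'" "distinct \<sigma>'"
    using assms by (auto simp: increasing_def strict_sorted_iff)
  have "\<not> set \<sigma> \<subseteq> set \<sigma>'"
  proof
    assume "set \<sigma> \<subseteq> set \<sigma>'"
    then have "set \<sigma> = set \<sigma>'"
      using \<sigma> by (intro card_subset_eq) (simp_all add: distinct_card)
    with False \<sigma> show False using sorted_distinct_set_unique by blast
  qed
  then obtain i where i: "i < k" "\<sigma> ! i \<notin> set \<sigma>'"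
    using \<sigma>(1) by (metis in_set_conv_nth subsetI)
  have "det_of k (\<lambda>i j. if \<sigma> ! i = \<sigma>' ! j then 1 else 0) = 0"
    using i \<sigma>(4) by (intro det_of_zero_row[OF i(1)]) (metis nth_mem)
  with False show ?thesis by simp
qed

lemma hcoord_diff_vertices:
  assumes "\<not> affine_dependent X" "y \<in> X" "z \<in> X"
  shows "hcoord X u (y - z, 0) = (if y = u then 1 else 0) - (if z = u then 1 else 0)"
proof -
  have "hcoord X u (y - z, 0) = hcoord X u ((y, 1) - (z, 1))" by simp
  also have "\<dots> = hcoord X u (y, 1) - hcoord X u (z, 1)"
    by (rule linear_diff[OF linear_hcoord[OF assms(1)]])
  finally show ?thesis by (simp add: hcoord_vertex assms eq_commute)
qed

context
  fixes F :: "'a::euclidean_space list" and r :: nat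
  assumes F: "\<not> affine_dependent (set F)" "distinct F" "F \<noteq> []" and r: "r > 0"
begin

lemma label_pivot:
  assumes "a \<in> labels (set F) r"
  obtains v where "a v > 0" "v \<in> set F"
proof -
  have "sum a (set F) \<noteq> 0" using assms r by (simp add: labels_def)
  then obtain v where "v \<in> set F" "a v \<noteq> 0" by (meson sum.neutral)
  then show ?thesis using that by blast
qed

text \<open>Since \<open>d\<lambda>\<^sub>0 + \<dots> + d\<lambda>\<^sub>m = 0\<close>, one of the \<open>d\<lambda>\<^sub>i\<close> can be eliminated for each \<open>\<alpha>\<close>; choosing \<open>i\<close> in the
  support of \<open>\<alpha>\<close> leaves a basis that is adapted to the traces.\<close>

lemma Pfull_basis_spans:
  assumes J: "\<And>a. a \<in> labels (set F) r \<Longrightarrow> j a \<in> set F"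
  shows "Pfull r k F \<subseteq> form.span ((\<lambda>(a, \<sigma>). gen_full F (set F) a (map ((!) F) \<sigma>) :: ('a, 'f::real_normed_field) form) `
    {(a, \<sigma>). a \<in> labels (set F) r \<and> \<sigma> \<in> increasing k (sdim F) \<and> j a \<notin> (!) F ` set \<sigma>})"
    (is "_ \<subseteq> form.span ?B")
proof -
  have *: "gen_full F (set F) a s \<in> form.span ?B"
    if a: "a \<in> labels (set F) r" and s: "length s = k" "set s \<subseteq> set F - {j a}" for a s
  proof (cases "distinct s")
    case True
    obtain \<sigma> p where \<sigma>: "\<sigma> \<in> increasing (length s) (sdim F)" "p permutes {..<length s}"
      "set (map ((!) F) \<sigma>) = set s" "\<And>i. i < length s \<Longrightarrow> s ! i = map ((!) F) \<sigma> ! p i"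
      using sort_to_increasing[OF F(2,3) True] s(2) by (metis Diff_subset subset_trans)
    have len: "length (map ((!) F) \<sigma>) = length s" using \<sigma>(1) by (simp add: increasing_def)
    have "gen_full F (set F) a (map ((!) F) \<sigma>) \<in> ?B"
      using a \<sigma>(1,3) s by (intro image_eqI[of _ _ "(a, \<sigma>)"]) auto
    moreover have "gen_full F (set F) a s =
        form_scale (of_int (sign p)) (gen_full F (set F) a (map ((!) F) \<sigma>) :: ('a, 'f) form)"
      by (rule gen_full_permuted[OF \<sigma>(2,4) len])
    ultimately show ?thesis by (simp only: form.span_scale form.span_base)
  next
    case False
    then show ?thesis by (simp only: gen_full_repeated form.span_zero not_False_eq_True)
  qed
  have "full_gens F r k (\<lambda>_. True) \<subseteq> form.span ?B"
  proof
    fix \<omega> :: "('a, 'f) form" assume "\<omega> \<in> full_gens F r k (\<lambda>_. True)"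
    then obtain a s where \<omega>: "\<omega> = gen_full F (set F) a s" and a: "a \<in> labels (set F) r"
      and s: "length s = k" "set s \<subseteq> set F" by (auto simp: full_gens_def)
    let ?X = "set F - {j a}"
    \<comment> \<open>The differential at \<open>j a\<close> becomes minus the sum of all the
      others, which are left alone.\<close>
    let ?C = "\<lambda>i u. if s ! i = j a then - 1 else if s ! i = u then 1 else (0::real)"
    have "\<omega> \<in> form.span {gen_full F (set F) a s' | s'. length s' = k \<and> set s' \<subseteq> ?X}"
      unfolding \<omega>
    proof (rule gen_full_expand[OF F(1) _ s(1), where C = ?C])
      fix i w assume i: "i < k" and w: "w \<in> tangent F"
      have si: "s ! i \<in> set F" using i s by (metis nth_mem subsetD)
      have "hcoord (set F) (s ! i) (w, 0) = (\<Sum>u\<in>?X. ?C i u * hcoord (set F) u (w, 0))"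
      proof (cases "s ! i = j a")
        case True
        then show ?thesis
          using sum_hcoord_tangent[OF F(1) w] sum.remove[OF finite_set J[OF a], of "\<lambda>u. hcoord (set F) u (w, 0)"]
          by (simp add: sum_negf)
      next
        case False
        then have "(\<Sum>u\<in>?X. ?C i u * hcoord (set F) u (w, 0)) =
            (\<Sum>u\<in>?X. if s ! i = u then hcoord (set F) u (w, 0) else 0)"
          by (intro sum.cong) auto
        also have "\<dots> = hcoord (set F) (s ! i) (w, 0)"
          using False si by (subst sum.delta') auto
        finally show ?thesis by simp
      qed
      then show "psi F (set F) a (s ! i) w = (\<Sum>u\<in>?X. ?C i u * hcoord (set F) u (w, 0))"
        using psi_self[OF F(1) w] by simp
    qed auto
    also have "\<dots> \<subseteq> form.span ?B"
      using * a by (intro form.span_minimal form.subspace_span) blast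
    finally show "\<omega> \<in> form.span ?B" .
  qed
  then show ?thesis
    unfolding Pfull_eq_span[OF F] by (intro form.span_minimal form.subspace_span)
qed

text \<open>The claim is that a coefficient vanishes if its exponent and list together miss a
  vertex. The vertices they do involve span a proper face: the trace there is zero, Bernstein
  independence isolates the exponent, and dual vectors isolate the list.\<close>

lemma Pfull0_eq_span:
  "Pfull0 r k F = form.span (full_gens F r k (\<lambda>U. U = set F) :: ('a, 'f::real_normed_field) form set)"
proof (rule antisym)
  have "full_gens F r k (\<lambda>U. U = set F) \<subseteq> (full_gens F r k (\<lambda>_. True) :: ('a, 'f) form set)"
    by (auto simp: full_gens_def)
  then show "form.span (full_gens F r k (\<lambda>U. U = set F) :: ('a, 'f) form set) \<subseteq> Pfull0 r k F"
    unfolding Pfull0_def Pfull_eq_span[OF F]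
    by (intro Int_greatest form.span_mono form.span_minimal gens_vanishing(1) F
        subspace_vanishing_traces)
  \<comment> \<open>The pivot lies in the support of \<open>a\<close>, hence in every face on which
    the monomial is not identically zero.\<close>
  define j where "j a = (SOME v. a v > 0 \<and> v \<in> set F)" for a :: "'a \<Rightarrow> nat"
  have j: "a (j a) > 0" "j a \<in> set F" if "a \<in> labels (set F) r" for a
    using someI_ex[of "\<lambda>v. a v > 0 \<and> v \<in> set F"] label_pivot[OF that] unfolding j_def by blast+
  show "Pfull0 r k F \<subseteq> form.span (full_gens F r k (\<lambda>U. U = set F) :: ('a, 'f) form set)"
  proof
    fix \<omega> :: "('a, 'f) form" assume \<omega>: "\<omega> \<in> Pfull0 r k F"
    let ?L = "labels (set F) r" and ?S = "increasing k (sdim F)"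
    let ?J = "{(a, \<sigma>). a \<in> ?L \<and> \<sigma> \<in> ?S \<and> j a \<notin> (!) F ` set \<sigma>}"
    let ?g = "\<lambda>(a, \<sigma>). gen_full F (set F) a (map ((!) F) \<sigma>) :: ('a, 'f) form"
    have fin: "finite (?L \<times> ?S)" using finite_labels[OF finite_set] finite_increasing by blast
    have "\<omega> \<in> form.span (?g ` ?J)"
      using \<omega> Pfull_basis_spans[of j, OF j(2)] by (auto simp: Pfull0_def)
    then obtain c where c: "\<omega> = (\<Sum>i\<in>?L \<times> ?S. form_scale (c i) (?g i))" "\<And>i. i \<notin> ?J \<Longrightarrow> c i = 0"
      by (rule sum_over_image_in_span[OF fin, rotated]) auto
    have c0: "c (a, \<sigma>') = 0" if a: "a \<in> ?L" and \<sigma>': "\<sigma>' \<in> ?S"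
      and not_full: "{v. a v > 0} \<union> (!) F ` set \<sigma>' \<noteq> set F" for a \<sigma>'
    proof (cases "j a \<in> (!) F ` set \<sigma>'")
      case True
      then show ?thesis by (intro c(2)) auto
    next
      case False
      let ?Y = "{v. a v > 0} \<union> (!) F ` set \<sigma>'"
      define G where "G = filter (\<lambda>v. v \<in> ?Y) F"
      note nth_bound = increasing_bound[OF F(3)]
      have YF: "?Y \<subseteq> set F"
        using a nth_bound[OF \<sigma>'] by (force simp: labels_def)
      then have setG: "set G = ?Y" by (auto simp: G_def)
      have "?Y \<inter> set F \<noteq> {}" using j[OF a] by auto
      then have sub: "subsimplex G F" unfolding G_def by (rule subsimplex_filter)
      have "G \<noteq> F" using setG not_full by auto
      have G: "set G \<subseteq> set F" "\<not> affine_dependent (set G)" "G \<noteq> []"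
      proof -
        show "set G \<subseteq> set F" using YF setG by simp
        then show "\<not> affine_dependent (set G)" using F(1) affine_dependent_subset by blast
        show "G \<noteq> []" using sub by (simp add: subsimplex_def)
      qed
      \<comment> \<open>Vectors dual to the differentials away from the pivot. Both ends of each lie
        in \<open>G\<close>, since the pivot is in the support of \<open>a\<close>, so the vectors
        are tangent to \<open>G\<close>.\<close>
      define ws where "ws = map (\<lambda>i. F ! i - j a) \<sigma>'"
      have \<sigma>'_len: "length \<sigma>' = k" using \<sigma>' by (simp add: increasing_def)
      have "F ! i - j a \<in> tangent G" if "i \<in> set \<sigma>'" for i
        unfolding tangent_def using that j[OF a] setG by (intro span_base) auto
      then have ws: "length ws = k" "set ws \<subseteq> tangent G" using \<sigma>'_len by (auto simp: ws_def)
      define B where "B b = (\<Sum>\<sigma>\<in>?S. c (b, \<sigma>) * of_real (det_of k (\<lambda>i l. hcoord (set F) (F ! (\<sigma> ! i)) (ws ! l, 0))))" for b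
      have "B a = 0"
      proof (rule bernstein_independent[OF G(2,3), where r = r])
        show "a \<in> labels (set G) r"
          using a setG labels_superset_iff[OF finite_set G(1)] by auto
        fix x assume x: "x \<in> body G"
        have D: "frechet_derivative (\<lambda>x. x) (at x within body G) w = w" if "w \<in> tangent G" for w
          using simplicial_map.vector_push(1)[OF simplicial_map_inclusion[OF F(1) G(1)] x that]
          by (metis prod.inject)
        have domG: "in_dom G k x ws" using x ws by (simp add: in_dom_def)
        have domF: "in_dom F k x ws"
          using domG body_subset[OF G(1)] tangent_subset[OF G(1)] by (auto simp: in_dom_def)
        have "map (frechet_derivative (\<lambda>x. x) (at x within body G)) ws = ws"
          using D ws(2) by (intro map_idI) auto
        moreover have "pullback G k (\<lambda>x. x) \<omega> = 0"
          using \<omega> sub \<open>G \<noteq> F\<close> by (auto simp: Pfull0_def vanishing_traces_def)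
        then have "pullback G k (\<lambda>x. x) \<omega> x ws = 0" by simp
        ultimately have "\<omega> x ws = 0" using domG by (simp add: pullback_def form_on_def in_dom_def)
        \<comment> \<open>On \<open>G\<close>, monomials with an exponent outside \<open>G\<close>
          vanish and the others are those of \<open>G\<close>, so the sum over labels of
          \<open>F\<close> reduces to one over labels of \<open>G\<close>.\<close>
        have mono: "monom_on F (set F) b x =
            (if b \<in> labels (set G) r then monom_on G (set G) b x else 0)" if b: "b \<in> ?L" for b
        proof (cases "b \<in> labels (set G) r")
          case True
          have "monom_on F (set F) b x = monom_on F (set G) b x"
            using True G(1) by (intro monom_on_superset) (auto simp: labels_def)
          also have "\<dots> = monom_on G (set G) b x"
            unfolding monom_on_def
            by (intro prod.cong refl) (simp add: hcoord_subset(1)[OF F(1) G(1) body_hspan[OF x]])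
          finally show ?thesis using True by simp
        next
          case False
          then obtain v where v: "v \<notin> set G" "b v \<noteq> 0"
            using b labels_superset_iff[OF finite_set G(1)] by blast
          then have "v \<in> set F" using b by (auto simp: labels_def)
          then have "monom_on F (set F) b x = 0"
            unfolding monom_on_def using v hcoord_subset(2)[OF F(1) G(1) body_hspan[OF x]]
            by (intro prod_zero) auto
          then show ?thesis using False by simp
        qed
        have sub_labels: "labels (set G) r \<subseteq> ?L"
          using labels_superset_iff[OF finite_set G(1)] by blast
        have "(\<Sum>b\<in>labels (set G) r. B b * of_real (monom_on G (set G) b x)) =
            (\<Sum>b\<in>?L. B b * of_real (monom_on F (set F) b x))"
          using sub_labels finite_labels[OF finite_set]
          by (intro sum.mono_neutral_cong_left) (auto simp: mono)
        also have "\<dots> = (\<Sum>(b, \<sigma>)\<in>?L \<times> ?S. c (b, \<sigma>) *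
            of_real (det_of k (\<lambda>i l. hcoord (set F) (F ! (\<sigma> ! i)) (ws ! l, 0))) * of_real (monom_on F (set F) b x))"
          unfolding B_def sum_distrib_right sum.cartesian_product ..
        also have "\<dots> = (\<Sum>i\<in>?L \<times> ?S. form_scale (c i) (?g i) x ws)"
        proof (intro sum.cong refl)
          fix i assume "i \<in> ?L \<times> ?S"
          then obtain b \<sigma> where i: "i = (b, \<sigma>)" "\<sigma> \<in> ?S" by auto
          have len: "length \<sigma> = k" using i(2) by (simp add: increasing_def)
          have "det_of k (\<lambda>i l. hcoord (set F) (map ((!) F) \<sigma> ! i) (ws ! l, 0)) =
              det_of k (\<lambda>i l. hcoord (set F) (F ! (\<sigma> ! i)) (ws ! l, 0))"
            using len by (intro det_of_cong) simp
          then show "(case i of (b, \<sigma>) \<Rightarrow> c (b, \<sigma>) *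
            of_real (det_of k (\<lambda>i l. hcoord (set F) (F ! (\<sigma> ! i)) (ws ! l, 0))) * of_real (monom_on F (set F) b x)) =
            form_scale (c i) (?g i) x ws"
            using domF len by (simp add: i(1) form_scale_def gen_full_self[OF F(1)])
        qed
        also have "\<dots> = \<omega> x ws" unfolding c(1) sum_form_apply ..
        also have "\<dots> = 0" by fact
        finally show "(\<Sum>b\<in>labels (set G) r. B b * of_real (monom_on G (set G) b x)) = 0" .
      qed
      moreover have "B a = (\<Sum>\<sigma>\<in>?S. if \<sigma> = \<sigma>' then c (a, \<sigma>') else 0)"
        unfolding B_def
      proof (intro sum.cong refl)
        fix \<sigma> assume \<sigma>: "\<sigma> \<in> ?S"
        show "c (a, \<sigma>) * of_real (det_of k (\<lambda>i l. hcoord (set F) (F ! (\<sigma> ! i)) (ws ! l, 0))) =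
          (if \<sigma> = \<sigma>' then c (a, \<sigma>') else 0)"
        proof (cases "j a \<in> (!) F ` set \<sigma>")
          case True
          \<comment> \<open>The differential at the pivot takes the value \<open>-1\<close> on the
            dual vectors, but lists containing the pivot carry no coefficient.\<close>
          then have "c (a, \<sigma>) = 0" by (intro c(2)) auto
          then show ?thesis using True False by auto
        next
          case jn: False
          have len: "length \<sigma> = k" using \<sigma> by (simp add: increasing_def)
          have "det_of k (\<lambda>i l. hcoord (set F) (F ! (\<sigma> ! i)) (ws ! l, 0)) =
              det_of k (\<lambda>i l. if \<sigma> ! i = \<sigma>' ! l then 1 else 0)"
          proof (rule det_of_cong)
            fix i l assume il: "i < k" "l < k"
            have b: "\<sigma> ! i < length F" "\<sigma>' ! l < length F"
              using nth_bound[OF \<sigma>] nth_bound[OF \<sigma>'] len \<sigma>'_len il by auto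
            have "j a \<noteq> F ! (\<sigma> ! i)" using jn len il by auto
            then show "hcoord (set F) (F ! (\<sigma> ! i)) (ws ! l, 0) = (if \<sigma> ! i = \<sigma>' ! l then 1 else 0)"
              using b il \<sigma>'_len j(2)[OF a] F(2) hcoord_diff_vertices[OF F(1), of "F ! (\<sigma>' ! l)" "j a"]
              by (auto simp: ws_def nth_eq_iff_index_eq)
          qed
          then show ?thesis using det_of_increasing[OF \<sigma> \<sigma>'] by simp
        qed
      qed
      moreover have "(\<Sum>\<sigma>\<in>?S. if \<sigma> = \<sigma>' then c (a, \<sigma>') else 0) = c (a, \<sigma>')"
        using \<sigma>' by (simp add: sum.delta[OF finite_increasing])
      ultimately show ?thesis by simp
    qed
    show "\<omega> \<in> form.span (full_gens F r k (\<lambda>U. U = set F))"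
      unfolding c(1)
    proof (rule form.span_sum)
      fix i assume i: "i \<in> ?L \<times> ?S"
      obtain a \<sigma> where as: "i = (a, \<sigma>)" by (cases i)
      show "form_scale (c i) (?g i) \<in> form.span (full_gens F r k (\<lambda>U. U = set F))"
      proof (cases "{v. a v > 0} \<union> (!) F ` set \<sigma> = set F")
        case True
        then have "?g i \<in> full_gens F r k (\<lambda>U. U = set F)"
          using i increasing_bound[OF F(3), of \<sigma> k]
          by (auto simp: as full_gens_def increasing_def intro!: exI[of _ a] exI[of _ "map ((!) F) \<sigma>"])
        then show ?thesis by (intro form.span_scale form.span_base)
      next
        case False
        then have "c i = 0" using i c0 as by blast
        then show ?thesis by (simp only: form.scale_zero_left form.span_zero)
      qed
    qed
  qed
qed

end

text \<open>The existence argument yields no formula, so the operator is handed over as some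
  globally linear \<open>E\<close> together with its values on generators.\<close>

lemma ext_full_eq:
  fixes T F :: "'a::euclidean_space list"
  assumes T: "\<not> affine_dependent (set T)" "distinct T" "T \<noteq> []"
    and F: "set F \<subseteq> set T" "distinct F" "F \<noteq> []" and r: "r > 0"
  obtains E :: "('a, 'f::real_normed_field) form \<Rightarrow> ('a, 'f) form" where "form_linear E"
    "\<And>a s. a \<in> labels (set F) r \<Longrightarrow> length s = k \<Longrightarrow> set s \<subseteq> set F \<Longrightarrow>
      E (gen_full F (set F) a s) = gen_full T (set F) a s"
    "ext_full k r F T = restrict E (Pfull0 r k F)"
proof -
  have F': "\<not> affine_dependent (set F)" using T(1) F(1) affine_dependent_subset by blast
  obtain E :: "('a, 'f) form \<Rightarrow> ('a, 'f) form" where E: "form_linear E"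
    "\<And>a s. a \<in> labels (set F) r \<Longrightarrow> length s = k \<Longrightarrow> set s \<subseteq> set F \<Longrightarrow>
      E (gen_full F (set F) a s) = gen_full T (set F) a s"
    using full_ext_exists[OF T(1) F(1,3) r, of k] by blast
  have "ext_full k r F T = restrict E (Pfull0 r k F)"
    unfolding ext_full_def
  proof (rule extension_operator_unique[OF _ E(1)])
    show "Pfull0 r k F = form.span {fun_mult (bary_monom F \<alpha>) (dbary_wedge F \<sigma>) :: ('a, 'f) form | \<alpha> \<sigma>.
        \<alpha> \<in> multiindices r (sdim F) \<and> \<sigma> \<in> increasing k (sdim F) \<and> supp \<alpha> \<union> set \<sigma> = {0..sdim F}}"
      unfolding Pfull0_eq_span[OF F' F(2,3) r] span_full_gens[OF F' F(2,3), symmetric]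
      by (intro arg_cong[where f = form.span] Collect_cong ex_cong1)
        (simp add: nth_image_full_iff[OF F' F(2,3)] cong: conj_cong)
    show "E \<omega> \<in> Pfull r k T" if "\<omega> \<in> Pfull0 r k F" for \<omega>
      using that unfolding Pfull0_eq_span[OF F' F(2,3) r] Pfull_eq_span[OF T]
    proof (rule form_linear_image_span[OF E(1), rotated])
      fix \<omega> :: "('a, 'f) form" assume "\<omega> \<in> full_gens F r k (\<lambda>U. U = set F)"
      then obtain a s where \<omega>: "\<omega> = gen_full F (set F) a s" "a \<in> labels (set F) r"
        "length s = k" "set s \<subseteq> set F" by (auto simp: full_gens_def)
      let ?C = "\<lambda>i u. (if s ! i = u then 1 else 0) -
        (if u \<in> set F then of_nat (a (s ! i)) / of_nat (sum a (set F)) else (0::real))"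
      have "(gen_full T (set F) a s :: ('a, 'f) form) \<in>
        form.span {gen_full T (set T) a s' | s'. length s' = k \<and> set s' \<subseteq> set T}"
      proof (rule gen_full_expand[OF T(1) finite_set \<omega>(3), where C = ?C])
        show "monom_on T (set F) a x = monom_on T (set T) a x" for x
          using F(1) \<omega>(2) by (intro monom_on_superset[symmetric]) (auto simp: labels_def)
        fix i w assume i: "i < k"
        have si: "s ! i \<in> set T" using i \<omega>(3,4) F(1) by (metis nth_mem subsetD)
        have "(\<Sum>u\<in>set T. ?C i u * hcoord (set T) u (w, 0)) =
          (\<Sum>u\<in>set T. if s ! i = u then hcoord (set T) u (w, 0) else 0) -
          (\<Sum>u\<in>set T. if u \<in> set F then of_nat (a (s ! i)) / of_nat (sum a (set F)) * hcoord (set T) u (w, 0) else 0)"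
          unfolding sum_subtractf[symmetric] by (intro sum.cong) (auto simp: left_diff_distrib)
        also have "\<dots> = psi T (set F) a (s ! i) w"
          using si F(1) by (simp add: psi_def sum.If_cases Int_absorb1 sum_distrib_left)
        finally show "psi T (set F) a (s ! i) w = (\<Sum>u\<in>set T. ?C i u * hcoord (set T) u (w, 0))" by simp
      qed
      moreover have "a \<in> labels (set T) r"
        using \<omega>(2) labels_superset_iff[OF finite_set F(1)] by blast
      then have "{gen_full T (set T) a s' | s'. length s' = k \<and> set s' \<subseteq> set T} \<subseteq>
          (full_gens T r k (\<lambda>_. True) :: ('a, 'f) form set)"
        by (auto simp: full_gens_def)
      ultimately show "E \<omega> \<in> form.span (full_gens T r k (\<lambda>_. True))"
        unfolding \<omega>(1) E(2)[OF \<omega>(2-4)] using form.span_mono by blast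
    qed
    fix \<alpha> \<sigma> assume *: "\<alpha> \<in> multiindices r (sdim F)" "\<sigma> \<in> increasing k (sdim F)"
    note b = increasing_bound[OF F(3) *(2)]
    have \<sigma>: "length \<sigma> = k" using *(2) by (auto simp: increasing_def)
    let ?a = "vlabel F \<alpha>" and ?s = "map ((!) F) \<sigma>"
    have "fun_mult (bary_monom F \<alpha>) (dbary_wedge F \<sigma>) = (gen_full F (set F) ?a ?s :: ('a, 'f) form)"
      using b by (intro full_generator F' F)
    moreover have "fun_mult (bary_monom T (multi_push F T \<alpha>))
        (wedge T (map (Psi (multi_push F T \<alpha>) F T) (map (vidx F T) \<sigma>))) =
        (gen_full T (set F) ?a ?s :: ('a, 'f) form)"
      using b by (intro ext_full_generator T F)
    moreover have "E (gen_full F (set F) ?a ?s) = gen_full T (set F) ?a ?s"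
      using b \<sigma> by (intro E(2) vlabel_in_labels F *) auto
    ultimately show "E (fun_mult (bary_monom F \<alpha>) (dbary_wedge F \<sigma>)) =
      fun_mult (bary_monom T (multi_push F T \<alpha>))
        (wedge T (map (Psi (multi_push F T \<alpha>) F T) (map (vidx F T) \<sigma>)))"
      by (simp only:)
  qed
  with E that show ?thesis by blast
qed

text \<open>A pulled-back exponent \<open>a \<circ> S\<close> need not vanish off \<open>F\<close>,
  while a label must. Only values on \<open>Y\<close> matter; the condition on \<open>s\<close> is
  there because \<open>psi\<close> also reads the exponent at the entries of
  \<open>s\<close>.\<close>

lemma
  assumes "\<And>v. v \<in> Y \<Longrightarrow> a v = b v"
  shows gen_full_cong: "set s \<subseteq> Y \<Longrightarrow> gen_full T Y a s = gen_full T Y b s"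
    and gen_minus_cong: "gen_minus T Y a s = gen_minus T Y b s"
proof -
  have m: "monom_on T Y a = monom_on T Y b"
    by (intro ext) (auto simp: monom_on_def assms intro!: prod.cong)
  have "sum a Y = sum b Y" by (intro sum.cong assms) auto
  then have p: "psi T Y a u = psi T Y b u" if "u \<in> Y" for u
    using assms[OF that] by (intro ext) (simp add: psi_def)
  show "gen_full T Y a s = gen_full T Y b s" if "set s \<subseteq> Y"
  proof -
    have "det_of (length s) (\<lambda>i j. psi T Y a (s ! i) (vs ! j)) = det_of (length s) (\<lambda>i j. psi T Y b (s ! i) (vs ! j))" for vs
      using that by (intro det_of_cong) (metis nth_mem p subsetD)
    then show ?thesis by (simp only: gen_full_def m)
  qed
  show "gen_minus T Y a s = gen_minus T Y b s" by (simp only: gen_minus_def m)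
qed

section \<open>Affine automorphisms and the main theorem\<close>

text \<open>Vertices are the extreme points of the body, and an affine bijection preserves these: a
  segment through \<open>S v\<close> pulls back to one through \<open>v\<close>.\<close>

lemma Sym_vertex:
  assumes T: "\<not> affine_dependent (set T)" and S: "S \<in> Sym T" and v: "v \<in> set T"
  shows "S v \<in> set T"
proof -
  have bij: "bij_betw S (body T) (body T)"
    and seg: "\<And>x y t. x \<in> body T \<Longrightarrow> y \<in> body T \<Longrightarrow> 0 \<le> t \<Longrightarrow> t \<le> 1 \<Longrightarrow>
      S ((1 - t) *\<^sub>R x + t *\<^sub>R y) = (1 - t) *\<^sub>R S x + t *\<^sub>R S y"
    using S by (auto simp: Sym_def)
  have ext: "x extreme_point_of body T \<longleftrightarrow> x \<in> set T" for x
    using extreme_point_of_convex_hull_affine_independent[OF T] by (simp add: body_def)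
  have conv: "convex (body T)" by (simp add: body_def)
  have vb: "v \<in> body T" using v by (simp add: body_def hull_inc)
  have "S v extreme_point_of body T"
    unfolding extreme_point_of_def
  proof (intro conjI ballI notI)
    show "S v \<in> body T" using bij vb by (rule bij_betw_apply)
    fix a b assume ab: "a \<in> body T" "b \<in> body T" "S v \<in> open_segment a b"
    obtain a' b' where ab': "a' \<in> body T" "a = S a'" "b' \<in> body T" "b = S b'"
      using ab(1,2) bij by (metis bij_betw_imp_surj_on imageE)
    obtain t where t: "a \<noteq> b" "0 < t" "t < 1" "S v = (1 - t) *\<^sub>R a + t *\<^sub>R b"
      using ab(3) by (auto simp: in_segment)
    let ?w = "(1 - t) *\<^sub>R a' + t *\<^sub>R b'"
    have w: "?w \<in> body T" using conv ab' t by (simp add: convex_alt)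
    have "S v = S ?w" using seg[OF ab'(1,3), of t] t ab' by simp
    then have "v = ?w" using bij_betw_imp_inj_on[OF bij] vb w by (meson inj_onD)
    then have "v \<in> open_segment a' b'" using t ab' by (auto simp: in_segment)
    then show False using ext[of v] v ab' by (auto simp: extreme_point_of_def)
  qed
  then show ?thesis by (simp add: ext)
qed

text \<open>\<open>S\<close> is known to respect convex combinations only on the body. The lift is
  prescribed on the independent lifted vertices; the points where it agrees with \<open>S\<close>
  form a convex set containing all vertices.\<close>

lemma Sym_linear_lift:
  assumes T: "\<not> affine_dependent (set T)" and S: "S \<in> Sym T"
  obtains A where "linear A" "\<And>v. v \<in> set T \<Longrightarrow> A (v, 1 :: real) = (S v, 1 :: real)"
    "\<And>x. x \<in> body T \<Longrightarrow> S x = fst (A (x, 1))"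
proof -
  obtain A where A: "linear A" "\<forall>z\<in>(\<lambda>u. (u, 1::real)) ` set T. A z = (S (fst z), 1::real)"
    using linear_independent_extend[OF independent_lift[OF T], of "\<lambda>z. (S (fst z), 1::real)"] by blast
  have seg: "\<And>x y t. x \<in> body T \<Longrightarrow> y \<in> body T \<Longrightarrow> 0 \<le> t \<Longrightarrow> t \<le> 1 \<Longrightarrow>
      S ((1 - t) *\<^sub>R x + t *\<^sub>R y) = (1 - t) *\<^sub>R S x + t *\<^sub>R S y"
    using S by (auto simp: Sym_def)
  let ?C = "{x \<in> body T. S x = fst (A (x, 1))}"
  have conv: "convex (body T)" by (simp add: body_def)
  have "convex ?C"
    unfolding convex_alt
  proof (intro ballI allI impI)
    fix x y t assume xy: "x \<in> ?C" "y \<in> ?C" and t: "0 \<le> t \<and> t \<le> (1::real)"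
    let ?w = "(1 - t) *\<^sub>R x + t *\<^sub>R y"
    have "(?w, 1) = (1 - t) *\<^sub>R (x, 1::real) + t *\<^sub>R (y, 1)" by simp
    then have "A (?w, 1) = (1 - t) *\<^sub>R A (x, 1) + t *\<^sub>R A (y, 1)"
      by (simp only: linear_add[OF A(1)] linear_scale[OF A(1)])
    then show "?w \<in> ?C" using xy t seg[of x y t] conv by (simp add: convex_alt)
  qed
  moreover have "set T \<subseteq> ?C" using A(2) by (auto simp: body_def hull_inc)
  ultimately have "body T \<subseteq> ?C" unfolding body_def[of T] by (intro hull_minimal) auto
  then show ?thesis using that[of A] A by auto
qed

lemma simplicial_map_Sym:
  assumes T: "\<not> affine_dependent (set T)" and S: "S \<in> Sym T" and F: "set F \<subseteq> set T"
    and F': "S ` set F \<subseteq> set F'" "set F' \<subseteq> set T"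
  shows "\<exists>A. simplicial_map F F' A S S"
proof -
  obtain A where A: "linear A" "\<And>v. v \<in> set T \<Longrightarrow> A (v, 1 :: real) = (S v, 1 :: real)"
    "\<And>x. x \<in> body T \<Longrightarrow> S x = fst (A (x, 1))"
    using Sym_linear_lift[OF T S] by blast
  have "bij_betw S (body T) (body T)" using S by (auto simp: Sym_def)
  moreover have "set T \<subseteq> body T" by (simp add: body_def hull_subset)
  ultimately have "inj_on S (set T)" using bij_betw_imp_inj_on inj_on_subset by blast
  then have "inj_on S (set F)" using F by (rule inj_on_subset)
  then have "simplicial_map F F' A S S"
    using A F F' body_subset[OF F] T affine_dependent_subset[of "set F" "set T"]
      affine_dependent_subset[of "set F'" "set T"]
    by (intro simplicial_map.intro) auto
  then show ?thesis by (intro exI[of _ A])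
qed

lemma set_image_simplex:
  assumes "\<not> affine_dependent (set T)" "S \<in> Sym T" "set F \<subseteq> set T"
  shows "set (image_simplex S F T) = S ` set F"
  using Sym_vertex[OF assms(1,2)] assms(3) by (auto simp: image_simplex_def)

lemma relabel:
  fixes S :: "'a \<Rightarrow> 'a"
  assumes inj: "inj_on S Y" and a: "a \<in> labels (S ` Y) r" and s: "set s \<subseteq> S ` Y"
    and full: "{v. a v > 0} \<union> set s = S ` Y"
  obtains b s' where "b \<in> labels Y r" "\<And>v. v \<in> Y \<Longrightarrow> b v = (a \<circ> S) v"
    "s = map S s'" "set s' \<subseteq> Y" "{v. b v > 0} \<union> set s' = Y"
proof
  \<comment> \<open>Truncated because \<open>a \<circ> S\<close> may be nonzero off
    \<open>Y\<close>.\<close>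
  let ?b = "\<lambda>v. if v \<in> Y then a (S v) else 0"
  let ?s = "map (inv_into Y S) s"
  show "?b \<in> labels Y r" using a by (simp add: labels_def sum.reindex[OF inj])
  show "?b v = (a \<circ> S) v" if "v \<in> Y" for v using that by simp
  show s': "s = map S ?s" using s by (simp add: map_idI f_inv_into_f subset_iff)
  show sub: "set ?s \<subseteq> Y" using s by (auto intro: inv_into_into)
  show "{v. ?b v > 0} \<union> set ?s = Y"
  proof (intro antisym subsetI)
    fix v assume v: "v \<in> Y"
    then have "a (S v) > 0 \<or> S v \<in> set s" using full by blast
    moreover have "v \<in> set ?s" if "S v \<in> set s"
      using that v inj by (metis image_eqI inv_into_f_f list.set_map)
    ultimately show "v \<in> {v. ?b v > 0} \<union> set ?s" using v by auto
  qed (use sub in \<open>auto split: if_splits\<close>)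
qed

theorem theorem7p7:
  fixes k r n m :: nat
    and T F :: "'a::euclidean_space list"
    and S :: "'a \<Rightarrow> 'a"
  assumes "r > 0"
    and "is_simplex n T"
    and "subsimplex F T" and "is_simplex m F"
    and "S \<in> Sym T"
  shows "(\<forall>\<omega> \<in> (Pfull0 r k (image_simplex S F T) :: ('a, 'f::real_normed_field) form set).
            ext_full k r F T (pullback F k S \<omega>) =
            pullback T k S (ext_full k r (image_simplex S F T) T \<omega>)) \<and>
         (\<forall>\<omega> \<in> (Pminus0 r k (image_simplex S F T) :: ('a, 'f) form set).
            ext_minus k r F T (pullback F k S \<omega>) =
            pullback T k S (ext_minus k r (image_simplex S F T) T \<omega>))"
proof -
  let ?F' = "image_simplex S F T"
  have T: "\<not> affine_dependent (set T)" "distinct T" "T \<noteq> []"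
    using assms(2) by (auto simp: is_simplex_def)
  have F: "set F \<subseteq> set T" "distinct F" "F \<noteq> []" and indep_F: "\<not> affine_dependent (set F)"
    using assms(3,4) subsimplex_set by (auto simp: is_simplex_def)
  have set_F': "set ?F' = S ` set F"
    by (rule set_image_simplex[OF T(1) assms(5) F(1)])
  then have "?F' \<noteq> []" using F(3) by (metis image_is_empty set_empty)
  then have F': "set ?F' \<subseteq> set T" "distinct ?F'" "?F' \<noteq> []"
    using T(2) by (auto simp: image_simplex_def)
  have indep_F': "\<not> affine_dependent (set ?F')"
    using T(1) F'(1) affine_dependent_subset by blast
  obtain A where "simplicial_map F ?F' A S S"
    using simplicial_map_Sym[OF T(1) assms(5) F(1) _ F'(1)] set_F' by blast
  then interpret face: simplicial_map F ?F' A S S .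
  \<comment> \<open>The same \<open>S\<close> is needed twice: on \<open>F\<close> for the pullback
    before extension, and on \<open>T\<close> for the pullback after it.\<close>
  have "S ` set T \<subseteq> set T" using Sym_vertex[OF T(1) assms(5)] by blast
  then obtain A' where "simplicial_map T T A' S S"
    using simplicial_map_Sym[OF T(1) assms(5), of T T] by blast
  then interpret whole: simplicial_map T T A' S S .

  have full: "ext_full k r F T (pullback F k S \<omega>) = pullback T k S (ext_full k r ?F' T \<omega>)"
    if \<omega>: "\<omega> \<in> Pfull0 r k ?F'" for \<omega> :: "('a, 'f) form"
  proof -
    obtain E :: "('a, 'f) form \<Rightarrow> ('a, 'f) form" where E: "form_linear E"
      "\<And>a s. a \<in> labels (set F) r \<Longrightarrow> length s = k \<Longrightarrow> set s \<subseteq> set F \<Longrightarrow>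
        E (gen_full F (set F) a s) = gen_full T (set F) a s"
      "ext_full k r F T = restrict E (Pfull0 r k F)"
      using ext_full_eq[OF T F assms(1), of k] by blast
    obtain E' :: "('a, 'f) form \<Rightarrow> ('a, 'f) form" where E': "form_linear E'"
      "\<And>a s. a \<in> labels (set ?F') r \<Longrightarrow> length s = k \<Longrightarrow> set s \<subseteq> set ?F' \<Longrightarrow>
        E' (gen_full ?F' (set ?F') a s) = gen_full T (set ?F') a s"
      "ext_full k r ?F' T = restrict E' (Pfull0 r k ?F')"
      using ext_full_eq[OF T F' assms(1), of k] by blast
    have \<omega>_span: "\<omega> \<in> form.span (full_gens ?F' r k (\<lambda>U. U = set ?F'))"
      using \<omega> by (simp only: Pfull0_eq_span[OF indep_F' F'(2,3) assms(1)])
    \<comment> \<open>Both sides are linear in the form, so generators suffice; that the pullback is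
      again a generator involving all vertices puts it in the domain of the operator for
      \<open>F\<close>.\<close>
    have gens: "pullback F k S \<eta> \<in> full_gens F r k (\<lambda>U. U = set F) \<and>
        E (pullback F k S \<eta>) = pullback T k S (E' \<eta>)"
      if \<eta>_in: "\<eta> \<in> full_gens ?F' r k (\<lambda>U. U = set ?F')" for \<eta> :: "('a, 'f) form"
    proof -
      obtain a s where \<eta>: "\<eta> = gen_full ?F' (set ?F') a s" "a \<in> labels (set ?F') r" "length s = k"
        "set s \<subseteq> set ?F'" "{v. a v > 0} \<union> set s = set ?F'"
        using \<eta>_in unfolding full_gens_def by blast
      obtain b s' where b: "b \<in> labels (set F) r" "\<And>v. v \<in> set F \<Longrightarrow> b v = (a \<circ> S) v"
        "s = map S s'" "set s' \<subseteq> set F" "{v. b v > 0} \<union> set s' = set F"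
        by (rule relabel[OF face.inj \<eta>(2,4,5)[unfolded set_F']]) (rule that)
      have len: "length s' = k" using \<eta>(3) b(3) by simp
      have cong: "gen_full G (set F) (a \<circ> S) s' = (gen_full G (set F) b s' :: ('a, 'f) form)" for G
        by (rule gen_full_cong) (use b in auto)
      have pull: "pullback F k S \<eta> = gen_full F (set F) b s'"
      proof -
        have "pullback F (length s') S (gen_full ?F' (S ` set F) a (map S s')) =
            (gen_full F (set F) (a \<circ> S) s' :: ('a, 'f) form)"
          by (rule face.pullback_gen_full[OF order_refl b(4)])
        then show ?thesis using len by (simp add: \<eta>(1) b(3) set_F' cong)
      qed
      have "pullback T k S (gen_full T (set ?F') a s) = (gen_full T (set F) b s' :: ('a, 'f) form)"
      proof -
        have "pullback T (length s') S (gen_full T (S ` set F) a (map S s')) =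
            (gen_full T (set F) (a \<circ> S) s' :: ('a, 'f) form)"
          by (rule whole.pullback_gen_full[OF F(1) subset_trans[OF b(4) F(1)]])
        then show ?thesis using len by (simp add: b(3) set_F' cong)
      qed
      then have "E (pullback F k S \<eta>) = pullback T k S (E' \<eta>)"
        unfolding pull E(2)[OF b(1) len b(4)] unfolding \<eta>(1) E'(2)[OF \<eta>(2-4)] by (rule sym)
      moreover have "pullback F k S \<eta> \<in> full_gens F r k (\<lambda>U. U = set F)"
        unfolding pull full_gens_def using b len by blast
      ultimately show ?thesis by blast
    qed
    \<comment> \<open>\<open>ext_full\<close> is a restricted function, with an unspecified value
      off \<open>Pfull0\<close>, so membership comes before the replacement by
      \<open>E\<close>.\<close>
    have "pullback F k S \<omega> \<in> Pfull0 r k F"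
      unfolding Pfull0_eq_span[OF indep_F F(2,3) assms(1)]
      using form_linear_pullback _ \<omega>_span
      by (rule form_linear_image_span) (use gens form.span_base in blast)
    moreover have "E (pullback F k S \<omega>) = pullback T k S (E' \<omega>)"
      using gens by (intro form_linear_eq_on_span[OF form_linear_compose[OF E(1) form_linear_pullback]
            form_linear_compose[OF form_linear_pullback E'(1)] _ \<omega>_span]) blast
    ultimately show ?thesis using \<omega> by (simp add: E(3) E'(3))
  qed

  have minus: "ext_minus k r F T (pullback F k S \<omega>) = pullback T k S (ext_minus k r ?F' T \<omega>)"
    if \<omega>: "\<omega> \<in> Pminus0 r k ?F'" for \<omega> :: "('a, 'f) form"
  proof -
    \<comment> \<open>Although the projection formula is explicit, equivariance is checked on
      generators, as for the other family.\<close>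
    let ?E = "minus_ext T (set F) k r :: ('a, 'f) form \<Rightarrow> ('a, 'f) form"
    let ?E' = "minus_ext T (set ?F') k r :: ('a, 'f) form \<Rightarrow> ('a, 'f) form"
    have \<omega>_span: "\<omega> \<in> form.span (minus_gens ?F' (r - 1) (Suc k) (\<lambda>U. U = set ?F'))"
      using \<omega> by (simp only: Pminus0_eq_span[OF indep_F' F'(2,3) assms(1)])
    have gens: "pullback F k S \<eta> \<in> minus_gens F (r - 1) (Suc k) (\<lambda>U. U = set F) \<and>
        ?E (pullback F k S \<eta>) = pullback T k S (?E' \<eta>)"
      if \<eta>_in: "\<eta> \<in> minus_gens ?F' (r - 1) (Suc k) (\<lambda>U. U = set ?F')" for \<eta> :: "('a, 'f) form"
    proof -
      obtain a s where \<eta>: "\<eta> = gen_minus ?F' (set ?F') a s" "a \<in> labels (set ?F') (r - 1)"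
        "length s = Suc k" "set s \<subseteq> set ?F'" "{v. a v > 0} \<union> set s = set ?F'"
        using \<eta>_in unfolding minus_gens_def by blast
      obtain b s' where b: "b \<in> labels (set F) (r - 1)" "\<And>v. v \<in> set F \<Longrightarrow> b v = (a \<circ> S) v"
        "s = map S s'" "set s' \<subseteq> set F" "{v. b v > 0} \<union> set s' = set F"
        by (rule relabel[OF face.inj \<eta>(2,4,5)[unfolded set_F']]) (rule that)
      have len: "length s' = Suc k" using \<eta>(3) b(3) by simp
      have cong: "gen_minus G (set F) (a \<circ> S) s' = (gen_minus G (set F) b s' :: ('a, 'f) form)" for G
        by (rule gen_minus_cong) (use b in auto)
      have pull: "pullback F k S \<eta> = gen_minus F (set F) b s'"
      proof -
        have "pullback F (length s' - 1) S (gen_minus ?F' (S ` set F) a (map S s')) =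
            (gen_minus F (set F) (a \<circ> S) s' :: ('a, 'f) form)"
          by (rule face.pullback_gen_minus[OF order_refl b(4)])
        then show ?thesis using len by (simp add: \<eta>(1) b(3) set_F' cong)
      qed
      have "pullback T k S (gen_minus T (set ?F') a s) = (gen_minus T (set F) b s' :: ('a, 'f) form)"
      proof -
        have "pullback T (length s' - 1) S (gen_minus T (S ` set F) a (map S s')) =
            (gen_minus T (set F) (a \<circ> S) s' :: ('a, 'f) form)"
          by (rule whole.pullback_gen_minus[OF F(1) subset_trans[OF b(4) F(1)]])
        then show ?thesis using len by (simp add: b(3) set_F' cong)
      qed
      then have "?E (pullback F k S \<eta>) = pullback T k S (?E' \<eta>)"
        unfolding pull minus_ext_generator[OF T(1) F(1) assms(1) b(1) len b(4)]
        unfolding \<eta>(1) minus_ext_generator[OF T(1) F'(1) assms(1) \<eta>(2-4)] by (rule sym)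
      moreover have "pullback F k S \<eta> \<in> minus_gens F (r - 1) (Suc k) (\<lambda>U. U = set F)"
        unfolding pull minus_gens_def using b len by blast
      ultimately show ?thesis by blast
    qed
    have "pullback F k S \<omega> \<in> Pminus0 r k F"
      unfolding Pminus0_eq_span[OF indep_F F(2,3) assms(1)]
      using form_linear_pullback _ \<omega>_span
      by (rule form_linear_image_span) (use gens form.span_base in blast)
    moreover have "?E (pullback F k S \<omega>) = pullback T k S (?E' \<omega>)"
      using gens by (intro form_linear_eq_on_span[OF
            form_linear_compose[OF form_linear_minus_ext form_linear_pullback]
            form_linear_compose[OF form_linear_pullback form_linear_minus_ext] _ \<omega>_span]) blast
    ultimately show ?thesis
      using \<omega> by (simp add: ext_minus_eq[OF T F assms(1)] ext_minus_eq[OF T F' assms(1)])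
  qed

  show ?thesis using full minus by blast
qed

end
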